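(* Let $\mathbb{G}_1,\mathbb{G}_2$ be monoidally equivalent compact quantum groups, with monoidal equivalence $\varphi:\mathbb{G}_2\to\mathbb{G}_1$, link algebra $\mathcal{B}$, unitaries $X^x$ ($x\in\mathrm{Irred}(\mathbb{G}_2)$) and commuting ergodic actions $\delta_1:\mathcal{B}\to\mathcal{C}(\mathbb{G}_1)\otimes_{\rm alg}\mathcal{B}$, $\delta_2:\mathcal{B}\to\mathcal{B}\otimes_{\rm alg}\mathcal{C}(\mathbb{G}_2)$. Let $\alpha_1:D_1\to D_1\otimes C(\mathbb{G}_1)$ be an action of $\mathbb{G}_1$ on a unital C$^*$-algebra $D_1$, with underlying Hopf $^*$-algebra action $\alpha_1:\mathcal{D}_1\to\mathcal{D}_1\otimes_{\rm alg}\mathcal{C}(\mathbb{G}_1)$ on its spectral subalgebra $\mathcal{D}_1$. Put $$\mathcal{D}_2:=\mathcal{D}_1\boxtimes_{\rm alg}^{\alpha_1}\mathcal{B}=\{a\in\mathcal{D}_1\otimes_{\rm alg}\mathcal{B}\mid(\alpha_1\otimes\mathrm{id})(a)=(\mathrm{id}\otimes\delta_1)(a)\},$$ and let $\alpha_2:=\mathrm{id}\boxtimes\delta_2$ be the action of $\mathbb{G}_2$ on $\mathcal{D}_2$ given by restricting $\mathrm{id}\otimes\delta_2$. Then: 1. $a\mapsto a\otimes 1$ is a $^*$-isomorphism from the fixed point algebra $\mathcal{D}_1^{\alpha_1}$ of $\alpha_1$ onto the fixed point algebra $\mathcal{D}_2^{\alpha_2}$ of $\alpha_2$. 2. For $x\in\mathrm{Irred}(\mathbb{G}_2)$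 let $K_{\varphi(x)}$ be the spectral subspace of $\alpha_1$ associated with $\varphi(x)$ and $K_x$ the spectral subspace of $\alpha_2$ associated with $x$. The map $T_x:K_{\varphi(x)}\to K_x$, $v\mapsto v_{12}X^x_{13}$, is an isomorphism of bimodules over the fixed point algebra (the fixed point algebras being identified by item 1). Moreover $T_x$ is a unitary element of $\mathcal{L}(K_{\varphi(x)},K_x)$ both for the inner products $\langle\cdot,\cdot\rangle_l$ and for the inner products $\langle\cdot,\cdot\rangle_r$. 3. The family $(T_x)_{x\in\mathrm{Irred}(\mathbb{G}_2)}$ respects the monoidal structure: for all $x,y,z\in\mathrm{Irred}(\mathbb{G}_2)$, $V\in\mathrm{Mor}(x\otimes y,z)$, $v\in K_{\varphi(x)}$, $w\in K_{\varphi(y)}$, $$T_x(v)_{13}\,T_y(w)_{23}\,(V\otimes 1)=T_z\bigl(v_{13}w_{23}(\varphi(V)\otimes 1)\bigr).$$ 4. If $\alpha_1$ is ergodic, then $\alpha_2$ is ergodic, and for all $x\in\mathrm{Irred}(\mathbb{G}_2)$ the quantum multiplicity of $x$ in $\alpha_2$ equals the quantum multiplicity of $\varphi(x)$ in $\alpha_1$: $\mathrm{mult}_q(x)=\mathrm{mult}_q(\varphi(x))$.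
   Context: Compact quantum groups. A compact quantum group $\mathbb{G}=(C(\mathbb{G}),\Delta)$ is a unital C$^*$-algebra with a coassociative unital $^*$-homomorphism $\Delta:C(\mathbb{G})\to C(\mathbb{G})\otimes C(\mathbb{G})$ such that $\Delta(C(\mathbb{G}))(1\otimes C(\mathbb{G}))$ and $\Delta(C(\mathbb{G}))(C(\mathbb{G})\otimes1)$ are total in $C(\mathbb{G})\otimes C(\mathbb{G})$; $h$ is its Haar state. A unitary representation on a finite-dimensional $H$ is a unitary $U\in\mathcal{L}(H)\otimes C(\mathbb{G})$ with $(\mathrm{id}\otimes\Delta)(U)=U_{12}U_{13}$ (leg numbering notation). $\mathrm{Mor}(U^1,U^2)=\{T\in\mathcal{L}(H_2,H_1)\mid U^1(T\otimes1)=(T\otimes1)U^2\}$. The tensor product of $U^1,U^2$ is $U^1_{13}U^2_{23}$. $\mathrm{Irred}(\mathbb{G})$ is the set of classes of irreducible unitary representations, with chosen representatives $U^x$ on $H_x$; $x\otimes y$ denotes the tensor product of $U^x$ and $U^y$; $\varepsilon$ is the trivial class; $\overline{x}$ the contragredient. $\mathcal{C}(\mathbb{G})$ is the Hopf $^*$-algebra spanned by coefficients of the $U^x$. Quantum dimension. Choose nonzero $t_x\in\mathrm{Mor}(x\otimes\overline{x},\varepsilon)$, $s_x\in\mathrm{Mor}(\overline{x}\otimes x,\varepsilon)$ with $(t_x^*\otimes1)(1\otimes s_x)=1$; $j_x:H_x\to H_{\overline x}$, $\xi\mapsto(\xi^*\otimes1)t_x$; $Q_x=j_x^*j_x$, normalized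 so that $\mathrm{Tr}(Q_x)=\mathrm{Tr}(Q_x^{-1})$; $\dim_q(x)=\mathrm{Tr}(Q_x)$. Monoidal equivalence. A monoidal equivalence $\varphi:\mathbb{G}_2\to\mathbb{G}_1$ is a bijection $\varphi:\mathrm{Irred}(\mathbb{G}_2)\to\mathrm{Irred}(\mathbb{G}_1)$ with $\varphi(\varepsilon)=\varepsilon$ together with linear isomorphisms $\varphi:\mathrm{Mor}(x_1\otimes\cdots\otimes x_r,y_1\otimes\cdots\otimes y_k)\to\mathrm{Mor}(\varphi(x_1)\otimes\cdots\otimes\varphi(x_r),\varphi(y_1)\otimes\cdots\otimes\varphi(y_k))$ satisfying $\varphi(1)=1$, $\varphi(S\otimes T)=\varphi(S)\otimes\varphi(T)$, $\varphi(S^* )=\varphi(S)^*$, $\varphi(ST)=\varphi(S)\varphi(T)$ whenever these make sense. Its link algebra (known to exist and be unique) is the unital $^*$-algebra $\mathcal{B}$ with faithful state $\omega$ and unitaries $X^x\in\mathcal{L}(H_x,H_{\varphi(x)})\otimes\mathcal{B}$, $x\in\mathrm{Irred}(\mathbb{G}_2)$, such that: $X^y_{13}X^z_{23}(S\otimes1)=(\varphi(S)\otimes1)X^x$ for $S\in\mathrm{Mor}(y\otimes z,x)$; the coefficients of the $X^x$ form a linear basis of $\mathcal{B}$; $(\mathrm{id}\otimes\omega)(X^x)=0$ for $x\ne\varepsilon$. It carries unique commuting ergodic $\omega$-invariant actions $\delta_1,\delta_2$ with $(\mathrm{id}\otimes\delta_1)(X^x)=U^{\varphi(x)}_{12}X^x_{13}$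 and $(\mathrm{id}\otimes\delta_2)(X^x)=X^x_{12}U^x_{13}$. Actions. An action of $\mathbb{G}$ on a unital C$^*$-algebra $D$ is a unital $^*$-homomorphism $\alpha:D\to D\otimes C(\mathbb{G})$ with $(\alpha\otimes\mathrm{id})\alpha=(\mathrm{id}\otimes\Delta)\alpha$ and $[\alpha(D)(1\otimes C(\mathbb{G}))]=D\otimes C(\mathbb{G})$. The fixed point algebra is $D^\alpha=\{a\mid\alpha(a)=a\otimes1\}$; $\alpha$ is ergodic if $D^\alpha=\mathbb{C}1$. The spectral subspace of $x\in\mathrm{Irred}(\mathbb{G})$ is $K_x=\{v\in\overline{H}_x\otimes D\mid(\mathrm{id}\otimes\alpha)(v)=v_{12}U^x_{13}\}$, where $\overline{H}_x=\mathcal{L}(H_x,\mathbb{C})$. The spectral subalgebra $\mathcal{D}$ is the span of all $v(\xi\otimes1)$, $v\in K_x$, $\xi\in H_x$, $x\in\mathrm{Irred}(\mathbb{G})$; it is a dense unital $^*$-subalgebra and $\alpha$ restricts to a Hopf $^*$-algebra action $\mathcal{D}\to\mathcal{D}\otimes_{\rm alg}\mathcal{C}(\mathbb{G})$. The same notions are used for Hopf $^*$-algebra actions. $K_x$ is a $D^\alpha$-bimodule by $a\bullet v=(1\otimes a)v$, $v\bullet a=v(1\otimes a)$. With $E=(\mathrm{id}\otimes h)\alpha:D\to D^\alpha$, the two $D^\alpha$-valued inner products on $K_x$ are $\langle v,w\rangle_l=vw^*$ (left Hilbert module) and $1\otimes\langle v,w\rangle_r=(\mathrm{id}\otimes E)(v^*w)$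 (right Hilbert module). Quantum multiplicity. If $\alpha$ is ergodic, $K_x$ is a finite-dimensional Hilbert space for $\langle v,w\rangle1=wv^*$. For $t\in\mathrm{Mor}(\overline{x}\otimes x,\varepsilon)$ with $t^*t=\dim_q(x)$, put $R_x:K_x\to K_{\overline{x}}$, $R_x(v)=(t^*\otimes1)(1\otimes v^* )$ (antilinear), $L_x=R_x^*R_x$, and $\mathrm{mult}_q(x)=\sqrt{\mathrm{Tr}(L_x)\mathrm{Tr}(L_{\overline{x}})}$. *)

theory Defs
  imports
    "HOL-Analysis.Elementary_Normed_Spaces"
    "HOL-Library.Nonpos_Ints"
    "Jordan_Normal_Form.Matrix"
begin

section \<open>Complex vector spaces, star-algebras and C*-algebras\<close>

class scaleC =
  fixes scaleC :: "complex \<Rightarrow> 'a \<Rightarrow> 'a"  (infixr "*\<^sub>C" 75)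

class complex_vector = scaleC + ab_group_add +
  assumes scaleC_add_right: "c *\<^sub>C (x + y) = c *\<^sub>C x + c *\<^sub>C y"
    and scaleC_add_left: "(c + d) *\<^sub>C x = c *\<^sub>C x + d *\<^sub>C x"
    and scaleC_scaleC: "c *\<^sub>C d *\<^sub>C x = (c * d) *\<^sub>C x"
    and scaleC_one: "1 *\<^sub>C x = x"

interpretation cvec: vector_space "scaleC :: complex \<Rightarrow> 'a \<Rightarrow> 'a::complex_vector"
  by unfold_locales (simp_all add: scaleC_add_right scaleC_add_left scaleC_scaleC scaleC_one)

interpretation cvec_pair: vector_space_pair
  "scaleC :: complex \<Rightarrow> 'a \<Rightarrow> 'a::complex_vector" "scaleC :: complex \<Rightarrow> 'b \<Rightarrow> 'b::complex_vector"
  by unfold_locales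

text \<open>Unital associative complex algebras with a conjugate-linear anti-multiplicative involution.
  The class \<open>ring_1\<close> excludes the zero algebra.\<close>

class star_algebra = complex_vector + ring_1 +
  fixes star :: "'a \<Rightarrow> 'a"
  assumes mult_scaleC_left: "(c *\<^sub>C x) * y = c *\<^sub>C (x * y)"
    and mult_scaleC_right: "x * (c *\<^sub>C y) = c *\<^sub>C (x * y)"
    and star_star: "star (star x) = x"
    and star_add: "star (x + y) = star x + star y"
    and star_scaleC: "star (c *\<^sub>C x) = cnj c *\<^sub>C star x"
    and star_mult: "star (x * y) = star y * star x"

class cstar_algebra = star_algebra + real_normed_algebra_1 + complete_space +
  assumes scaleR_eq_scaleC: "r *\<^sub>R x = complex_of_real r *\<^sub>C x"
    and norm_scaleC: "norm (c *\<^sub>C x) = cmod c * norm x"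
    and cstar_identity: "norm (star x * x) = (norm x)\<^sup>2"

instantiation complex :: cstar_algebra
begin
definition scaleC_complex :: "complex \<Rightarrow> complex \<Rightarrow> complex" where "scaleC_complex c z = c * z"
definition star_complex :: "complex \<Rightarrow> complex" where "star_complex = cnj"
instance
  by standard
    (simp_all add: scaleC_complex_def star_complex_def algebra_simps norm_mult power2_eq_square
      scaleR_conv_of_real)
end

abbreviation clinear :: "('a::complex_vector \<Rightarrow> 'b::complex_vector) \<Rightarrow> bool" where
  "clinear \<equiv> Vector_Spaces.linear scaleC scaleC"

definition cbilinear :: "('a::complex_vector \<Rightarrow> 'b::complex_vector \<Rightarrow> 'c::complex_vector) \<Rightarrow> bool" where
  "cbilinear \<beta> \<longleftrightarrow> (\<forall>a. clinear (\<beta> a)) \<and> (\<forall>b. clinear (\<lambda>a. \<beta> a b))"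

definition unital_star_hom :: "('a::star_algebra \<Rightarrow> 'b::star_algebra) \<Rightarrow> bool" where
  "unital_star_hom f \<longleftrightarrow> clinear f \<and> f 1 = 1 \<and> (\<forall>a b. f (a * b) = f a * f b) \<and>
     (\<forall>a. f (star a) = star (f a))"

definition state :: "('a::star_algebra \<Rightarrow> complex) \<Rightarrow> bool" where
  "state f \<longleftrightarrow> clinear f \<and> f 1 = 1 \<and> (\<forall>a. f (star a * a) \<in> \<real>\<^sub>\<ge>\<^sub>0)"

definition star_isomorphism_on ::
  "'a set \<Rightarrow> 'b set \<Rightarrow> ('a::star_algebra \<Rightarrow> 'b::star_algebra) \<Rightarrow> bool" where
  "star_isomorphism_on A B f \<longleftrightarrow> bij_betw f A B \<and> f 1 = 1 \<and>
     (\<forall>a\<in>A. \<forall>b\<in>A. f (a + b) = f a + f b \<and> f (a * b) = f a * f b) \<and>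
     (\<forall>c. \<forall>a\<in>A. f (c *\<^sub>C a) = c *\<^sub>C f a) \<and> (\<forall>a\<in>A. f (star a) = star (f a))"


section \<open>Algebraic tensor products\<close>

lemma clinear_iff: "clinear f \<longleftrightarrow> (\<forall>x y. f (x + y) = f x + f y) \<and> (\<forall>c x. f (c *\<^sub>C x) = c *\<^sub>C f x)"
  by (auto simp: Vector_Spaces.linear_def module_hom_def module_hom_axioms_def
      cvec.module_axioms cvec.vector_space_axioms)

lemma cbilinear_iff:
  "cbilinear \<beta> \<longleftrightarrow> (\<forall>a a' b. \<beta> (a + a') b = \<beta> a b + \<beta> a' b) \<and> (\<forall>a b b'. \<beta> a (b + b') = \<beta> a b + \<beta> a b')
     \<and> (\<forall>c a b. \<beta> (c *\<^sub>C a) b = c *\<^sub>C \<beta> a b) \<and> (\<forall>c a b. \<beta> a (c *\<^sub>C b) = c *\<^sub>C \<beta> a b)"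
  by (auto simp: cbilinear_def clinear_iff)

lemma clinear_functionals_separate:
  fixes x :: "'a::complex_vector"
  assumes "x \<noteq> 0"
  obtains f :: "'a \<Rightarrow> complex" where "clinear f" "f x = 1"
proof -
  have "cvec.independent {x}" using assms by (simp add: cvec.dependent_single)
  then obtain g :: "'a \<Rightarrow> complex" where "clinear g" "\<forall>y\<in>{x}. g y = 1"
    using cvec_pair.linear_independent_extend[of "{x}" "\<lambda>_. 1"] by blast
  then show ?thesis using that by auto
qed

definition formal_eval :: "('a \<Rightarrow> 'b \<Rightarrow> 'c::comm_monoid_add) \<Rightarrow> ('a \<times> 'b) list \<Rightarrow> 'c" where
  "formal_eval \<beta> xs = (\<Sum>(a, b)\<leftarrow>xs. \<beta> a b)"

lemma formal_eval_simps [simp]: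
  "formal_eval \<beta> [] = 0"
  "formal_eval \<beta> (p # xs) = \<beta> (fst p) (snd p) + formal_eval \<beta> xs"
  "formal_eval \<beta> (xs @ ys) = formal_eval \<beta> xs + formal_eval \<beta> ys"
  by (simp_all add: formal_eval_def split_beta)

text \<open>A list of pairs stands for the formal sum of the tensors \<open>a \<otimes> b\<close>. Two formal sums agree
  in the tensor product iff every bilinear form takes the same value on them. The universal
  property with respect to bilinear maps into arbitrary vector spaces is proved below.\<close>

definition tensor_eq ::
  "('a::complex_vector \<times> 'b::complex_vector) list \<Rightarrow> ('a \<times> 'b) list \<Rightarrow> bool" where
  "tensor_eq xs ys \<longleftrightarrow>
     (\<forall>\<beta> :: 'a \<Rightarrow> 'b \<Rightarrow> complex. cbilinear \<beta> \<longrightarrow> formal_eval \<beta> xs = formal_eval \<beta> ys)"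

quotient_type (overloaded) ('a, 'b) tensor =
  "('a::complex_vector \<times> 'b::complex_vector) list" / tensor_eq
  by (rule equivpI) (auto simp: reflp_def symp_def transp_def tensor_eq_def)

lemma clinear_formal_eval:
  "clinear f \<Longrightarrow> f (formal_eval \<beta> xs) = formal_eval (\<lambda>a b. f (\<beta> a b)) xs"
proof (induction xs)
  case Nil
  then show ?case using cvec_pair.linear_0[of f] by simp
next
  case (Cons p xs)
  then show ?case by (simp add: clinear_iff)
qed

lemma tensor_eqD:
  fixes \<beta> :: "'a::complex_vector \<Rightarrow> 'b::complex_vector \<Rightarrow> 'c::complex_vector"
  assumes "tensor_eq xs ys" "cbilinear \<beta>"
  shows "formal_eval \<beta> xs = formal_eval \<beta> ys"
proof (rule ccontr)
  assume "formal_eval \<beta> xs \<noteq> formal_eval \<beta> ys"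
  then obtain f :: "'c \<Rightarrow> complex" where f: "clinear f" "f (formal_eval \<beta> xs - formal_eval \<beta> ys) = 1"
    using clinear_functionals_separate[of "formal_eval \<beta> xs - formal_eval \<beta> ys"] by auto
  have "cbilinear (\<lambda>a b. f (\<beta> a b))" using assms(2) f(1) by (simp add: cbilinear_iff clinear_iff)
  then have "f (formal_eval \<beta> xs) = f (formal_eval \<beta> ys)"
    using assms(1) f(1) unfolding tensor_eq_def by (simp add: clinear_formal_eval)
  then show False using f cvec_pair.linear_diff[of f] by simp
qed

lemma formal_eval_cong:
  "(\<And>a b. (a, b) \<in> set xs \<Longrightarrow> \<beta> a b = \<gamma> a b) \<Longrightarrow> formal_eval \<beta> xs = formal_eval \<gamma> xs"
  by (induction xs) auto

lemma formal_eval_map_scale: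
  "cbilinear \<beta> \<Longrightarrow> formal_eval \<beta> (map (\<lambda>(a, b). (c *\<^sub>C a, b)) xs) = c *\<^sub>C formal_eval \<beta> xs"
  by (induction xs) (auto simp: cbilinear_iff scaleC_add_right)

instantiation tensor :: (complex_vector, complex_vector) complex_vector
begin

lift_definition zero_tensor :: "('a, 'b) tensor" is "[]" .

lift_definition plus_tensor :: "('a, 'b) tensor \<Rightarrow> ('a, 'b) tensor \<Rightarrow> ('a, 'b) tensor" is "(@)"
  by (simp add: tensor_eq_def)

lift_definition scaleC_tensor :: "complex \<Rightarrow> ('a, 'b) tensor \<Rightarrow> ('a, 'b) tensor"
  is "\<lambda>c. map (\<lambda>(a, b). (c *\<^sub>C a, b))"
  by (simp add: tensor_eq_def formal_eval_map_scale)

definition uminus_tensor :: "('a, 'b) tensor \<Rightarrow> ('a, 'b) tensor" where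
  "uminus_tensor t = (- 1) *\<^sub>C t"

definition minus_tensor :: "('a, 'b) tensor \<Rightarrow> ('a, 'b) tensor \<Rightarrow> ('a, 'b) tensor" where
  "minus_tensor s t = s + - t"

instance
proof
  fix x y z :: "('a, 'b) tensor" and c d :: complex
  show "x + y + z = x + (y + z)" by transfer (simp add: tensor_eq_def)
  show "x + y = y + x" by transfer (simp add: tensor_eq_def)
  show "0 + x = x" by transfer (simp add: tensor_eq_def)
  show "- x + x = 0" unfolding uminus_tensor_def
    by transfer (simp add: tensor_eq_def formal_eval_map_scale scaleC_complex_def
      del: cvec.scale_minus_left)
  show "x - y = x + - y" by (simp add: minus_tensor_def)
  show "c *\<^sub>C (x + y) = c *\<^sub>C x + c *\<^sub>C y" by transfer (simp add: tensor_eq_def)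
  show "(c + d) *\<^sub>C x = c *\<^sub>C x + d *\<^sub>C x"
    by transfer (simp add: tensor_eq_def formal_eval_map_scale, simp add: scaleC_add_left)
  show "c *\<^sub>C d *\<^sub>C x = (c * d) *\<^sub>C x"
    by transfer (simp add: tensor_eq_def formal_eval_map_scale scaleC_complex_def del: map_map)
  show "1 *\<^sub>C x = x" by transfer (simp add: tensor_eq_def formal_eval_map_scale scaleC_complex_def)
qed

end

lift_definition alg_tensor :: "'a::complex_vector \<Rightarrow> 'b::complex_vector \<Rightarrow> ('a, 'b) tensor"
  (infixr "\<otimes>\<^sub>a" 71) is "\<lambda>a b. [(a, b)]" .

text \<open>The linear map on the tensor product induced by a bilinear map.\<close>

definition tensor_lift ::
  "('a::complex_vector \<Rightarrow> 'b::complex_vector \<Rightarrow> 'c::complex_vector) \<Rightarrow> ('a, 'b) tensor \<Rightarrow> 'c" where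
  "tensor_lift \<beta> t = formal_eval \<beta> (rep_tensor t)"

lemma cbilinear_alg_tensor: "cbilinear (\<otimes>\<^sub>a)"
  unfolding cbilinear_iff
  by (intro conjI allI; transfer) (auto simp: tensor_eq_def cbilinear_iff)

lemma tensor_lift_abs:
  assumes "cbilinear \<beta>" shows "tensor_lift \<beta> (abs_tensor xs) = formal_eval \<beta> xs"
  unfolding tensor_lift_def
  by (rule tensor_eqD[OF _ assms])
    (metis Quotient3_tensor Quotient3_rel_abs Quotient3_rep_abs Quotient3_abs_rep
      tensor.abs_eq_iff)

lemma tensor_lift_alg_tensor:
  assumes "cbilinear \<beta>" shows "tensor_lift \<beta> (a \<otimes>\<^sub>a b) = \<beta> a b"
  using tensor_lift_abs[OF assms, of "[(a, b)]"] by (simp add: alg_tensor.abs_eq)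

lemma clinear_tensor_lift:
  assumes "cbilinear \<beta>" shows "clinear (tensor_lift \<beta>)"
proof -
  have "tensor_lift \<beta> (x + y) = tensor_lift \<beta> x + tensor_lift \<beta> y" for x y
    by (induct x, induct y) (simp add: plus_tensor.abs_eq tensor_lift_abs[OF assms])
  moreover have "tensor_lift \<beta> (c *\<^sub>C x) = c *\<^sub>C tensor_lift \<beta> x" for c x
    by (induct x) (simp add: scaleC_tensor.abs_eq tensor_lift_abs[OF assms] formal_eval_map_scale[OF assms])
  ultimately show ?thesis by (simp add: clinear_iff)
qed

lemma tensor_induct [case_names zero add]:
  assumes "P 0" "\<And>a b t. P t \<Longrightarrow> P (a \<otimes>\<^sub>a b + t)"
  shows "P t"
proof (induct t)
  fix xs :: "('a \<times> 'b) list"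
  show "P (abs_tensor xs)"
  proof (induction xs)
    case Nil
    then show ?case using assms(1) by (simp add: zero_tensor.abs_eq)
  next
    case (Cons p xs)
    then have "P (fst p \<otimes>\<^sub>a snd p + abs_tensor xs)" by (rule assms(2))
    then show ?case by (simp add: alg_tensor.abs_eq plus_tensor.abs_eq)
  qed
qed

lemma tensor_lift_unique:
  assumes "clinear f" "clinear g" "\<And>a b. f (a \<otimes>\<^sub>a b) = g (a \<otimes>\<^sub>a b)"
  shows "f = g"
proof
  fix t show "f t = g t"
    by (induction t rule: tensor_induct)
      (use assms in \<open>auto simp: cvec_pair.linear_0 clinear_iff\<close>)
qed

lemma formal_eval_add:
  "formal_eval (\<lambda>a b. \<beta> a b + \<gamma> a b) xs = formal_eval \<beta> xs + formal_eval \<gamma> xs"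
  by (induction xs) (auto simp: algebra_simps)

lemma formal_eval_scale:
  fixes \<beta> :: "'a \<Rightarrow> 'b \<Rightarrow> 'c::complex_vector"
  shows "formal_eval (\<lambda>a b. c *\<^sub>C \<beta> a b) xs = c *\<^sub>C formal_eval \<beta> xs"
  by (induction xs) (auto simp: scaleC_add_right)

text \<open>Multiplication and involution: \<open>(a \<otimes> b)(c \<otimes> d) = ac \<otimes> bd\<close> and
  \<open>(a \<otimes> b)* = a* \<otimes> b*\<close>.\<close>

instantiation tensor :: (star_algebra, star_algebra) star_algebra
begin

definition times_tensor :: "('a, 'b) tensor \<Rightarrow> ('a, 'b) tensor \<Rightarrow> ('a, 'b) tensor" where
  "times_tensor s t = tensor_lift (\<lambda>a b. tensor_lift (\<lambda>c d. (a * c) \<otimes>\<^sub>a (b * d)) t) s"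

definition one_tensor :: "('a, 'b) tensor" where "one_tensor = 1 \<otimes>\<^sub>a 1"

lift_definition star_tensor :: "('a, 'b) tensor \<Rightarrow> ('a, 'b) tensor"
  is "map (\<lambda>(a, b). (star a, star b))"
proof -
  fix xs ys :: "('a \<times> 'b) list" assume eq: "tensor_eq xs ys"
  show "tensor_eq (map (\<lambda>(a, b). (star a, star b)) xs) (map (\<lambda>(a, b). (star a, star b)) ys)"
    unfolding tensor_eq_def
  proof (intro allI impI)
    fix \<beta> :: "'a \<Rightarrow> 'b \<Rightarrow> complex" assume b: "cbilinear \<beta>"
    have c: "cbilinear (\<lambda>a b. cnj (\<beta> (star a) (star b)))"
      using b by (simp add: cbilinear_iff star_add star_scaleC scaleC_complex_def)
    have "formal_eval \<beta> (map (\<lambda>(a, b). (star a, star b)) zs)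
        = cnj (formal_eval (\<lambda>a b. cnj (\<beta> (star a) (star b))) zs)" for zs
      by (induction zs) auto
    then show "formal_eval \<beta> (map (\<lambda>(a, b). (star a, star b)) xs)
        = formal_eval \<beta> (map (\<lambda>(a, b). (star a, star b)) ys)"
      using tensor_eqD[OF eq c] by simp
  qed
qed

instance
proof
  have bil1: "cbilinear (\<lambda>c d. (a * c) \<otimes>\<^sub>a (b * d))" for a :: 'a and b :: 'b
    using cbilinear_alg_tensor[where 'a='a and 'b='b]
    by (simp add: cbilinear_iff distrib_left mult_scaleC_right)
  have lin1: "clinear (tensor_lift (\<lambda>c d. (a * c) \<otimes>\<^sub>a (b * d)))" for a :: 'a and b :: 'b
    by (rule clinear_tensor_lift[OF bil1])
  have bil2: "cbilinear (\<lambda>a b. tensor_lift (\<lambda>c d. (a * c) \<otimes>\<^sub>a (b * d)) t)" for t :: "('a, 'b) tensor"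
    using cbilinear_alg_tensor[where 'a='a and 'b='b]
    unfolding cbilinear_iff tensor_lift_def
    by (simp add: distrib_right mult_scaleC_left formal_eval_add formal_eval_scale)
  have lin_l: "clinear (\<lambda>s. s * t)" for t :: "('a, 'b) tensor"
    unfolding times_tensor_def by (rule clinear_tensor_lift[OF bil2])
  have lin_r: "clinear (\<lambda>t. s * t)" for s :: "('a, 'b) tensor"
    unfolding times_tensor_def clinear_iff tensor_lift_def[of _ s] using lin1
    by (simp add: clinear_iff formal_eval_add formal_eval_scale)
  have tm: "(a \<otimes>\<^sub>a b) * (c \<otimes>\<^sub>a d) = (a * c) \<otimes>\<^sub>a (b * d)" for a c :: 'a and b d :: 'b
    unfolding times_tensor_def
    by (rule trans[OF tensor_lift_alg_tensor[OF bil2] tensor_lift_alg_tensor[OF bil1]])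
  note l = lin_l[unfolded clinear_iff] and r = lin_r[unfolded clinear_iff]
  have l0: "0 * t = 0" and r0: "t * 0 = 0" for t :: "('a, 'b) tensor"
    using cvec_pair.linear_0[OF lin_l] cvec_pair.linear_0[OF lin_r] by auto
  have st0: "star 0 = (0 :: ('a, 'b) tensor)" by transfer (simp add: tensor_eq_def)
  have sta: "star (x + y) = star x + star y" for x y :: "('a, 'b) tensor"
    by transfer (simp add: tensor_eq_def)
  have stt: "star (a \<otimes>\<^sub>a b) = star a \<otimes>\<^sub>a star b" for a :: 'a and b :: 'b
    by transfer (simp add: tensor_eq_def)
  fix x y z :: "('a, 'b) tensor" and c :: complex
  show "(x + y) * z = x * z + y * z" and "x * (y + z) = x * y + x * z"
    and "(c *\<^sub>C x) * y = c *\<^sub>C (x * y)" and "x * (c *\<^sub>C y) = c *\<^sub>C (x * y)"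
    using l r by auto
  show "x * y * z = x * (y * z)"
  proof (induction x rule: tensor_induct)
    case (add a b s)
    have "(a \<otimes>\<^sub>a b) * y * z = (a \<otimes>\<^sub>a b) * (y * z)"
    proof (induction y rule: tensor_induct)
      case (add a' b' s')
      have "((a \<otimes>\<^sub>a b) * (a' \<otimes>\<^sub>a b')) * z = (a \<otimes>\<^sub>a b) * ((a' \<otimes>\<^sub>a b') * z)"
        by (induction z rule: tensor_induct) (simp_all add: r0 r tm mult.assoc)
      with add show ?case by (simp add: l r)
    qed (simp add: l0 r0)
    with add show ?case by (simp add: l)
  qed (simp add: l0)
  show "1 * x = x" "x * 1 = x" unfolding one_tensor_def
    by (induction x rule: tensor_induct; simp add: l0 r0 l r tm)+
  obtain f :: "'a \<Rightarrow> complex" where f: "clinear f" "f 1 = 1"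
    by (rule clinear_functionals_separate[OF one_neq_zero])
  obtain g :: "'b \<Rightarrow> complex" where g: "clinear g" "g 1 = 1"
    by (rule clinear_functionals_separate[OF one_neq_zero])
  have "cbilinear (\<lambda>a b. f a * g b)"
    using f(1) g(1) unfolding cbilinear_iff clinear_iff by (simp add: scaleC_complex_def algebra_simps)
  from cvec_pair.linear_0[OF clinear_tensor_lift[OF this]] tensor_lift_alg_tensor[OF this, of 1 1]
  have "tensor_lift (\<lambda>a b. f a * g b) 0 \<noteq> tensor_lift (\<lambda>a b. f a * g b) (1 \<otimes>\<^sub>a 1)"
    by (simp add: f(2) g(2))
  then show "(0 :: ('a, 'b) tensor) \<noteq> 1" unfolding one_tensor_def by metis
  show "star (star x) = x"
    by transfer (simp add: tensor_eq_def comp_def split_beta star_star)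
  show "star (x + y) = star x + star y" by (rule sta)
  show "star (c *\<^sub>C x) = cnj c *\<^sub>C star x"
    by transfer (simp add: tensor_eq_def comp_def split_beta star_scaleC)
  show "star (x * y) = star y * star x"
  proof (induction x rule: tensor_induct)
    case (add a b s)
    have "star ((a \<otimes>\<^sub>a b) * y) = star y * star (a \<otimes>\<^sub>a b)"
      by (induction y rule: tensor_induct) (simp_all add: l0 r0 l r tm st0 sta stt star_mult)
    with add show ?case by (simp add: l r sta)
  qed (simp add: l0 r0 st0)
qed

end

definition tensor_map ::
  "('a::complex_vector \<Rightarrow> 'c::complex_vector) \<Rightarrow> ('b::complex_vector \<Rightarrow> 'd::complex_vector)
    \<Rightarrow> ('a, 'b) tensor \<Rightarrow> ('c, 'd) tensor" where
  "tensor_map f g = tensor_lift (\<lambda>a b. f a \<otimes>\<^sub>a g b)"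

definition assoc_left ::
  "('a::complex_vector, ('b::complex_vector, 'c::complex_vector) tensor) tensor
    \<Rightarrow> (('a, 'b) tensor, 'c) tensor" where
  "assoc_left = tensor_lift (\<lambda>a. tensor_lift (\<lambda>b c. (a \<otimes>\<^sub>a b) \<otimes>\<^sub>a c))"

definition assoc_right ::
  "(('a::complex_vector, 'b::complex_vector) tensor, 'c::complex_vector) tensor
    \<Rightarrow> ('a, ('b, 'c) tensor) tensor" where
  "assoc_right = tensor_lift (\<lambda>s c. tensor_lift (\<lambda>a b. a \<otimes>\<^sub>a (b \<otimes>\<^sub>a c)) s)"

text \<open>The tensor product of two subspaces, inside the tensor product of the ambient spaces.\<close>

definition tensor_subspace ::
  "'a::complex_vector set \<Rightarrow> 'b::complex_vector set \<Rightarrow> ('a, 'b) tensor set" where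
  "tensor_subspace A B = cvec.span {a \<otimes>\<^sub>a b | a b. a \<in> A \<and> b \<in> B}"


section \<open>Minimal C*-tensor products\<close>

text \<open>\<open>cstar_tensor \<iota>\<close> says that the target C*-algebra of \<open>\<iota>\<close> is the minimal (spatial) tensor
  product of the two source C*-algebras, with \<open>\<iota> a b\<close> the elementary tensors: it is a
  completion of the algebraic tensor product in the spatial norm. The last clause is the usual
  formula for this norm in terms of GNS representations of product states: the norm of \<open>z\<close> is
  the supremum of \<open>\<parallel>(\<pi>\<^sub>f \<otimes> \<pi>\<^sub>g)(z) \<eta>\<parallel> / \<parallel>\<eta>\<parallel>\<close> over all states \<open>f, g\<close>, where it suffices to take
  \<open>\<eta> = (\<pi>\<^sub>f \<otimes> \<pi>\<^sub>g)(y)(\<xi>\<^sub>f \<otimes> \<xi>\<^sub>g)\<close> with \<open>y\<close> in the algebraic tensor product.\<close>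

definition product_functional ::
  "('a::complex_vector \<Rightarrow> complex) \<Rightarrow> ('b::complex_vector \<Rightarrow> complex) \<Rightarrow> ('a, 'b) tensor \<Rightarrow> complex" where
  "product_functional f g = tensor_lift (\<lambda>a b. f a * g b)"

definition cstar_tensor ::
  "('a::cstar_algebra \<Rightarrow> 'b::cstar_algebra \<Rightarrow> 'c::cstar_algebra) \<Rightarrow> bool" where
  "cstar_tensor \<iota> \<longleftrightarrow>
     cbilinear \<iota> \<and> \<iota> 1 1 = 1 \<and>
     (\<forall>a a' b b'. \<iota> a b * \<iota> a' b' = \<iota> (a * a') (b * b')) \<and>
     (\<forall>a b. star (\<iota> a b) = \<iota> (star a) (star b)) \<and>
     inj (tensor_lift \<iota>) \<and>
     closure (range (tensor_lift \<iota>)) = UNIV \<and>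
     (\<forall>z r. 0 \<le> r \<longrightarrow>
        (norm (tensor_lift \<iota> z) \<le> r \<longleftrightarrow>
         (\<forall>f g y. state f \<longrightarrow> state g \<longrightarrow>
            Re (product_functional f g (star y * star z * z * y))
              \<le> r\<^sup>2 * Re (product_functional f g (star y * y)))))"

text \<open>A common target for the two iterated tensor products \<open>(A \<otimes> B) \<otimes> C\<close> and
  \<open>A \<otimes> (B \<otimes> C)\<close>.\<close>

definition cstar_triple_tensor ::
  "('a::cstar_algebra \<Rightarrow> 'b::cstar_algebra \<Rightarrow> 'ab::cstar_algebra)
    \<Rightarrow> ('ab \<Rightarrow> 'c::cstar_algebra \<Rightarrow> 'abc::cstar_algebra)
    \<Rightarrow> ('b \<Rightarrow> 'c \<Rightarrow> 'bc::cstar_algebra) \<Rightarrow> ('a \<Rightarrow> 'bc \<Rightarrow> 'abc) \<Rightarrow> bool" where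
  "cstar_triple_tensor \<iota>ab \<iota>l \<iota>bc \<iota>r \<longleftrightarrow>
     cstar_tensor \<iota>ab \<and> cstar_tensor \<iota>l \<and> cstar_tensor \<iota>bc \<and> cstar_tensor \<iota>r \<and>
     (\<forall>a b c. \<iota>l (\<iota>ab a b) c = \<iota>r a (\<iota>bc b c))"

text \<open>\<open>F\<close> is the continuous extension of the linear map determined by \<open>a \<otimes> b \<mapsto> \<beta> a b\<close>.\<close>

definition tensor_extension ::
  "('a::cstar_algebra \<Rightarrow> 'b::cstar_algebra \<Rightarrow> 'c::cstar_algebra)
    \<Rightarrow> ('a \<Rightarrow> 'b \<Rightarrow> 'd::cstar_algebra) \<Rightarrow> ('c \<Rightarrow> 'd) \<Rightarrow> bool" where
  "tensor_extension \<iota> \<beta> F \<longleftrightarrow> clinear F \<and> continuous_on UNIV F \<and> (\<forall>a b. F (\<iota> a b) = \<beta> a b)"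


section \<open>Matrices over star-algebras\<close>

text \<open>Finite-dimensional Hilbert spaces are the spaces \<open>\<complex>\<^sup>n\<close>, so \<open>L(H, K) \<otimes> A\<close> consists of
  matrices over \<open>A\<close>, vectors of \<open>H \<otimes> A\<close> are columns and elements of \<open>L(H, \<complex>) \<otimes> A\<close> are rows.\<close>

definition mat_star :: "'a::star_algebra mat \<Rightarrow> 'a mat" where
  "mat_star M = mat (dim_col M) (dim_row M) (\<lambda>(i, j). star (M $$ (j, i)))"

text \<open>Kronecker product. Over a noncommutative algebra the factors are multiplied in the given
  order, so \<open>kron U V\<close> is \<open>U\<^sub>1\<^sub>3 V\<^sub>2\<^sub>3\<close>; over the scalars it is the tensor product of operators.\<close>

definition kron :: "'a::semiring_0 mat \<Rightarrow> 'a mat \<Rightarrow> 'a mat" where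
  "kron M N = mat (dim_row M * dim_row N) (dim_col M * dim_col N)
     (\<lambda>(i, j). M $$ (i div dim_row N, j div dim_col N) * N $$ (i mod dim_row N, j mod dim_col N))"

text \<open>\<open>amp T\<close> is \<open>T \<otimes> 1\<close>.\<close>

definition amp :: "complex mat \<Rightarrow> 'a::star_algebra mat" where
  "amp T = map_mat (\<lambda>c. c *\<^sub>C 1) T"

text \<open>\<open>legs \<iota> V W\<close> is \<open>V\<^sub>1\<^sub>2 W\<^sub>1\<^sub>3\<close>, the matrix product in which entries are multiplied by \<open>\<iota>\<close>.\<close>

definition legs :: "('a \<Rightarrow> 'b \<Rightarrow> 'c::comm_monoid_add) \<Rightarrow> 'a mat \<Rightarrow> 'b mat \<Rightarrow> 'c mat" where
  "legs \<iota> V W = mat (dim_row V) (dim_col W)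
     (\<lambda>(i, j). \<Sum>k<dim_col V. \<iota> (V $$ (i, k)) (W $$ (k, j)))"

definition unitary_mat :: "'a::star_algebra mat \<Rightarrow> bool" where
  "unitary_mat U \<longleftrightarrow> mat_star U * U = 1\<^sub>m (dim_col U) \<and> U * mat_star U = 1\<^sub>m (dim_row U)"

definition mat_trace :: "'a::comm_monoid_add mat \<Rightarrow> 'a" where
  "mat_trace M = (\<Sum>i<dim_row M. M $$ (i, i))"

definition mat_coeffs :: "'a mat \<Rightarrow> 'a set" where
  "mat_coeffs M = {M $$ (i, j) | i j. i < dim_row M \<and> j < dim_col M}"


section \<open>Compact quantum groups and their representations\<close>

text \<open>The type \<open>'g\<close> is \<open>C(G)\<close>, and \<open>'gg\<close>, \<open>'ggg\<close> are its minimal tensor square and cube. The type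
  \<open>'x\<close> is the set of classes of irreducible representations, with representatives \<open>irr\<close>. The
  fields \<open>contra\<close>, \<open>tvec\<close>, \<open>svec\<close> hold the contragredient and the chosen intertwiners
  \<open>t\<^sub>x\<close>, \<open>s\<^sub>x\<close>.\<close>

record ('g, 'gg, 'ggg, 'x) cqg =
  tens2 :: "'g \<Rightarrow> 'g \<Rightarrow> 'gg"
  tens3_l :: "'gg \<Rightarrow> 'g \<Rightarrow> 'ggg"
  tens3_r :: "'g \<Rightarrow> 'gg \<Rightarrow> 'ggg"
  comult :: "'g \<Rightarrow> 'gg"
  haar :: "'g \<Rightarrow> complex"
  irr :: "'x \<Rightarrow> 'g mat"
  triv :: 'x
  contra :: "'x \<Rightarrow> 'x"
  tvec :: "'x \<Rightarrow> complex mat"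
  svec :: "'x \<Rightarrow> complex mat"

definition compact_quantum_group ::
  "('g::cstar_algebra, 'gg::cstar_algebra, 'ggg::cstar_algebra, 'x) cqg \<Rightarrow> bool" where
  "compact_quantum_group G \<longleftrightarrow>
     cstar_triple_tensor (tens2 G) (tens3_l G) (tens2 G) (tens3_r G) \<and>
     unital_star_hom (comult G) \<and>
     (\<exists>F1 F2. tensor_extension (tens2 G) (\<lambda>a b. tens3_l G (comult G a) b) F1 \<and>
              tensor_extension (tens2 G) (\<lambda>a b. tens3_r G a (comult G b)) F2 \<and>
              (\<forall>a. F1 (comult G a) = F2 (comult G a))) \<and>
     closure (cvec.span {comult G a * tens2 G 1 b | a b. True}) = UNIV \<and>
     closure (cvec.span {comult G a * tens2 G b 1 | a b. True}) = UNIV"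

definition haar_state ::
  "('g::cstar_algebra, 'gg::cstar_algebra, 'ggg::cstar_algebra, 'x) cqg \<Rightarrow> bool" where
  "haar_state G \<longleftrightarrow> state (haar G) \<and>
     (\<exists>F1 F2. tensor_extension (tens2 G) (\<lambda>a b. haar G a *\<^sub>C b) F1 \<and>
              tensor_extension (tens2 G) (\<lambda>a b. haar G b *\<^sub>C a) F2 \<and>
              (\<forall>a. F1 (comult G a) = haar G a *\<^sub>C 1 \<and> F2 (comult G a) = haar G a *\<^sub>C 1))"

definition unitary_rep :: "('g::cstar_algebra, 'gg::cstar_algebra, 'ggg, 'x) cqg \<Rightarrow> 'g mat \<Rightarrow> bool" where
  "unitary_rep G U \<longleftrightarrow> dim_row U = dim_col U \<and> unitary_mat U \<and>
     map_mat (comult G) U = legs (tens2 G) U U"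

definition Mor :: "'g::star_algebra mat \<Rightarrow> 'g mat \<Rightarrow> complex mat set" where
  "Mor U V = {T \<in> carrier_mat (dim_row U) (dim_row V). U * amp T = amp T * V}"

definition irreducible_rep :: "('g::cstar_algebra, 'gg::cstar_algebra, 'ggg, 'x) cqg \<Rightarrow> 'g mat \<Rightarrow> bool" where
  "irreducible_rep G U \<longleftrightarrow> unitary_rep G U \<and> 0 < dim_row U \<and>
     Mor U U = {c \<cdot>\<^sub>m 1\<^sub>m (dim_row U) | c. True}"

definition equivalent_reps :: "'g::star_algebra mat \<Rightarrow> 'g mat \<Rightarrow> bool" where
  "equivalent_reps U V \<longleftrightarrow> (\<exists>T\<in>Mor U V. unitary_mat T)"

definition irreducible_representatives ::
  "('g::cstar_algebra, 'gg::cstar_algebra, 'ggg, 'x) cqg \<Rightarrow> bool" where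
  "irreducible_representatives G \<longleftrightarrow>
     (\<forall>x. irreducible_rep G (irr G x)) \<and>
     (\<forall>x y. equivalent_reps (irr G x) (irr G y) \<longrightarrow> x = y) \<and>
     (\<forall>U. irreducible_rep G U \<longrightarrow> (\<exists>x. equivalent_reps U (irr G x))) \<and>
     irr G (triv G) = 1\<^sub>m 1"

definition hdim :: "('g, 'gg, 'ggg, 'x) cqg \<Rightarrow> 'x \<Rightarrow> nat" where
  "hdim G x = dim_row (irr G x)"

definition tensor_rep :: "('g::star_algebra, 'gg, 'ggg, 'x) cqg \<Rightarrow> 'x list \<Rightarrow> 'g mat" where
  "tensor_rep G xs = foldr (\<lambda>x U. kron (irr G x) U) xs (1\<^sub>m 1)"

text \<open>\<open>MorI G [x\<^sub>1, \<dots>, x\<^sub>r] [y\<^sub>1, \<dots>, y\<^sub>k]\<close> is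
  \<open>Mor(x\<^sub>1 \<otimes> \<cdots> \<otimes> x\<^sub>r, y\<^sub>1 \<otimes> \<cdots> \<otimes> y\<^sub>k)\<close>.\<close>

definition MorI :: "('g::star_algebra, 'gg, 'ggg, 'x) cqg \<Rightarrow> 'x list \<Rightarrow> 'x list \<Rightarrow> complex mat set" where
  "MorI G xs ys = Mor (tensor_rep G xs) (tensor_rep G ys)"

text \<open>The span \<open>\<C>(G)\<close> of the coefficients of the irreducible representations.\<close>

definition coeff_algebra :: "('g::star_algebra, 'gg, 'ggg, 'x) cqg \<Rightarrow> 'g set" where
  "coeff_algebra G = cvec.span (\<Union>x. mat_coeffs (irr G x))"


subsection \<open>Contragredients and quantum dimension\<close>

definition unit_col :: "nat \<Rightarrow> nat \<Rightarrow> complex mat" where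
  "unit_col n a = mat n 1 (\<lambda>(i, _). if i = a then 1 else 0)"

definition col_inner :: "complex mat \<Rightarrow> complex mat \<Rightarrow> complex" where
  "col_inner u v = (mat_star u * v) $$ (0, 0)"

definition jmap :: "('g, 'gg, 'ggg, 'x) cqg \<Rightarrow> 'x \<Rightarrow> complex mat \<Rightarrow> complex mat" where
  "jmap G x \<xi> = kron (mat_star \<xi>) (1\<^sub>m (hdim G (contra G x))) * tvec G x"

text \<open>The matrix of \<open>j\<^sub>x* j\<^sub>x\<close>. Since \<open>j = j\<^sub>x\<close> is antilinear, its adjoint satisfies
  \<open>\<langle>\<xi>, j* \<zeta>\<rangle> = \<langle>\<zeta>, j \<xi>\<rangle>\<close>, whence \<open>\<langle>\<xi>, j* j \<eta>\<rangle> = \<langle>j \<eta>, j \<xi>\<rangle>\<close>.\<close>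

definition Qmat :: "('g, 'gg, 'ggg, 'x) cqg \<Rightarrow> 'x \<Rightarrow> complex mat" where
  "Qmat G x = (let n = hdim G x in
     mat n n (\<lambda>(a, b). col_inner (jmap G x (unit_col n b)) (jmap G x (unit_col n a))))"

definition qdim :: "('g, 'gg, 'ggg, 'x) cqg \<Rightarrow> 'x \<Rightarrow> complex" where
  "qdim G x = mat_trace (Qmat G x)"

definition contragredient_choice :: "('g::star_algebra, 'gg, 'ggg, 'x) cqg \<Rightarrow> bool" where
  "contragredient_choice G \<longleftrightarrow> (\<forall>x. let n = hdim G x; t = tvec G x; s = svec G x in
     t \<in> MorI G [x, contra G x] [triv G] \<and> t \<noteq> 0\<^sub>m (dim_row t) (dim_col t) \<and>
     s \<in> MorI G [contra G x, x] [triv G] \<and> s \<noteq> 0\<^sub>m (dim_row s) (dim_col s) \<and>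
     kron (mat_star t) (1\<^sub>m n) * kron (1\<^sub>m n) s = 1\<^sub>m n \<and>
     (\<exists>R \<in> carrier_mat n n. inverts_mat (Qmat G x) R \<and> inverts_mat R (Qmat G x) \<and>
        mat_trace (Qmat G x) = mat_trace R))"

definition quantum_group_data ::
  "('g::cstar_algebra, 'gg::cstar_algebra, 'ggg::cstar_algebra, 'x) cqg \<Rightarrow> bool" where
  "quantum_group_data G \<longleftrightarrow> compact_quantum_group G \<and> haar_state G \<and>
     irreducible_representatives G \<and> contragredient_choice G"


section \<open>Monoidal equivalence and the link algebra\<close>

text \<open>The three unit conditions express \<open>\<phi>(1) = 1\<close> for the identity of \<open>H\<^sub>x\<close> regarded in
  \<open>Mor(x, x) = Mor(x \<otimes> \<epsilon>, x) = Mor(\<epsilon> \<otimes> x, x)\<close>.\<close>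

definition monoidal_equivalence ::
  "('g2::star_algebra, 'gg2, 'ggg2, 'x2) cqg \<Rightarrow> ('g1::star_algebra, 'gg1, 'ggg1, 'x1) cqg
    \<Rightarrow> ('x2 \<Rightarrow> 'x1) \<Rightarrow> ('x2 list \<Rightarrow> 'x2 list \<Rightarrow> complex mat \<Rightarrow> complex mat) \<Rightarrow> bool" where
  "monoidal_equivalence G2 G1 \<phi> \<Phi> \<longleftrightarrow>
     bij \<phi> \<and> \<phi> (triv G2) = triv G1 \<and>
     (\<forall>xs ys. xs \<noteq> [] \<longrightarrow> ys \<noteq> [] \<longrightarrow>
        bij_betw (\<Phi> xs ys) (MorI G2 xs ys) (MorI G1 (map \<phi> xs) (map \<phi> ys)) \<and>
        (\<forall>S\<in>MorI G2 xs ys. \<forall>T\<in>MorI G2 xs ys. \<Phi> xs ys (S + T) = \<Phi> xs ys S + \<Phi> xs ys T) \<and>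
        (\<forall>c. \<forall>S\<in>MorI G2 xs ys. \<Phi> xs ys (c \<cdot>\<^sub>m S) = c \<cdot>\<^sub>m \<Phi> xs ys S) \<and>
        (\<forall>S\<in>MorI G2 xs ys. \<Phi> ys xs (mat_star S) = mat_star (\<Phi> xs ys S))) \<and>
     (\<forall>x. \<Phi> [x] [x] (1\<^sub>m (hdim G2 x)) = 1\<^sub>m (hdim G1 (\<phi> x)) \<and>
          \<Phi> [x, triv G2] [x] (1\<^sub>m (hdim G2 x)) = 1\<^sub>m (hdim G1 (\<phi> x)) \<and>
          \<Phi> [triv G2, x] [x] (1\<^sub>m (hdim G2 x)) = 1\<^sub>m (hdim G1 (\<phi> x))) \<and>
     (\<forall>xs ys xs' ys' S T. xs \<noteq> [] \<longrightarrow> ys \<noteq> [] \<longrightarrow> xs' \<noteq> [] \<longrightarrow> ys' \<noteq> [] \<longrightarrow>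
        S \<in> MorI G2 xs ys \<longrightarrow> T \<in> MorI G2 xs' ys' \<longrightarrow>
        \<Phi> (xs @ xs') (ys @ ys') (kron S T) = kron (\<Phi> xs ys S) (\<Phi> xs' ys' T)) \<and>
     (\<forall>xs ys zs S T. xs \<noteq> [] \<longrightarrow> ys \<noteq> [] \<longrightarrow> zs \<noteq> [] \<longrightarrow>
        S \<in> MorI G2 xs ys \<longrightarrow> T \<in> MorI G2 ys zs \<longrightarrow>
        \<Phi> xs zs (S * T) = \<Phi> xs ys S * \<Phi> ys zs T)"

record (overloaded) ('x, 'g1, 'g2, 'b) link =
  link_X :: "'x \<Rightarrow> 'b mat"
  link_state :: "'b \<Rightarrow> complex"
  link_act1 :: "'b \<Rightarrow> ('g1, 'b) tensor"
  link_act2 :: "'b \<Rightarrow> ('b, 'g2) tensor"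

definition link_index :: "('x, 'g1, 'g2, 'b) link \<Rightarrow> ('x \<times> nat \<times> nat) set" where
  "link_index L = {(x, i, j). i < dim_row (link_X L x) \<and> j < dim_col (link_X L x)}"

definition link_algebra ::
  "('g2::star_algebra, 'gg2, 'ggg2, 'x2) cqg \<Rightarrow> ('g1::star_algebra, 'gg1, 'ggg1, 'x1) cqg
    \<Rightarrow> ('x2 \<Rightarrow> 'x1) \<Rightarrow> ('x2 list \<Rightarrow> 'x2 list \<Rightarrow> complex mat \<Rightarrow> complex mat)
    \<Rightarrow> ('x2, 'g1, 'g2, 'b::star_algebra) link \<Rightarrow> bool" where
  "link_algebra G2 G1 \<phi> \<Phi> L \<longleftrightarrow>
     state (link_state L) \<and> (\<forall>b. link_state L (star b * b) = 0 \<longrightarrow> b = 0) \<and>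
     (\<forall>x. link_X L x \<in> carrier_mat (hdim G1 (\<phi> x)) (hdim G2 x) \<and> unitary_mat (link_X L x)) \<and>
     (\<forall>x y z. \<forall>S\<in>MorI G2 [y, z] [x].
        kron (link_X L y) (link_X L z) * amp S = amp (\<Phi> [y, z] [x] S) * link_X L x) \<and>
     inj_on (\<lambda>(x, i, j). link_X L x $$ (i, j)) (link_index L) \<and>
     cvec.independent ((\<lambda>(x, i, j). link_X L x $$ (i, j)) ` link_index L) \<and>
     cvec.span ((\<lambda>(x, i, j). link_X L x $$ (i, j)) ` link_index L) = UNIV \<and>
     (\<forall>x. x \<noteq> triv G2 \<longrightarrow>
        map_mat (link_state L) (link_X L x) = 0\<^sub>m (hdim G1 (\<phi> x)) (hdim G2 x))"

definition is_counit :: "('g::star_algebra, 'gg, 'ggg, 'x) cqg \<Rightarrow> ('g \<Rightarrow> complex) \<Rightarrow> bool" where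
  "is_counit G f \<longleftrightarrow> clinear f \<and> (\<forall>x. map_mat f (irr G x) = 1\<^sub>m (hdim G x))"

text \<open>Left and right actions of the Hopf *-algebra \<open>\<C>(G)\<close> on a *-algebra. Coassociativity
  is stated after the embedding of the algebraic tensor square of \<open>C(G)\<close> into its C*-tensor
  square, where the comultiplication takes its values.\<close>

definition hopf_left_action ::
  "('g::cstar_algebra, 'gg::cstar_algebra, 'ggg, 'x) cqg
    \<Rightarrow> ('b::star_algebra \<Rightarrow> ('g, 'b) tensor) \<Rightarrow> bool" where
  "hopf_left_action G \<delta> \<longleftrightarrow> unital_star_hom \<delta> \<and>
     range \<delta> \<subseteq> tensor_subspace (coeff_algebra G) UNIV \<and>
     (\<forall>b. tensor_map (tensor_lift (tens2 G)) id (assoc_left (tensor_map id \<delta> (\<delta> b)))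
          = tensor_map (comult G) id (\<delta> b)) \<and>
     (\<forall>f b. is_counit G f \<longrightarrow> tensor_lift (\<lambda>c b. f c *\<^sub>C b) (\<delta> b) = b)"

definition hopf_right_action ::
  "('g::cstar_algebra, 'gg::cstar_algebra, 'ggg, 'x) cqg
    \<Rightarrow> ('b::star_algebra \<Rightarrow> ('b, 'g) tensor) \<Rightarrow> bool" where
  "hopf_right_action G \<delta> \<longleftrightarrow> unital_star_hom \<delta> \<and>
     range \<delta> \<subseteq> tensor_subspace UNIV (coeff_algebra G) \<and>
     (\<forall>b. tensor_map id (tensor_lift (tens2 G)) (assoc_right (tensor_map \<delta> id (\<delta> b)))
          = tensor_map id (comult G) (\<delta> b)) \<and>
     (\<forall>f b. is_counit G f \<longrightarrow> tensor_lift (\<lambda>b c. f c *\<^sub>C b) (\<delta> b) = b)"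

definition link_actions ::
  "('g2::cstar_algebra, 'gg2::cstar_algebra, 'ggg2, 'x2) cqg
    \<Rightarrow> ('g1::cstar_algebra, 'gg1::cstar_algebra, 'ggg1, 'x1) cqg
    \<Rightarrow> ('x2 \<Rightarrow> 'x1) \<Rightarrow> ('x2, 'g1, 'g2, 'b::star_algebra) link \<Rightarrow> bool" where
  "link_actions G2 G1 \<phi> L \<longleftrightarrow>
     hopf_left_action G1 (link_act1 L) \<and> hopf_right_action G2 (link_act2 L) \<and>
     (\<forall>x. map_mat (link_act1 L) (link_X L x) = legs (\<otimes>\<^sub>a) (irr G1 (\<phi> x)) (link_X L x)) \<and>
     (\<forall>x. map_mat (link_act2 L) (link_X L x) = legs (\<otimes>\<^sub>a) (link_X L x) (irr G2 x)) \<and>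
     (\<forall>b. assoc_left (tensor_map id (link_act2 L) (link_act1 L b))
          = tensor_map (link_act1 L) id (link_act2 L b)) \<and>
     {b. link_act1 L b = 1 \<otimes>\<^sub>a b} = range (\<lambda>c. c *\<^sub>C 1) \<and>
     {b. link_act2 L b = b \<otimes>\<^sub>a 1} = range (\<lambda>c. c *\<^sub>C 1) \<and>
     (\<forall>b. tensor_lift (\<lambda>c b. link_state L b *\<^sub>C c) (link_act1 L b) = link_state L b *\<^sub>C 1) \<and>
     (\<forall>b. tensor_lift (\<lambda>b c. link_state L b *\<^sub>C c) (link_act2 L b) = link_state L b *\<^sub>C 1)"


section \<open>Actions\<close>

text \<open>\<open>\<iota>\<close> is the tensor product \<open>D \<otimes> C(G)\<close>; \<open>\<iota>l\<close>, \<open>\<iota>r\<close> give \<open>D \<otimes> C(G) \<otimes> C(G)\<close>.\<close>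

definition cstar_action ::
  "('g::cstar_algebra, 'gg::cstar_algebra, 'ggg, 'x) cqg
    \<Rightarrow> ('d::cstar_algebra \<Rightarrow> 'g \<Rightarrow> 'dg::cstar_algebra)
    \<Rightarrow> ('dg \<Rightarrow> 'g \<Rightarrow> 'dgg::cstar_algebra) \<Rightarrow> ('d \<Rightarrow> 'gg \<Rightarrow> 'dgg) \<Rightarrow> ('d \<Rightarrow> 'dg) \<Rightarrow> bool" where
  "cstar_action G \<iota> \<iota>l \<iota>r \<alpha> \<longleftrightarrow>
     cstar_triple_tensor \<iota> \<iota>l (tens2 G) \<iota>r \<and>
     unital_star_hom \<alpha> \<and>
     (\<exists>F1 F2. tensor_extension \<iota> (\<lambda>d a. \<iota>l (\<alpha> d) a) F1 \<and>
              tensor_extension \<iota> (\<lambda>d a. \<iota>r d (comult G a)) F2 \<and>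
              (\<forall>d. F1 (\<alpha> d) = F2 (\<alpha> d))) \<and>
     closure (cvec.span {\<alpha> d * \<iota> 1 a | d a. True}) = UNIV"

text \<open>The notions below serve both for C*-algebraic actions (where \<open>\<iota>\<close> is the minimal tensor
  product) and for Hopf *-algebra actions (where \<open>\<iota>\<close> is \<open>(\<otimes>\<^sub>a)\<close>). The set \<open>A\<close> is the
  algebra acted upon, as a subalgebra of the type on which \<open>\<alpha>\<close> is defined.\<close>

definition fixed_points ::
  "'d::star_algebra set \<Rightarrow> ('d \<Rightarrow> 'g::star_algebra \<Rightarrow> 'e) \<Rightarrow> ('d \<Rightarrow> 'e) \<Rightarrow> 'd set" where
  "fixed_points A \<iota> \<alpha> = {a \<in> A. \<alpha> a = \<iota> a 1}"

definition ergodic ::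
  "'d::star_algebra set \<Rightarrow> ('d \<Rightarrow> 'g::star_algebra \<Rightarrow> 'e) \<Rightarrow> ('d \<Rightarrow> 'e) \<Rightarrow> bool" where
  "ergodic A \<iota> \<alpha> \<longleftrightarrow> fixed_points A \<iota> \<alpha> = range (\<lambda>c. c *\<^sub>C 1)"

definition spectral_subspace ::
  "('g, 'gg, 'ggg, 'x) cqg \<Rightarrow> 'd set \<Rightarrow> ('d \<Rightarrow> 'g \<Rightarrow> 'e::comm_monoid_add) \<Rightarrow> ('d \<Rightarrow> 'e)
    \<Rightarrow> 'x \<Rightarrow> 'd mat set" where
  "spectral_subspace G A \<iota> \<alpha> x =
     {v \<in> carrier_mat 1 (hdim G x). mat_coeffs v \<subseteq> A \<and> map_mat \<alpha> v = legs \<iota> v (irr G x)}"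

definition spectral_subalgebra ::
  "('g, 'gg, 'ggg, 'x) cqg \<Rightarrow> ('d::star_algebra \<Rightarrow> 'g \<Rightarrow> 'e::comm_monoid_add) \<Rightarrow> ('d \<Rightarrow> 'e) \<Rightarrow> 'd set" where
  "spectral_subalgebra G \<iota> \<alpha> =
     cvec.span {(v * amp \<xi>) $$ (0, 0) | v \<xi> x.
       v \<in> spectral_subspace G UNIV \<iota> \<alpha> x \<and> \<xi> \<in> carrier_mat (hdim G x) 1}"

text \<open>The conditional expectation \<open>E = (id \<otimes> h) \<alpha>\<close>. On the spectral subalgebra, which contains
  all entries of \<open>v* w\<close> for \<open>v, w\<close> in a spectral subspace, \<open>\<alpha>\<close> takes its values in the algebraic
  tensor product, and the slice map is evaluated there; arguments \<open>d\<close> with \<open>\<alpha> d\<close> outside the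
  algebraic tensor product are not used.\<close>

definition cond_exp ::
  "('g::star_algebra, 'gg, 'ggg, 'x) cqg \<Rightarrow> ('d::star_algebra \<Rightarrow> 'g \<Rightarrow> 'e::complex_vector)
    \<Rightarrow> ('d \<Rightarrow> 'e) \<Rightarrow> 'd \<Rightarrow> 'd" where
  "cond_exp G \<iota> \<alpha> d = tensor_lift (\<lambda>a c. haar G c *\<^sub>C a) (inv_into UNIV (tensor_lift \<iota>) (\<alpha> d))"

definition inner_l :: "'d::star_algebra mat \<Rightarrow> 'd mat \<Rightarrow> 'd" where
  "inner_l v w = (v * mat_star w) $$ (0, 0)"

definition inner_r :: "('d::star_algebra \<Rightarrow> 'd) \<Rightarrow> 'd mat \<Rightarrow> 'd mat \<Rightarrow> 'd" where
  "inner_r E v w = (THE d. map_mat E (mat_star v * w) = d \<cdot>\<^sub>m 1\<^sub>m (dim_col v))"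

text \<open>Maps between spectral subspaces, regarded as bimodules over algebras that are identified
  along \<open>\<theta>\<close>: the left action is \<open>a \<cdot> v = (1 \<otimes> a) v\<close> and the right action \<open>v \<cdot> a = v (1 \<otimes> a)\<close>.\<close>

definition bimodule_isomorphism ::
  "'d::star_algebra set \<Rightarrow> ('d \<Rightarrow> 'e::star_algebra) \<Rightarrow> 'd mat set \<Rightarrow> 'e mat set \<Rightarrow> ('d mat \<Rightarrow> 'e mat) \<Rightarrow> bool" where
  "bimodule_isomorphism F \<theta> K K' T \<longleftrightarrow> bij_betw T K K' \<and>
     (\<forall>v\<in>K. \<forall>w\<in>K. T (v + w) = T v + T w) \<and>
     (\<forall>c. \<forall>v\<in>K. T (map_mat ((*\<^sub>C) c) v) = map_mat ((*\<^sub>C) c) (T v)) \<and>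
     (\<forall>a\<in>F. \<forall>v\<in>K. T (map_mat (\<lambda>u. a * u) v) = map_mat (\<lambda>u. \<theta> a * u) (T v) \<and>
                    T (map_mat (\<lambda>u. u * a) v) = map_mat (\<lambda>u. u * \<theta> a) (T v))"

text \<open>\<open>T\<close> is adjointable with respect to algebra-valued inner products, and its adjoint is its
  inverse.\<close>

definition hilbert_module_unitary ::
  "('d \<Rightarrow> 'e) \<Rightarrow> 'd mat set \<Rightarrow> ('d mat \<Rightarrow> 'd mat \<Rightarrow> 'd) \<Rightarrow> 'e mat set \<Rightarrow> ('e mat \<Rightarrow> 'e mat \<Rightarrow> 'e)
    \<Rightarrow> ('d mat \<Rightarrow> 'e mat) \<Rightarrow> bool" where
  "hilbert_module_unitary \<theta> K ip K' ip' T \<longleftrightarrow> T ` K \<subseteq> K' \<and>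
     (\<exists>S. S ` K' \<subseteq> K \<and> (\<forall>v\<in>K. \<forall>w\<in>K'. ip' (T v) w = \<theta> (ip v (S w))) \<and>
          (\<forall>v\<in>K. S (T v) = v) \<and> (\<forall>w\<in>K'. T (S w) = w))"


subsection \<open>Quantum multiplicity\<close>

text \<open>The scalar product \<open>\<langle>v, w\<rangle> 1 = w v*\<close> on the spectral subspaces of an ergodic action.\<close>

definition spec_inner :: "'d::star_algebra mat \<Rightarrow> 'd mat \<Rightarrow> complex" where
  "spec_inner v w = (THE c. inner_l w v = c *\<^sub>C 1)"

definition spec_onb :: "'d::star_algebra mat set \<Rightarrow> 'd mat set \<Rightarrow> bool" where
  "spec_onb K B \<longleftrightarrow> finite B \<and> B \<subseteq> K \<and>
     (\<forall>e\<in>B. \<forall>f\<in>B. spec_inner e f = (if e = f then 1 else 0)) \<and>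
     (\<forall>v\<in>K. \<forall>i<dim_col v. v $$ (0, i) = (\<Sum>e\<in>B. spec_inner e v *\<^sub>C e $$ (0, i)))"

definition spec_trace :: "'d::star_algebra mat set \<Rightarrow> ('d mat \<Rightarrow> 'd mat) \<Rightarrow> complex" where
  "spec_trace K M = (THE \<tau>. \<exists>B. spec_onb K B \<and> \<tau> = (\<Sum>e\<in>B. spec_inner e (M e)))"

text \<open>The adjoint of an antilinear map \<open>R\<close>, characterized by \<open>\<langle>w, R* u\<rangle> = \<langle>u, R w\<rangle>\<close>.\<close>

definition antilinear_adjoint :: "'d::star_algebra mat set \<Rightarrow> ('d mat \<Rightarrow> 'd mat) \<Rightarrow> 'd mat \<Rightarrow> 'd mat" where
  "antilinear_adjoint K R u = (THE v. v \<in> K \<and> (\<forall>w\<in>K. spec_inner w v = spec_inner u (R w)))"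

definition Rmap ::
  "('g, 'gg, 'ggg, 'x) cqg \<Rightarrow> ('x \<Rightarrow> complex mat) \<Rightarrow> 'x \<Rightarrow> 'd::star_algebra mat \<Rightarrow> 'd mat" where
  "Rmap G \<tau> x v = amp (mat_star (\<tau> x)) * kron (1\<^sub>m (hdim G (contra G x))) (mat_star v)"

definition Lmap ::
  "('g, 'gg, 'ggg, 'x) cqg \<Rightarrow> ('x \<Rightarrow> complex mat) \<Rightarrow> 'd::star_algebra set
    \<Rightarrow> ('d \<Rightarrow> 'g \<Rightarrow> 'e::comm_monoid_add) \<Rightarrow> ('d \<Rightarrow> 'e) \<Rightarrow> 'x \<Rightarrow> 'd mat \<Rightarrow> 'd mat" where
  "Lmap G \<tau> A \<iota> \<alpha> x v =
     antilinear_adjoint (spectral_subspace G A \<iota> \<alpha> x) (Rmap G \<tau> x) (Rmap G \<tau> x v)"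

text \<open>The intertwiners \<open>t \<in> Mor(x\<^sup>c \<otimes> x, \<epsilon>)\<close>, \<open>x\<^sup>c\<close> the contragredient of \<open>x\<close>, with
  \<open>t* t = dim\<^sub>q(x)\<close>, one for each \<open>x\<close>. They are unique up to a phase, on which the quantum
  multiplicity does not depend.\<close>

definition normalized_intertwiners ::
  "('g::star_algebra, 'gg, 'ggg, 'x) cqg \<Rightarrow> ('x \<Rightarrow> complex mat) \<Rightarrow> bool" where
  "normalized_intertwiners G \<tau> \<longleftrightarrow>
     (\<forall>x. \<tau> x \<in> MorI G [contra G x, x] [triv G] \<and> mat_star (\<tau> x) * \<tau> x = qdim G x \<cdot>\<^sub>m 1\<^sub>m 1)"

definition mult_q ::
  "('g, 'gg, 'ggg, 'x) cqg \<Rightarrow> ('x \<Rightarrow> complex mat) \<Rightarrow> 'd::star_algebra set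
    \<Rightarrow> ('d \<Rightarrow> 'g \<Rightarrow> 'e::comm_monoid_add) \<Rightarrow> ('d \<Rightarrow> 'e) \<Rightarrow> 'x \<Rightarrow> real" where
  "mult_q G \<tau> A \<iota> \<alpha> x =
     sqrt (Re (spec_trace (spectral_subspace G A \<iota> \<alpha> x) (Lmap G \<tau> A \<iota> \<alpha> x)) *
           Re (spec_trace (spectral_subspace G A \<iota> \<alpha> (contra G x)) (Lmap G \<tau> A \<iota> \<alpha> (contra G x))))"


section \<open>The action obtained from the link algebra\<close>

text \<open>The algebra of all \<open>a \<in> A \<otimes> \<B>\<close> with \<open>(\<alpha> \<otimes> id)(a) = (id \<otimes> \<delta>)(a)\<close>, where \<open>A\<close> is the
  spectral subalgebra of \<open>\<alpha>\<close>. Both sides are compared in \<open>(D \<otimes> C(G)) \<otimes> \<B>\<close>, into which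
  \<open>A \<otimes> \<C>(G) \<otimes> \<B>\<close> embeds by \<open>\<iota>\<close>.\<close>

definition box_algebra ::
  "('d::star_algebra \<Rightarrow> 'g::star_algebra \<Rightarrow> 'e::star_algebra) \<Rightarrow> ('d \<Rightarrow> 'e) \<Rightarrow> 'd set
    \<Rightarrow> ('b::star_algebra \<Rightarrow> ('g, 'b) tensor) \<Rightarrow> ('d, 'b) tensor set" where
  "box_algebra \<iota> \<alpha> A \<delta> = {a \<in> tensor_subspace A UNIV.
     tensor_map \<alpha> id a = tensor_map (tensor_lift \<iota>) id (assoc_left (tensor_map id \<delta> a))}"

definition box_action ::
  "('b::star_algebra \<Rightarrow> ('b, 'g::star_algebra) tensor)
    \<Rightarrow> ('d::star_algebra, 'b) tensor \<Rightarrow> (('d, 'b) tensor, 'g) tensor" where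
  "box_action \<delta> a = assoc_left (tensor_map id \<delta> a)"

end

theory Submission
  imports Defs
begin

text \<open>The fixed points of \<open>id \<otimes> \<delta>\<^sub>2\<close> in \<open>D\<^sub>1 \<otimes> \<B>\<close> are \<open>D\<^sub>1 \<otimes> 1\<close>, because \<open>\<delta>\<^sub>2\<close> is ergodic; this
  gives the first item, and also the surjectivity of \<open>T\<^sub>x\<close>, since \<open>w X\<^sup>*\<close> is fixed for \<open>w \<in> K\<^sub>x\<close>.
  The inner products \<open>\<langle>\<cdot>,\<cdot>\<rangle>\<^sub>l\<close> agree by unitarity of \<open>X\<^sup>x\<close>. For \<open>\<langle>\<cdot>,\<cdot>\<rangle>\<^sub>r\<close> the orthogonality relations
  \<open>h(u\<^sub>k\<^sub>i\<^sup>* u\<^sub>l\<^sub>j) = \<delta>\<^sub>i\<^sub>j F\<^sub>k\<^sub>l\<close> in both quantum groups are matched through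
  \<open>\<Sum>\<^sub>p\<^sub>q F\<^sub>p\<^sub>q X\<^sub>k\<^sub>p\<^sup>* X\<^sub>l\<^sub>q = F\<^sub>k\<^sub>l 1\<close>: the left side is \<open>\<delta>\<^sub>2\<close>-invariant, hence a scalar, and the
  invariance of \<open>\<omega>\<close> under \<open>\<delta>\<^sub>1\<close> determines which one. For the quantum multiplicities, invariant
  vectors of \<open>x\<^sup>c \<otimes> x\<close> are unique up to a scalar and \<open>X\<close> carries the solutions of the conjugate
  equations for \<open>x\<close> isometrically to those for \<open>\<phi>(x)\<close>. So \<open>\<phi>\<close> preserves contragredients and quantum
  dimensions, and \<open>T\<close> intertwines the maps \<open>R\<^sub>x\<close> up to a phase.\<close>


section \<open>Matrices, linear maps and tensor products\<close>

text \<open>Equality in an algebraic tensor product is tested by slicing with linear functionals;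
  this lifts ergodicity of \<delta>2 from B to D \<otimes> B. The scalar in the F-identity comes out
  right because \<omega>(X_kp^* X_lq) equals F_kl of the first group for p = q and 0 otherwise,
  while the F of the second group has trace 1. For the quantum dimensions, the transported t and s
  are multiples c and d of the chosen ones. The conjugate equation gives cnj c * d = 1. The isometry
  gives |c|^2 dim_q(\<phi>(x)) = dim_q(x) = |d|^2 dim_q(\<phi>(x)), since the normalization Tr Q =
  Tr Q^{-1} makes dim_q the squared norm of both t and s. Together these force equality. Traces and
  adjoints are definite descriptions, meaningful only in the presence of orthonormal bases. They are
  compared through their defining predicates: T matches the bases on both sides, and an adjoint is
  evaluated only when a basis is at hand.\<close>

lemma sum_lessThan_mult:
  fixes f :: "nat \<Rightarrow> 'a::comm_monoid_add"
  shows "(\<Sum>k<n * m. f k) = (\<Sum>i<n. \<Sum>j<m. f (i * m + j))"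
proof (induction n)
  case (Suc n)
  have "(\<Sum>k<Suc n * m. f k) = (\<Sum>k<n * m + m. f k)" by (simp add: add.commute)
  also have "\<dots> = (\<Sum>k<n * m. f k) + (\<Sum>j<m. f (n * m + j))"
  proof -
    have "(\<Sum>k<a + m. f k) = (\<Sum>k<a. f k) + (\<Sum>j<m. f (a + j))" for a
      by (induction m) (simp_all add: add.assoc)
    then show ?thesis .
  qed
  finally show ?case using Suc by simp
qed simp

lemma mult_mat_entry:
  "i < dim_row A \<Longrightarrow> j < dim_col B \<Longrightarrow> dim_row B = dim_col A \<Longrightarrow>
    (A * B) $$ (i, j) = (\<Sum>k<dim_col A. A $$ (i, k) * B $$ (k, j))"
  by (simp add: scalar_prod_def atLeast0LessThan)

lemma mat_star_dim [simp]: "dim_row (mat_star M) = dim_col M" "dim_col (mat_star M) = dim_row M"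
  by (simp_all add: mat_star_def)

lemma mat_star_entry [simp]:
  "i < dim_col M \<Longrightarrow> j < dim_row M \<Longrightarrow> mat_star M $$ (i, j) = star (M $$ (j, i))"
  by (simp add: mat_star_def)

lemma kron_dim [simp]:
  "dim_row (kron M N) = dim_row M * dim_row N" "dim_col (kron M N) = dim_col M * dim_col N"
  by (simp_all add: kron_def)

lemma kron_entry:
  assumes "i < dim_row M" "a < dim_row N" "j < dim_col M" "b < dim_col N"
  shows "kron M N $$ (i * dim_row N + a, j * dim_col N + b) = M $$ (i, j) * N $$ (a, b)"
proof -
  have "i * dim_row N + a < dim_row M * dim_row N"
    using assms mult_le_mono1[of "Suc i" "dim_row M" "dim_row N"] by simp
  moreover have "j * dim_col N + b < dim_col M * dim_col N"
    using assms mult_le_mono1[of "Suc j" "dim_col M" "dim_col N"] by simp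
  ultimately show ?thesis using assms by (simp add: kron_def)
qed

lemma amp_dim [simp]: "dim_row (amp M) = dim_row M" "dim_col (amp M) = dim_col M"
  by (simp_all add: amp_def)

lemma amp_entry [simp]: "i < dim_row M \<Longrightarrow> j < dim_col M \<Longrightarrow> amp M $$ (i, j) = M $$ (i, j) *\<^sub>C 1"
  by (simp add: amp_def)

lemma legs_dim [simp]: "dim_row (legs \<iota> V W) = dim_row V" "dim_col (legs \<iota> V W) = dim_col W"
  by (simp_all add: legs_def)

lemma legs_entry [simp]:
  "i < dim_row V \<Longrightarrow> j < dim_col W \<Longrightarrow>
    legs \<iota> V W $$ (i, j) = (\<Sum>k<dim_col V. \<iota> (V $$ (i, k)) (W $$ (k, j)))"
  by (simp add: legs_def)

lemma unitary_mat_columns: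
  assumes "unitary_mat U" "U \<in> carrier_mat m n" "i < n" "j < n"
  shows "(\<Sum>k<m. star (U $$ (k, i)) * U $$ (k, j)) = (if i = j then 1 else 0)"
proof -
  have "(mat_star U * U) $$ (i, j) = (1\<^sub>m n) $$ (i, j)"
    using assms by (simp add: unitary_mat_def)
  moreover have "(mat_star U * U) $$ (i, j) = (\<Sum>k<m. star (U $$ (k, i)) * U $$ (k, j))"
    using assms by (subst mult_mat_entry) (auto intro!: sum.cong)
  ultimately show ?thesis using assms by simp
qed

lemma unitary_mat_rows:
  assumes "unitary_mat U" "U \<in> carrier_mat m n" "i < m" "j < m"
  shows "(\<Sum>k<n. U $$ (i, k) * star (U $$ (j, k))) = (if i = j then 1 else 0)"
proof -
  have "(U * mat_star U) $$ (i, j) = (1\<^sub>m m) $$ (i, j)"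
    using assms by (simp add: unitary_mat_def)
  moreover have "(U * mat_star U) $$ (i, j) = (\<Sum>k<n. U $$ (i, k) * star (U $$ (j, k)))"
    using assms by (subst mult_mat_entry) (auto intro!: sum.cong)
  ultimately show ?thesis using assms by simp
qed

section \<open>Involution, linear and bilinear maps\<close>

lemma star_0 [simp]: "star (0 :: 'a::star_algebra) = 0"
  using star_scaleC[of 0 "0::'a"] by simp

lemma star_1 [simp]: "star (1 :: 'a::star_algebra) = 1"
  by (metis mult_1 mult_1_right star_mult star_star)

lemma star_sum: "star (\<Sum>i\<in>A. f i) = (\<Sum>i\<in>A. star (f i :: 'a::star_algebra))"
  by (induction A rule: infinite_finite_induct) (simp_all add: star_add)

lemma star_complex [simp]: "star (z :: complex) = cnj z"
  by (simp add: star_complex_def)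

lemma scaleC_complex [simp]: "c *\<^sub>C (z :: complex) = c * z"
  by (simp add: scaleC_complex_def)

lemma scaleC_one_eq_iff [simp]: "c *\<^sub>C (1 :: 'a::star_algebra) = d *\<^sub>C 1 \<longleftrightarrow> c = d"
  by simp

lemma clinear_sum: "clinear f \<Longrightarrow> f (\<Sum>i\<in>A. g i) = (\<Sum>i\<in>A. f (g i))"
  by (rule cvec_pair.linear_sum)

lemma clinear_add: "clinear f \<Longrightarrow> f (x + y) = f x + f y"
  and clinear_scale: "clinear f \<Longrightarrow> f (c *\<^sub>C x) = c *\<^sub>C f x"
  by (simp_all add: clinear_iff)

lemma clinear_zero: "clinear f \<Longrightarrow> f 0 = 0"
  by (rule cvec_pair.linear_0)

lemma cbilinear_add:
  "cbilinear \<beta> \<Longrightarrow> \<beta> (a + a') b = \<beta> a b + \<beta> a' b"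
  "cbilinear \<beta> \<Longrightarrow> \<beta> a (b + b') = \<beta> a b + \<beta> a b'"
  by (simp_all add: cbilinear_iff)

lemma cbilinear_scale:
  "cbilinear \<beta> \<Longrightarrow> \<beta> (c *\<^sub>C a) b = c *\<^sub>C \<beta> a b"
  "cbilinear \<beta> \<Longrightarrow> \<beta> a (c *\<^sub>C b) = c *\<^sub>C \<beta> a b"
  by (simp_all add: cbilinear_iff)

lemma cbilinear_sum:
  "cbilinear \<beta> \<Longrightarrow> \<beta> (\<Sum>i\<in>A. f i) b = (\<Sum>i\<in>A. \<beta> (f i) b)"
  "cbilinear \<beta> \<Longrightarrow> \<beta> a (\<Sum>i\<in>A. g i) = (\<Sum>i\<in>A. \<beta> a (g i))"
  unfolding cbilinear_def
  using clinear_sum[of "\<beta> a" g A] clinear_sum[of "\<lambda>a. \<beta> a b" f A] by blast+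

lemma cbilinear_zero:
  fixes \<beta> :: "'a::complex_vector \<Rightarrow> 'b::complex_vector \<Rightarrow> 'c::complex_vector"
  shows "cbilinear \<beta> \<Longrightarrow> \<beta> 0 b = 0" "cbilinear \<beta> \<Longrightarrow> \<beta> a 0 = 0"
  using clinear_zero[of "\<lambda>a. \<beta> a b"] clinear_zero[of "\<beta> a"] by (auto simp: cbilinear_def)

text \<open>\<open>tensor_lift\<close> evaluates the form on one chosen representative of t, so
  linearity in a parameter passes through term by term. This supplies the outer linearity of nested
  lifts such as those behind the product and \<open>assoc_left\<close>.\<close>

lemma clinear_tensor_lift_parameter:
  assumes "\<And>b c. clinear (\<lambda>a. \<gamma> a b c)"
  shows "clinear (\<lambda>a. tensor_lift (\<gamma> a) t)"
proof -
  have "\<gamma> (x + y) = (\<lambda>b c. \<gamma> x b c + \<gamma> y b c)" "\<gamma> (k *\<^sub>C x) = (\<lambda>b c. k *\<^sub>C \<gamma> x b c)" for x y k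
    by (intro ext, rule clinear_add[OF assms] clinear_scale[OF assms])+
  then show ?thesis
    by (simp add: clinear_iff tensor_lift_def formal_eval_add formal_eval_scale)
qed

section \<open>Elementary tensors and star-homomorphisms on tensor products\<close>

lemmas tensor_add = cbilinear_add[OF cbilinear_alg_tensor]
lemmas tensor_scale = cbilinear_scale[OF cbilinear_alg_tensor]
lemmas tensor_sum = cbilinear_sum[OF cbilinear_alg_tensor]
lemmas tensor_zero [simp] = cbilinear_zero[OF cbilinear_alg_tensor]

lemma tensor_mult [simp]:
  "(a \<otimes>\<^sub>a b) * (c \<otimes>\<^sub>a d) = (a * c) \<otimes>\<^sub>a (b * d :: 'b::star_algebra)" for a c :: "'a::star_algebra"
proof -
  have 1: "cbilinear (\<lambda>c d. (a * c) \<otimes>\<^sub>a (b * d))" for a :: 'a and b :: 'b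
    by (simp add: cbilinear_iff distrib_left mult_scaleC_right tensor_add tensor_scale)
  have 2: "cbilinear (\<lambda>a b. tensor_lift (\<lambda>c d. (a * c) \<otimes>\<^sub>a (b * d)) t)" for t :: "('a, 'b) tensor"
    unfolding cbilinear_def
    by (intro conjI allI clinear_tensor_lift_parameter)
      (simp_all add: clinear_iff distrib_right mult_scaleC_left tensor_add tensor_scale)
  show ?thesis
    unfolding times_tensor_def by (rule trans[OF tensor_lift_alg_tensor[OF 2] tensor_lift_alg_tensor[OF 1]])
qed

lemma star_tensor [simp]: "star (a \<otimes>\<^sub>a b) = star a \<otimes>\<^sub>a star b"
  by transfer (simp add: tensor_eq_def)

lemma tensor_map_tensor [simp]:
  assumes "clinear f" "clinear g"
  shows "tensor_map f g (a \<otimes>\<^sub>a b) = f a \<otimes>\<^sub>a g b"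
  and clinear_tensor_map: "clinear (tensor_map f g)"
proof -
  have "cbilinear (\<lambda>a b. f a \<otimes>\<^sub>a g b)"
    using assms by (simp add: cbilinear_iff clinear_iff tensor_add tensor_scale)
  then show "tensor_map f g (a \<otimes>\<^sub>a b) = f a \<otimes>\<^sub>a g b" "clinear (tensor_map f g)"
    unfolding tensor_map_def by - (rule tensor_lift_alg_tensor clinear_tensor_lift, assumption)+
qed

lemma clinear_id [simp]: "clinear id" "clinear (\<lambda>x. x)"
  by (simp_all add: clinear_iff)

lemma clinear_compose: "clinear f \<Longrightarrow> clinear g \<Longrightarrow> clinear (\<lambda>x. f (g x))"
  by (simp add: clinear_iff)

lemma assoc_left_tensor [simp]:
  fixes a :: "'a::complex_vector" and b :: "'b::complex_vector" and c :: "'c::complex_vector"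
  shows "assoc_left (a \<otimes>\<^sub>a (b \<otimes>\<^sub>a c)) = (a \<otimes>\<^sub>a b) \<otimes>\<^sub>a c"
  and clinear_assoc_left: "clinear (assoc_left :: ('a, ('b, 'c) tensor) tensor \<Rightarrow> _)"
proof -
  have 1: "cbilinear (\<lambda>b c. (a \<otimes>\<^sub>a b) \<otimes>\<^sub>a c)" for a :: 'a and b :: 'b and c :: 'c
    by (simp add: cbilinear_iff tensor_add tensor_scale)
  have 2: "cbilinear (\<lambda>a. tensor_lift (\<lambda>(b::'b) (c::'c). ((a::'a) \<otimes>\<^sub>a b) \<otimes>\<^sub>a c))"
    unfolding cbilinear_def
    by (intro conjI allI clinear_tensor_lift_parameter clinear_tensor_lift 1)
      (simp add: clinear_iff tensor_add tensor_scale)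
  show "assoc_left (a \<otimes>\<^sub>a (b \<otimes>\<^sub>a c)) = (a \<otimes>\<^sub>a b) \<otimes>\<^sub>a c"
    unfolding assoc_left_def
    by (rule trans[OF tensor_lift_alg_tensor[OF 2] tensor_lift_alg_tensor[OF 1]])
  show "clinear (assoc_left :: ('a, ('b, 'c) tensor) tensor \<Rightarrow> _)"
    unfolding assoc_left_def by (rule clinear_tensor_lift[OF 2])
qed

text \<open>Multiplicativity is additive in each factor, so two nested inductions reduce it to
  elementary tensors. The instances are \<open>tensor_map\<close>, \<open>assoc_left\<close> and the
  embedding induced by \<iota>.\<close>

lemma unital_star_hom_tensorI:
  fixes F :: "('a::star_algebra, 'b::star_algebra) tensor \<Rightarrow> 'c::star_algebra"
  assumes F: "clinear F" and one: "F (1 \<otimes>\<^sub>a 1) = 1"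
    and mult: "\<And>a b c d. F ((a * c) \<otimes>\<^sub>a (b * d)) = F (a \<otimes>\<^sub>a b) * F (c \<otimes>\<^sub>a d)"
    and st: "\<And>a b. F (star a \<otimes>\<^sub>a star b) = star (F (a \<otimes>\<^sub>a b))"
  shows "unital_star_hom F"
  unfolding unital_star_hom_def
proof (intro conjI allI)
  note F' = clinear_add[OF F] clinear_zero[OF F]
  show "F 1 = 1" using one by (simp add: one_tensor_def)
  show "F (star s) = star (F s)" for s
    by (induction s rule: tensor_induct) (simp_all add: F' star_add st)
  have *: "F ((a \<otimes>\<^sub>a b) * t) = F (a \<otimes>\<^sub>a b) * F t" for a b t
    by (induction t rule: tensor_induct) (simp_all add: F' distrib_left mult)
  show "F (s * t) = F s * F t" for s t
    by (induction s rule: tensor_induct) (simp_all add: F' distrib_right *)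
qed (rule F)

lemma unital_star_homD:
  assumes "unital_star_hom f"
  shows "clinear f" "f 1 = 1" "f (a * b) = f a * f b" "f (star a) = star (f a)"
  using assms by (simp_all add: unital_star_hom_def)

lemma unital_star_hom_id: "unital_star_hom id"
  by (simp add: unital_star_hom_def)

lemma unital_star_hom_compose:
  "unital_star_hom f \<Longrightarrow> unital_star_hom g \<Longrightarrow> unital_star_hom (\<lambda>x. f (g x))"
  by (simp add: unital_star_hom_def clinear_iff)

lemma unital_star_hom_tensor_map:
  assumes "unital_star_hom f" "unital_star_hom g"
  shows "unital_star_hom (tensor_map f g)"
proof (rule unital_star_hom_tensorI)
  note f = unital_star_homD[OF assms(1)] and g = unital_star_homD[OF assms(2)]
  show "clinear (tensor_map f g)" using f g by (simp add: clinear_tensor_map)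
qed (simp_all add: unital_star_homD[OF assms(1)] unital_star_homD[OF assms(2)] one_tensor_def)

lemma unital_star_hom_assoc_left: "unital_star_hom assoc_left"
proof (rule unital_star_hom_tensorI)
  note F = clinear_add[OF clinear_assoc_left] clinear_zero[OF clinear_assoc_left]
  show "clinear (assoc_left :: ('a, ('b, 'c) tensor) tensor \<Rightarrow> _)" by (rule clinear_assoc_left)
  show "assoc_left (1 \<otimes>\<^sub>a 1) = (1 :: (('a, 'b) tensor, 'c) tensor)"
    by (simp add: one_tensor_def)
  fix a c :: 'a and s t :: "('b, 'c) tensor"
  show "assoc_left (star a \<otimes>\<^sub>a star s) = star (assoc_left (a \<otimes>\<^sub>a s))"
    by (induction s rule: tensor_induct) (simp_all add: F star_add tensor_add)
  have *: "assoc_left ((a * c) \<otimes>\<^sub>a ((b \<otimes>\<^sub>a d) * t)) = assoc_left (a \<otimes>\<^sub>a b \<otimes>\<^sub>a d) * assoc_left (c \<otimes>\<^sub>a t)"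
    for b d
    by (induction t rule: tensor_induct) (simp_all add: F distrib_left tensor_add)
  show "assoc_left ((a * c) \<otimes>\<^sub>a (s * t)) = assoc_left (a \<otimes>\<^sub>a s) * assoc_left (c \<otimes>\<^sub>a t)"
    by (induction s rule: tensor_induct) (simp_all add: F distrib_right tensor_add *)
qed

section \<open>Slice maps\<close>

lemma clinear_tensor_slice:
  fixes f :: "'b::complex_vector \<Rightarrow> complex" and a :: "'a::complex_vector"
  assumes "clinear f"
  shows tensor_slice_tensor: "tensor_lift (\<lambda>a b. f b *\<^sub>C a) (a \<otimes>\<^sub>a b) = f b *\<^sub>C a"
    and "clinear (tensor_lift (\<lambda>(a::'a) b. f b *\<^sub>C a))"
proof -
  have "cbilinear (\<lambda>(a::'a) b. f b *\<^sub>C a)"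
    using assms by (simp add: cbilinear_iff clinear_iff scaleC_add_right scaleC_add_left mult.commute)
  then show "tensor_lift (\<lambda>a b. f b *\<^sub>C a) (a \<otimes>\<^sub>a b) = f b *\<^sub>C a"
    "clinear (tensor_lift (\<lambda>(a::'a) b. f b *\<^sub>C a))"
    by - (rule tensor_lift_alg_tensor clinear_tensor_lift, assumption)+
qed

lemma clinear_tensor_slice':
  fixes f :: "'a::complex_vector \<Rightarrow> complex" and b :: "'b::complex_vector"
  assumes "clinear f"
  shows tensor_slice_tensor': "tensor_lift (\<lambda>a b. f a *\<^sub>C b) (a \<otimes>\<^sub>a b) = f a *\<^sub>C b"
    and "clinear (tensor_lift (\<lambda>a (b::'b). f a *\<^sub>C b))"
proof -
  have "cbilinear (\<lambda>a (b::'b). f a *\<^sub>C b)"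
    using assms by (simp add: cbilinear_iff clinear_iff scaleC_add_right scaleC_add_left mult.commute)
  then show "tensor_lift (\<lambda>a b. f a *\<^sub>C b) (a \<otimes>\<^sub>a b) = f a *\<^sub>C b"
    "clinear (tensor_lift (\<lambda>a (b::'b). f a *\<^sub>C b))"
    by - (rule tensor_lift_alg_tensor clinear_tensor_lift, assumption)+
qed

text \<open>Slicing the second leg with a functional that is 1 at the unit recovers the first
  leg.\<close>

lemma tensor_one_right_inject [simp]:
  "a \<otimes>\<^sub>a (1 :: 'b::star_algebra) = b \<otimes>\<^sub>a 1 \<longleftrightarrow> a = b"
proof
  obtain f :: "'b \<Rightarrow> complex" where f: "clinear f" "f 1 = 1"
    by (rule clinear_functionals_separate[OF one_neq_zero])
  assume "a \<otimes>\<^sub>a (1 :: 'b) = b \<otimes>\<^sub>a 1"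
  then have "f 1 *\<^sub>C a = f 1 *\<^sub>C b"
    by (metis tensor_slice_tensor[OF f(1)])
  then show "a = b" by (simp only: f(2) scaleC_one)
qed simp

text \<open>In a Hamel basis of the first space, t is a finite sum of terms e \<otimes> t_e, where
  t_e is the slice of t by the coordinate functional of e; all t_e vanish by hypothesis.\<close>

lemma tensor_eq_zero_if_slices_zero:
  fixes t :: "('a::complex_vector, 'b::complex_vector) tensor"
  assumes "\<And>f. clinear f \<Longrightarrow> tensor_lift (\<lambda>a b. f a *\<^sub>C b) t = 0"
  shows "t = 0"
proof -
  define B :: "'a set" where "B = cvec.extend_basis {}"
  have B: "cvec.independent B" "cvec.span B = UNIV"
    unfolding B_def
    by (rule cvec.independent_extend_basis cvec.span_extend_basis cvec.independent_empty)+
  define r where "r = (\<lambda>e a. cvec.representation B a e)"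
  have r: "clinear (r e)" for e
    unfolding r_def clinear_iff
    using B by (auto simp: cvec.representation_add cvec.representation_scale)
  \<comment> \<open>Claimed for every finite F above E, so that the support of a new summand can be
    merged with the one found for t.\<close>
  have "\<exists>E. finite E \<and> E \<subseteq> B \<and> (\<forall>F. finite F \<longrightarrow> E \<subseteq> F \<longrightarrow> F \<subseteq> B \<longrightarrow>
      t = (\<Sum>e\<in>F. e \<otimes>\<^sub>a tensor_lift (\<lambda>a b. r e a *\<^sub>C b) t))"
  proof (induction t rule: tensor_induct)
    case zero
    show ?case by (intro exI[of _ "{}"]) (simp add: clinear_zero[OF clinear_tensor_slice'(2)[OF r]])
  next
    case (add a b t)
    then obtain E where E: "finite E" "E \<subseteq> B" and *: "\<And>F. finite F \<Longrightarrow> E \<subseteq> F \<Longrightarrow> F \<subseteq> B \<Longrightarrow>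
      t = (\<Sum>e\<in>F. e \<otimes>\<^sub>a tensor_lift (\<lambda>a b. r e a *\<^sub>C b) t)" by blast
    let ?E = "E \<union> {e. r e a \<noteq> 0}"
    show ?case
    proof (intro exI[of _ ?E] conjI allI impI)
      show "finite ?E" "?E \<subseteq> B"
        using E by (auto simp: r_def cvec.finite_representation dest: cvec.representation_ne_zero)
      fix F assume F: "finite F" "?E \<subseteq> F" "F \<subseteq> B"
      have "a = (\<Sum>e\<in>{e. r e a \<noteq> 0}. r e a *\<^sub>C e)"
        using cvec.sum_nonzero_representation_eq[OF B(1), of a] B by (simp add: r_def)
      also have "\<dots> = (\<Sum>e\<in>F. r e a *\<^sub>C e)"
        using F by (intro sum.mono_neutral_left) auto
      finally have ab: "a \<otimes>\<^sub>a b = (\<Sum>e\<in>F. e \<otimes>\<^sub>a (r e a *\<^sub>C b))"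
        using tensor_sum(1)[where f = "\<lambda>e. r e a *\<^sub>C e" and A = F and b = b] by (simp add: tensor_scale)
      have t: "t = (\<Sum>e\<in>F. e \<otimes>\<^sub>a tensor_lift (\<lambda>a b. r e a *\<^sub>C b) t)"
        using * F by blast
      have "(\<Sum>e\<in>F. e \<otimes>\<^sub>a tensor_lift (\<lambda>a b. r e a *\<^sub>C b) (a \<otimes>\<^sub>a b + t)) =
          (\<Sum>e\<in>F. e \<otimes>\<^sub>a (r e a *\<^sub>C b)) + (\<Sum>e\<in>F. e \<otimes>\<^sub>a tensor_lift (\<lambda>a b. r e a *\<^sub>C b) t)"
        by (simp add: clinear_add[OF clinear_tensor_slice'(2)[OF r]] tensor_slice_tensor'[OF r]
            tensor_add sum.distrib)
      then show "a \<otimes>\<^sub>a b + t = (\<Sum>e\<in>F. e \<otimes>\<^sub>a tensor_lift (\<lambda>a b. r e a *\<^sub>C b) (a \<otimes>\<^sub>a b + t))"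
        by (simp only: ab[symmetric] t[symmetric])
    qed
  qed
  then obtain E where "t = (\<Sum>e\<in>E. e \<otimes>\<^sub>a tensor_lift (\<lambda>a b. r e a *\<^sub>C b) t)" by blast
  then show ?thesis using assms[OF r] by simp
qed

lemma tensor_subspace_slice:
  assumes "clinear f" "t \<in> tensor_subspace A UNIV" "cvec.subspace A"
  shows "tensor_lift (\<lambda>a b. f b *\<^sub>C a) t \<in> A"
  using assms(2) unfolding tensor_subspace_def
proof (induction t rule: cvec.span_induct_alt)
  case base
  then show ?case
    by (simp add: clinear_zero[OF clinear_tensor_slice(2)[OF assms(1)]] cvec.subspace_0[OF assms(3)])
next
  case (step c x y)
  then show ?case
    using assms(3)
    by (auto simp: clinear_add[OF clinear_tensor_slice(2)[OF assms(1)]] cvec.subspace_add cvec.subspace_scale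
        clinear_scale[OF clinear_tensor_slice(2)[OF assms(1)]] tensor_slice_tensor[OF assms(1)])
qed


section \<open>Intertwiners\<close>

lemma mat_star_mult:
  "dim_col A = dim_row B \<Longrightarrow> mat_star (A * B) = mat_star B * mat_star (A :: 'a::star_algebra mat)"
  by (rule eq_matI) (simp_all add: mult_mat_entry star_sum star_mult del: index_mult_mat(1))

lemma amp_mult: "dim_col A = dim_row B \<Longrightarrow> amp (A * B) = amp A * amp B"
  by (rule eq_matI)
    (simp_all add: mult_mat_entry cvec.scale_sum_left mult_scaleC_left mult_scaleC_right
      mult.commute[of "B $$ _"] del: index_mult_mat(1))

lemma amp_mat_star: "amp (mat_star A) = mat_star (amp A)"
  by (rule eq_matI) (simp_all add: star_scaleC)

lemma amp_one_mat [simp]: "amp (1\<^sub>m n) = 1\<^sub>m n"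
  by (rule eq_matI) (simp_all add: scaleC_one)

lemma kron_one_mat_right [simp]: "kron A (1\<^sub>m (Suc 0)) = (A :: 'a::semiring_1 mat)"
  by (rule eq_matI) (simp_all add: kron_def)

lemma amp_carrier [simp]: "amp S \<in> carrier_mat m n \<longleftrightarrow> S \<in> carrier_mat m n"
  unfolding carrier_mat_def by auto

lemma mat_star_carrier [simp]: "mat_star S \<in> carrier_mat m n \<longleftrightarrow> S \<in> carrier_mat n m"
  unfolding carrier_mat_def by auto

lemma Mor_iff:
  "U \<in> carrier_mat m m \<Longrightarrow> V \<in> carrier_mat n n \<Longrightarrow>
    S \<in> Mor U V \<longleftrightarrow> S \<in> carrier_mat m n \<and> U * amp S = amp S * V"
  by (auto simp: Mor_def)

lemma Mor_mult:
  assumes "S \<in> Mor U V" "T \<in> Mor V W"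
    and c: "U \<in> carrier_mat l l" "V \<in> carrier_mat m m" "W \<in> carrier_mat n n"
  shows "S * T \<in> Mor U W"
proof -
  have S: "amp S \<in> carrier_mat l m" "U * amp S = amp S * V"
    and T: "amp T \<in> carrier_mat m n" "V * amp T = amp T * W"
    using assms by (simp_all add: Mor_iff)
  have "U * (amp S * amp T) = (U * amp S) * amp T"
    by (rule assoc_mult_mat[symmetric, OF c(1) S(1) T(1)])
  also have "\<dots> = amp S * (V * amp T)"
    by (simp only: S(2) assoc_mult_mat[OF S(1) c(2) T(1)])
  also have "\<dots> = (amp S * amp T) * W"
    by (simp only: T(2) assoc_mult_mat[OF S(1) T(1) c(3)])
  finally show ?thesis
    using S(1) T(1) by (simp add: Mor_iff[OF c(1,3)] amp_mult mult_carrier_mat[of _ _ m])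
qed

text \<open>Taking adjoints gives S^* U^* = V^* S^*; multiply by V on the left and by U on the
  right.\<close>

lemma Mor_mat_star:
  assumes "S \<in> Mor U V" and u: "unitary_mat U" "unitary_mat V"
    and c: "U \<in> carrier_mat m m" "V \<in> carrier_mat n n"
  shows "mat_star S \<in> Mor V U"
proof -
  let ?S = "mat_star (amp S)"
  have S: "amp S \<in> carrier_mat m n" "U * amp S = amp S * V"
    using assms by (simp_all add: Mor_iff)
  then have S': "?S \<in> carrier_mat n m" and U': "mat_star U \<in> carrier_mat m m"
    and V': "mat_star V \<in> carrier_mat n n"
    using c by simp_all
  have eq: "?S * mat_star U = mat_star V * ?S"
    using arg_cong[OF S(2), of mat_star] S(1) c by (simp add: mat_star_mult)
  have "V * ?S = V * (?S * (mat_star U * U))"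
    using u c S' by (simp add: unitary_mat_def)
  also have "\<dots> = V * ((?S * mat_star U) * U)"
    by (simp only: assoc_mult_mat[OF S' U' c(1)])
  also have "\<dots> = V * (mat_star V * (?S * U))"
    by (simp only: eq assoc_mult_mat[OF V' S' c(1)])
  also have "\<dots> = (V * mat_star V) * (?S * U)"
    by (rule assoc_mult_mat[symmetric, OF c(2) V' mult_carrier_mat[OF S' c(1)]])
  also have "\<dots> = ?S * U" using u c S' by (simp add: unitary_mat_def)
  finally show ?thesis using S' by (simp add: Mor_iff[OF c(2,1)] amp_mat_star)
qed

lemma Mor_smult:
  assumes "S \<in> Mor U V" and c: "U \<in> carrier_mat m m" "V \<in> carrier_mat n n"
  shows "k \<cdot>\<^sub>m S \<in> Mor U V"
proof -
  have S: "S \<in> carrier_mat m n" "U * amp S = amp S * V"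
    using assms by (simp_all add: Mor_iff)
  have *: "amp (k \<cdot>\<^sub>m S) = map_mat ((*\<^sub>C) k) (amp S)"
    by (rule eq_matI) simp_all
  have "U * map_mat ((*\<^sub>C) k) (amp S) = map_mat ((*\<^sub>C) k) (U * amp S)"
    using S(1) c by (intro eq_matI)
      (auto simp: mult_mat_entry mult_scaleC_right cvec.scale_sum_right simp del: index_mult_mat(1))
  moreover have "map_mat ((*\<^sub>C) k) (amp S) * V = map_mat ((*\<^sub>C) k) (amp S * V)"
    using S(1) c by (intro eq_matI)
      (auto simp: mult_mat_entry mult_scaleC_left cvec.scale_sum_right simp del: index_mult_mat(1))
  ultimately show ?thesis using S by (simp add: Mor_iff[OF c] *)
qed

text \<open>Schur's lemma: Y Y^* and Y^* Y are self-intertwiners, hence scalars \<mu> and \<nu>. A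
  nonzero entry makes \<nu> positive, computing Y Y^* Y in two ways shows \<mu> = \<nu>, and Y
  divided by the square root of \<nu> is unitary.\<close>

lemma Mor_irreducible_nonzero:
  assumes U: "irreducible_rep G U" and V: "irreducible_rep G V"
    and Y: "Y \<in> Mor U V" and nz: "i < dim_row Y" "j < dim_col Y" "Y $$ (i, j) \<noteq> 0"
  shows "equivalent_reps U V"
proof -
  define m n where "m = dim_row U" "n = dim_row V"
  have u: "unitary_mat U" "unitary_mat V" and c: "U \<in> carrier_mat m m" "V \<in> carrier_mat n n"
    using U V by (auto simp: irreducible_rep_def unitary_rep_def m_n_def)
  have Yc: "Y \<in> carrier_mat m n" "mat_star Y \<in> carrier_mat n m"
    using Y c by (simp_all add: Mor_iff)
  have Y': "mat_star Y \<in> Mor V U" by (rule Mor_mat_star[OF Y u c])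
  have "Y * mat_star Y \<in> Mor U U" using Mor_mult[OF Y Y' c c(1)] .
  then obtain \<mu> where \<mu>: "Y * mat_star Y = \<mu> \<cdot>\<^sub>m 1\<^sub>m m"
    using U by (auto simp: irreducible_rep_def m_n_def)
  have "mat_star Y * Y \<in> Mor V V" using Mor_mult[OF Y' Y c(2,1,2)] .
  then obtain \<nu> where \<nu>: "mat_star Y * Y = \<nu> \<cdot>\<^sub>m 1\<^sub>m n"
    using V by (auto simp: irreducible_rep_def m_n_def)
  have ij: "i < m" "j < n" using nz Yc by auto
  have "\<nu> = (mat_star Y * Y) $$ (j, j)" using ij by (simp add: \<nu>)
  also have "\<dots> = (\<Sum>k<m. cnj (Y $$ (k, j)) * Y $$ (k, j))"
    using ij Yc by (subst mult_mat_entry) (auto intro!: sum.cong)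
  also have "\<dots> = complex_of_real (\<Sum>k<m. (cmod (Y $$ (k, j)))\<^sup>2)"
    unfolding of_real_sum by (rule sum.cong[OF refl]) (metis complex_norm_square mult.commute)
  finally have \<nu>r: "\<nu> = complex_of_real (\<Sum>k<m. (cmod (Y $$ (k, j)))\<^sup>2)" .
  define r where "r = (\<Sum>k<m. (cmod (Y $$ (k, j)))\<^sup>2)"
  have r: "r > 0" unfolding r_def by (rule sum_pos2[of _ i]) (use ij nz in auto)
  have "\<mu> \<cdot>\<^sub>m Y = (Y * mat_star Y) * Y"
    using Yc by (simp add: \<mu> mult_smult_assoc_mat[OF one_carrier_mat Yc(1)])
  also have "\<dots> = \<nu> \<cdot>\<^sub>m Y"
    using Yc by (simp add: assoc_mult_mat[OF Yc(1) Yc(2) Yc(1)] \<nu> mult_smult_distrib[OF Yc(1) one_carrier_mat])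
  finally have "(\<mu> \<cdot>\<^sub>m Y) $$ (i, j) = (\<nu> \<cdot>\<^sub>m Y) $$ (i, j)" by simp
  then have \<mu>\<nu>: "\<mu> = \<nu>" using nz by simp
  define k where "k = complex_of_real (1 / sqrt r)"
  define T where "T = k \<cdot>\<^sub>m Y"
  have T: "T \<in> Mor U V" unfolding T_def by (rule Mor_smult[OF Y c])
  have k: "k * (k * \<nu>) = 1"
    unfolding k_def \<nu>r r_def[symmetric] of_real_mult[symmetric] using r by (simp add: field_simps)
  have st: "mat_star T = k \<cdot>\<^sub>m mat_star Y"
    unfolding T_def k_def by (rule eq_matI) auto
  have "mat_star T * T = k \<cdot>\<^sub>m (k \<cdot>\<^sub>m (mat_star Y * Y))"
    unfolding st unfolding T_def
    by (simp only: mult_smult_assoc_mat[OF Yc(2) smult_carrier_mat[OF Yc(1)]] mult_smult_distrib[OF Yc(2) Yc(1)])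
  then have "mat_star T * T = 1\<^sub>m n"
    using k by (intro eq_matI) (auto simp: \<nu>)
  moreover have "T * mat_star T = k \<cdot>\<^sub>m (k \<cdot>\<^sub>m (Y * mat_star Y))"
    unfolding st unfolding T_def
    by (simp only: mult_smult_assoc_mat[OF Yc(1) smult_carrier_mat[OF Yc(2)]] mult_smult_distrib[OF Yc(1) Yc(2)])
  then have "T * mat_star T = 1\<^sub>m m"
    using k by (intro eq_matI) (auto simp: \<mu> \<mu>\<nu>)
  ultimately have "unitary_mat T" using Yc by (simp add: unitary_mat_def T_def)
  with T show ?thesis by (auto simp: equivalent_reps_def)
qed


subsection \<open>Invariant vectors in tensor products of two spaces\<close>

text \<open>\<open>kron_maps P X S S'\<close> says \<open>P\<^sub>1\<^sub>3 X\<^sub>2\<^sub>3 (s \<otimes> 1) = s' \<otimes> 1\<close>, where \<open>S\<close>, \<open>S'\<close> hold the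
  coordinates of the vectors \<open>s\<close>, \<open>s'\<close>.\<close>

definition kron_maps ::
  "'a::star_algebra mat \<Rightarrow> 'a mat \<Rightarrow> (nat \<Rightarrow> nat \<Rightarrow> complex) \<Rightarrow> (nat \<Rightarrow> nat \<Rightarrow> complex) \<Rightarrow> bool" where
  "kron_maps P X S S' \<longleftrightarrow> (\<forall>a<dim_row P. \<forall>b<dim_row X.
     (\<Sum>i<dim_col P. \<Sum>j<dim_col X. S i j *\<^sub>C (P $$ (a, i) * X $$ (b, j))) = S' a b *\<^sub>C 1)"

text \<open>Undoes the Kronecker numbering of a tensor product basis; n is the dimension of the
  second factor.\<close>

definition vec_coords :: "nat \<Rightarrow> complex mat \<Rightarrow> nat \<Rightarrow> nat \<Rightarrow> complex" where
  "vec_coords n s i j = s $$ (i * n + j, 0)"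

lemma index_pair_less: "i < m \<Longrightarrow> j < n \<Longrightarrow> i * n + j < m * (n :: nat)"
  using mult_le_mono1[of "Suc i" m n] by simp

lemma kron_mult_amp_entry:
  assumes "a < dim_row P" "b < dim_row X" "dim_row s = dim_col P * dim_col X" "l < dim_col s"
  shows "(kron P X * amp s) $$ (a * dim_row X + b, l) =
    (\<Sum>i<dim_col P. \<Sum>j<dim_col X. s $$ (i * dim_col X + j, l) *\<^sub>C (P $$ (a, i) * X $$ (b, j)))"
  using assms
  by (simp add: mult_mat_entry index_pair_less sum_lessThan_mult kron_entry mult_scaleC_right
      del: index_mult_mat(1))

lemma kron_mapsI:
  assumes "kron P X * amp s = amp s'" "s \<in> carrier_mat (dim_col P * dim_col X) 1"
    "s' \<in> carrier_mat (dim_row P * dim_row X) 1"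
  shows "kron_maps P X (vec_coords (dim_col X) s) (vec_coords (dim_row X) s')"
  unfolding kron_maps_def vec_coords_def
proof (intro allI impI)
  fix a b assume ab: "a < dim_row P" "b < dim_row X"
  have "(kron P X * amp s) $$ (a * dim_row X + b, 0) = s' $$ (a * dim_row X + b, 0) *\<^sub>C 1"
    using assms ab by (simp add: index_pair_less)
  then show "(\<Sum>i<dim_col P. \<Sum>j<dim_col X. s $$ (i * dim_col X + j, 0) *\<^sub>C (P $$ (a, i) * X $$ (b, j))) =
      s' $$ (a * dim_row X + b, 0) *\<^sub>C 1"
    using kron_mult_amp_entry[OF ab, of s 0] assms by simp
qed

text \<open>Multiplying by the adjoint of P moves one leg to the other side. This is the main tool
  for invariant vectors: it trades entries of X for adjoints of entries of P.\<close>

lemma kron_maps_cross: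
  assumes "kron_maps P X S S'" and P: "unitary_mat P" "P \<in> carrier_mat p q"
    and X: "X \<in> carrier_mat m n" and ib: "i < q" "b < m"
  shows "(\<Sum>j<n. S i j *\<^sub>C X $$ (b, j)) = (\<Sum>a<p. S' a b *\<^sub>C star (P $$ (a, i)))"
proof -
  have "(\<Sum>a<p. S' a b *\<^sub>C star (P $$ (a, i))) = (\<Sum>a<p. star (P $$ (a, i)) * (S' a b *\<^sub>C 1))"
    by (simp add: mult_scaleC_right)
  also have "\<dots> = (\<Sum>a<p. star (P $$ (a, i)) * (\<Sum>k<q. \<Sum>j<n. S k j *\<^sub>C (P $$ (a, k) * X $$ (b, j))))"
    using assms by (auto simp: kron_maps_def intro!: sum.cong)
  also have "\<dots> = (\<Sum>a<p. \<Sum>k<q. \<Sum>j<n. S k j *\<^sub>C (star (P $$ (a, i)) * P $$ (a, k) * X $$ (b, j)))"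
    by (simp add: sum_distrib_left mult_scaleC_right mult.assoc)
  also have "\<dots> = (\<Sum>k<q. \<Sum>j<n. \<Sum>a<p. S k j *\<^sub>C (star (P $$ (a, i)) * P $$ (a, k) * X $$ (b, j)))"
    by (subst sum.swap, rule sum.cong[OF refl], rule sum.swap)
  also have "\<dots> = (\<Sum>k<q. \<Sum>j<n. S k j *\<^sub>C ((\<Sum>a<p. star (P $$ (a, i)) * P $$ (a, k)) * X $$ (b, j)))"
    by (simp add: sum_distrib_right cvec.scale_sum_right)
  also have "\<dots> = (\<Sum>k<q. if i = k then \<Sum>j<n. S k j *\<^sub>C X $$ (b, j) else 0)"
    using ib by (intro sum.cong refl) (simp add: unitary_mat_columns[OF P])
  finally show ?thesis using ib by simp
qed

lemma kron_maps_cross_star: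
  assumes "kron_maps P X S S'" "unitary_mat P" "P \<in> carrier_mat p q" "X \<in> carrier_mat m n" "i < q" "b < m"
  shows "(\<Sum>j<n. cnj (S i j) *\<^sub>C star (X $$ (b, j))) = (\<Sum>a<p. cnj (S' a b) *\<^sub>C P $$ (a, i))"
  using arg_cong[OF kron_maps_cross[OF assms], of star] by (simp add: star_sum star_scaleC star_star)

text \<open>The operator P_13 X_23 is an isometry. One factor s' is expanded,
  \<open>kron_maps_cross_star\<close> removes P, and orthonormality of the columns removes
  X.\<close>

lemma kron_maps_norm:
  assumes K: "kron_maps P X S S'" and P: "unitary_mat P" "P \<in> carrier_mat p q"
    and X: "unitary_mat X" "X \<in> carrier_mat m n"
  shows "(\<Sum>a<p. \<Sum>b<m. cnj (S' a b) * S' a b) = (\<Sum>i<q. \<Sum>j<n. cnj (S i j) * S i j)"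
proof -
  have "(\<Sum>a<p. \<Sum>b<m. cnj (S' a b) * S' a b) *\<^sub>C (1 :: 'a)
      = (\<Sum>b<m. \<Sum>a<p. cnj (S' a b) *\<^sub>C S' a b *\<^sub>C 1)"
    by (subst sum.swap) (simp add: cvec.scale_sum_left)
  also have "\<dots> = (\<Sum>b<m. \<Sum>a<p. cnj (S' a b) *\<^sub>C (\<Sum>i<q. \<Sum>j<n. S i j *\<^sub>C (P $$ (a, i) * X $$ (b, j))))"
    using K P X by (auto simp: kron_maps_def intro!: sum.cong)
  also have "\<dots> = (\<Sum>b<m. \<Sum>a<p. \<Sum>i<q. (cnj (S' a b) *\<^sub>C P $$ (a, i)) * (\<Sum>j<n. S i j *\<^sub>C X $$ (b, j)))"
    by (simp add: cvec.scale_sum_right sum_distrib_left mult_scaleC_right mult_scaleC_left mult.commute)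
  also have "\<dots> = (\<Sum>b<m. \<Sum>i<q. (\<Sum>a<p. cnj (S' a b) *\<^sub>C P $$ (a, i)) * (\<Sum>j<n. S i j *\<^sub>C X $$ (b, j)))"
    by (rule sum.cong[OF refl], subst sum.swap) (simp add: sum_distrib_right)
  also have "\<dots> = (\<Sum>b<m. \<Sum>i<q. (\<Sum>k<n. cnj (S i k) *\<^sub>C star (X $$ (b, k))) * (\<Sum>j<n. S i j *\<^sub>C X $$ (b, j)))"
    by (intro sum.cong refl) (simp add: kron_maps_cross_star[OF K P X(2)])
  also have "\<dots> = (\<Sum>b<m. \<Sum>i<q. \<Sum>k<n. \<Sum>j<n. (cnj (S i k) * S i j) *\<^sub>C (star (X $$ (b, k)) * X $$ (b, j)))"
    by (simp add: sum_product mult_scaleC_left mult_scaleC_right mult.commute[of "cnj _"])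
  also have "\<dots> = (\<Sum>i<q. \<Sum>k<n. \<Sum>j<n. \<Sum>b<m. (cnj (S i k) * S i j) *\<^sub>C (star (X $$ (b, k)) * X $$ (b, j)))"
    by (subst sum.swap, rule sum.cong[OF refl], subst sum.swap, rule sum.cong[OF refl], rule sum.swap)
  also have "\<dots> = (\<Sum>i<q. \<Sum>k<n. \<Sum>j<n. (cnj (S i k) * S i j) *\<^sub>C (if k = j then 1 else 0))"
    by (intro sum.cong refl) (simp add: cvec.scale_sum_right[symmetric] unitary_mat_columns[OF X])
  also have "\<dots> = (\<Sum>i<q. \<Sum>k<n. \<Sum>j<n. if k = j then (cnj (S i k) * S i j) *\<^sub>C 1 else 0)"
    by (intro sum.cong refl) simp
  also have "\<dots> = (\<Sum>i<q. \<Sum>j<n. cnj (S i j) * S i j) *\<^sub>C 1"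
    by (simp add: cvec.scale_sum_left)
  finally show ?thesis by (simp only: scaleC_one_eq_iff)
qed

text \<open>Solutions of the conjugate equation go to solutions. With Z the sought numbers for fixed
  b, the two cross relations show that row b of X is the combination of the rows of X with
  coefficients Z; multiplying by X^* on the right determines Z.\<close>

lemma kron_maps_conjugate:
  assumes N: "kron_maps X P N N'" and S: "kron_maps P X S S'"
    and P: "unitary_mat P" "P \<in> carrier_mat p q" and X: "unitary_mat X" "X \<in> carrier_mat m n"
    and eq: "\<And>j l. j < n \<Longrightarrow> l < n \<Longrightarrow> (\<Sum>i<q. cnj (N j i) * S i l) = (if j = l then 1 else 0)"
    and cb: "c < m" "b < m"
  shows "(\<Sum>a<p. cnj (N' c a) * S' a b) = (if c = b then 1 else 0)"
proof -
  define Z where "Z k = (\<Sum>a<p. cnj (N' k a) * S' a b)" for k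
  have *: "X $$ (b, l) = (\<Sum>k<m. Z k *\<^sub>C X $$ (k, l))" if l: "l < n" for l
  proof -
    have "X $$ (b, l) = (\<Sum>j<n. (\<Sum>i<q. cnj (N l i) * S i j) *\<^sub>C X $$ (b, j))"
      using l by (simp add: eq if_distrib[of "\<lambda>c. c *\<^sub>C _"] scaleC_one cong: if_cong)
    also have "\<dots> = (\<Sum>i<q. cnj (N l i) *\<^sub>C (\<Sum>j<n. S i j *\<^sub>C X $$ (b, j)))"
      by (simp add: cvec.scale_sum_left cvec.scale_sum_right) (rule sum.swap)
    also have "\<dots> = (\<Sum>i<q. cnj (N l i) *\<^sub>C (\<Sum>a<p. S' a b *\<^sub>C star (P $$ (a, i))))"
      using cb by (intro sum.cong refl) (simp add: kron_maps_cross[OF S P X(2)])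
    also have "\<dots> = (\<Sum>a<p. S' a b *\<^sub>C (\<Sum>i<q. cnj (N l i) *\<^sub>C star (P $$ (a, i))))"
      by (simp add: cvec.scale_sum_right mult.commute) (rule sum.swap)
    also have "\<dots> = (\<Sum>a<p. S' a b *\<^sub>C (\<Sum>k<m. cnj (N' k a) *\<^sub>C X $$ (k, l)))"
      using l by (intro sum.cong refl) (simp add: kron_maps_cross_star[OF N X P(2)])
    also have "\<dots> = (\<Sum>k<m. Z k *\<^sub>C X $$ (k, l))"
      unfolding Z_def by (simp add: cvec.scale_sum_right cvec.scale_sum_left mult.commute) (rule sum.swap)
    finally show ?thesis .
  qed
  have "(if b = c then 1 else 0) = (\<Sum>l<n. X $$ (b, l) * star (X $$ (c, l)))"
    by (simp add: unitary_mat_rows[OF X cb(2,1)])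
  also have "\<dots> = (\<Sum>l<n. (\<Sum>k<m. Z k *\<^sub>C X $$ (k, l)) * star (X $$ (c, l)))"
    by (intro sum.cong refl) (simp add: *[symmetric])
  also have "\<dots> = (\<Sum>k<m. Z k *\<^sub>C (\<Sum>l<n. X $$ (k, l) * star (X $$ (c, l))))"
    by (simp add: cvec.scale_sum_right sum_distrib_right mult_scaleC_left) (rule sum.swap)
  also have "\<dots> = (\<Sum>k<m. if k = c then Z k *\<^sub>C 1 else 0)"
    using cb by (intro sum.cong refl) (simp add: unitary_mat_rows[OF X])
  also have "\<dots> = Z c *\<^sub>C 1" using cb by simp
  finally have "Z c *\<^sub>C (1 :: 'a) = (if b = c then 1 else 0) *\<^sub>C 1"
    by (metis scaleC_one cvec.scale_zero_left)
  then have "Z c = (if b = c then 1 else 0)" by (simp only: scaleC_one_eq_iff)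
  then show ?thesis by (auto simp: Z_def)
qed

text \<open>Composing an invariant vector of \<open>V \<otimes> U\<close> with the adjoint of one of \<open>U \<otimes> W\<close> gives an
  intertwiner between \<open>V\<close> and \<open>W\<close>.\<close>

lemma Mor_contract:
  assumes S: "kron_maps V U S S" and N: "kron_maps U W N N"
    and V: "unitary_mat V" "V \<in> carrier_mat l l" and U: "unitary_mat U" "U \<in> carrier_mat n n"
    and W: "unitary_mat W" "W \<in> carrier_mat m m"
  shows "mat l m (\<lambda>(a, r). \<Sum>k<n. S a k * cnj (N k r)) \<in> Mor V W" (is "?Y \<in> _")
proof -
  let ?c = "carrier_mat" and ?y = "\<lambda>a r. \<Sum>k<n. S a k * cnj (N k r)"
  have c: "V \<in> ?c l l" "W \<in> ?c m m" "mat_star V \<in> ?c l l" "mat_star W \<in> ?c m m" "amp ?Y \<in> ?c l m"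
    using V W by (auto simp: mat_star_def)
  \<comment> \<open>The cross relations yield the relation for the adjoints; unitarity of V and W
    then turns it around.\<close>
  have "mat_star V * amp ?Y = amp ?Y * mat_star W"
  proof (rule eq_matI)
    fix p q assume "p < dim_row (amp ?Y * mat_star W)" "q < dim_col (amp ?Y * mat_star W)"
    then have pq: "p < l" "q < m" using W by auto
    have "(mat_star V * amp ?Y) $$ (p, q) = (\<Sum>a<l. ?y a q *\<^sub>C star (V $$ (a, p)))"
      using pq V by (subst mult_mat_entry) (auto intro!: sum.cong simp: mult_scaleC_right)
    also have "\<dots> = (\<Sum>k<n. cnj (N k q) *\<^sub>C (\<Sum>a<l. S a k *\<^sub>C star (V $$ (a, p))))"
      by (simp add: cvec.scale_sum_right cvec.scale_sum_left mult.commute) (rule sum.swap)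
    also have "\<dots> = (\<Sum>k<n. cnj (N k q) *\<^sub>C (\<Sum>j<n. S p j *\<^sub>C U $$ (k, j)))"
      using pq by (intro sum.cong refl) (simp add: kron_maps_cross[OF S V U(2)])
    also have "\<dots> = (\<Sum>j<n. S p j *\<^sub>C (\<Sum>k<n. cnj (N k q) *\<^sub>C U $$ (k, j)))"
      by (simp add: cvec.scale_sum_right mult.commute) (rule sum.swap)
    also have "\<dots> = (\<Sum>j<n. S p j *\<^sub>C (\<Sum>r<m. cnj (N j r) *\<^sub>C star (W $$ (q, r))))"
      using pq by (intro sum.cong refl) (simp add: kron_maps_cross_star[OF N U W(2)])
    also have "\<dots> = (\<Sum>r<m. ?y p r *\<^sub>C star (W $$ (q, r)))"
      by (simp add: cvec.scale_sum_right cvec.scale_sum_left) (rule sum.swap)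
    also have "\<dots> = (amp ?Y * mat_star W) $$ (p, q)"
      using pq W by (subst mult_mat_entry) (auto intro!: sum.cong simp: mult_scaleC_left)
    finally show "(mat_star V * amp ?Y) $$ (p, q) = (amp ?Y * mat_star W) $$ (p, q)" .
  qed (use V W in auto)
  note eq = this
  have "amp ?Y * W = ((V * mat_star V) * amp ?Y) * W"
    using V c by (simp add: unitary_mat_def)
  also have "\<dots> = (V * (amp ?Y * mat_star W)) * W"
    by (simp only: assoc_mult_mat[OF c(1,3,5)] eq)
  also have "\<dots> = (V * amp ?Y) * (mat_star W * W)"
    by (simp only: assoc_mult_mat[symmetric, OF c(1,5,4)]
        assoc_mult_mat[OF mult_carrier_mat[OF c(1,5)] c(4,2)])
  also have "\<dots> = V * amp ?Y" using W c by (simp add: unitary_mat_def)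
  finally show ?thesis using V W by (auto simp: Mor_def)
qed


section \<open>Compact quantum groups\<close>

lemma cstar_tensorD:
  assumes "cstar_tensor \<iota>"
  shows "cbilinear \<iota>" "\<iota> 1 1 = 1" "\<iota> a b * \<iota> a' b' = \<iota> (a * a') (b * b')"
    "star (\<iota> a b) = \<iota> (star a) (star b)" "inj (tensor_lift \<iota>)"
  using assms by (simp_all add: cstar_tensor_def)

locale qgroup =
  fixes G :: "('g::cstar_algebra, 'gg::cstar_algebra, 'ggg::cstar_algebra, 'x) cqg"
  assumes data: "quantum_group_data G"
begin

lemma irr_irreducible: "irreducible_rep G (irr G x)"
  using data by (simp add: quantum_group_data_def irreducible_representatives_def)

lemma irr_carrier: "irr G x \<in> carrier_mat (hdim G x) (hdim G x)"
  and irr_unitary: "unitary_mat (irr G x)"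
  and hdim_pos: "0 < hdim G x"
  and comult_irr_mat: "map_mat (comult G) (irr G x) = legs (tens2 G) (irr G x) (irr G x)"
  using irr_irreducible[of x]
  by (auto simp: irreducible_rep_def unitary_rep_def hdim_def)

lemma irr_dim [simp]: "dim_row (irr G x) = hdim G x" "dim_col (irr G x) = hdim G x"
  using irr_carrier[of x] by auto

lemma comult_irr:
  assumes "i < hdim G x" "j < hdim G x"
  shows "comult G (irr G x $$ (i, j)) = (\<Sum>k<hdim G x. tens2 G (irr G x $$ (i, k)) (irr G x $$ (k, j)))"
  using arg_cong[OF comult_irr_mat[of x], of "\<lambda>M. M $$ (i, j)"] assms by simp

lemma irr_triv: "irr G (triv G) = 1\<^sub>m 1"
  using data by (simp add: quantum_group_data_def irreducible_representatives_def)

lemma hdim_triv [simp]: "hdim G (triv G) = 1"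
  by (simp add: hdim_def irr_triv)

lemma comult_hom: "unital_star_hom (comult G)"
  and tens2_tensor: "cstar_tensor (tens2 G)"
  using data by (simp_all add: quantum_group_data_def compact_quantum_group_def cstar_triple_tensor_def)

lemma haar_state: "state (haar G)"
  using data by (simp add: quantum_group_data_def haar_state_def)

lemma haar_linear: "clinear (haar G)" and haar_one: "haar G 1 = 1"
  using haar_state by (simp_all add: state_def)

text \<open>Invariance is given for continuous extensions to the C*-tensor product. On elementary
  tensors these agree with the slice maps, hence on the whole algebraic tensor product, where
  comultiplied coefficients live.\<close>

lemma haar_invariant:
  assumes "comult G a = tensor_lift (tens2 G) t"
  shows haar_left: "tensor_lift (\<lambda>b c. haar G b *\<^sub>C c) t = haar G a *\<^sub>C 1"
    and haar_right: "tensor_lift (\<lambda>b c. haar G c *\<^sub>C b) t = haar G a *\<^sub>C 1"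
proof -
  note b = cstar_tensorD(1)[OF tens2_tensor]
  obtain F1 F2 where F1: "tensor_extension (tens2 G) (\<lambda>a b. haar G a *\<^sub>C b) F1"
    and F2: "tensor_extension (tens2 G) (\<lambda>a b. haar G b *\<^sub>C a) F2"
    and F: "\<And>a. F1 (comult G a) = haar G a *\<^sub>C 1" "\<And>a. F2 (comult G a) = haar G a *\<^sub>C 1"
    using data by (auto simp: quantum_group_data_def haar_state_def)
  have "(\<lambda>t. F1 (tensor_lift (tens2 G) t)) = tensor_lift (\<lambda>b c. haar G b *\<^sub>C c)"
    by (rule tensor_lift_unique[OF clinear_compose[OF _ clinear_tensor_lift[OF b]]
          clinear_tensor_slice'(2)[OF haar_linear]])
      (use F1 in \<open>simp_all add: tensor_extension_def tensor_lift_alg_tensor[OF b] tensor_slice_tensor'[OF haar_linear]\<close>)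
  then show "tensor_lift (\<lambda>b c. haar G b *\<^sub>C c) t = haar G a *\<^sub>C 1"
    using F(1)[of a] assms by (simp add: fun_eq_iff)
  have "(\<lambda>t. F2 (tensor_lift (tens2 G) t)) = tensor_lift (\<lambda>b c. haar G c *\<^sub>C b)"
    by (rule tensor_lift_unique[OF clinear_compose[OF _ clinear_tensor_lift[OF b]]
          clinear_tensor_slice(2)[OF haar_linear]])
      (use F2 in \<open>simp_all add: tensor_extension_def tensor_lift_alg_tensor[OF b] tensor_slice_tensor[OF haar_linear]\<close>)
  then show "tensor_lift (\<lambda>b c. haar G c *\<^sub>C b) t = haar G a *\<^sub>C 1"
    using F(2)[of a] assms by (simp add: fun_eq_iff)
qed


subsection \<open>Orthogonality relations\<close>

text \<open>The matrix F of the overview. Column 0 stands for an arbitrary column;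
  \<open>haar_orthogonality\<close> shows that the choice does not matter.\<close>

definition haar_form :: "'x \<Rightarrow> nat \<Rightarrow> nat \<Rightarrow> complex" where
  "haar_form x k l = haar G (star (irr G x $$ (k, 0)) * irr G x $$ (l, 0))"

context
  fixes x :: 'x
begin

private abbreviation (input) "d \<equiv> hdim G x"
private abbreviation (input) "u i j \<equiv> irr G x $$ (i, j)"

private lemma comult_product:
  assumes "i < d" "j < d" "k < d" "l < d"
  shows "comult G (star (u k i) * u l j) =
    tensor_lift (tens2 G) (\<Sum>p<d. \<Sum>q<d. (star (u k p) * u l q) \<otimes>\<^sub>a (star (u p i) * u q j))"
proof -
  note t = cstar_tensorD[OF tens2_tensor] and h = unital_star_homD[OF comult_hom]
  show ?thesis
    using assms
    by (simp add: h comult_irr star_sum t sum_product clinear_sum[OF clinear_tensor_lift[OF t(1)]]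
        tensor_lift_alg_tensor[OF t(1)])
qed

text \<open>Right invariance of h at a product of two entries from column 0. In
  \<open>haar_form_X\<close> it makes the F-weighted sum invariant under \<delta>2.\<close>

lemma haar_form_invariant:
  assumes "k < d" "l < d"
  shows "(\<Sum>p<d. \<Sum>q<d. haar_form x p q *\<^sub>C (star (u k p) * u l q)) = haar_form x k l *\<^sub>C 1"
  using haar_right[OF comult_product[OF hdim_pos hdim_pos assms]]
  by (simp add: clinear_sum[OF clinear_tensor_slice(2)[OF haar_linear]]
      tensor_slice_tensor[OF haar_linear] haar_form_def)

text \<open>For fixed k and l, left invariance says U^* Y U = Y for the matrix Y of the values
  h(u_kp^* u_lq). Hence Y is a self-intertwiner of an irreducible representation, so a scalar, read
  off at entry (0, 0).\<close>

lemma haar_orthogonality: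
  assumes "i < d" "j < d" "k < d" "l < d"
  shows "haar G (star (u k i) * u l j) = (if i = j then haar_form x k l else 0)"
proof -
  define Y where "Y = mat d d (\<lambda>(p, q). haar G (star (u k p) * u l q))"
  let ?U = "irr G x"
  have c: "?U \<in> carrier_mat d d" "mat_star ?U \<in> carrier_mat d d" "amp Y \<in> carrier_mat d d"
    using irr_carrier by (simp_all add: Y_def)
  have "mat_star ?U * (amp Y * ?U) = amp Y"
  proof (rule eq_matI)
    fix a b assume "a < dim_row (amp Y)" "b < dim_col (amp Y)"
    then have ab: "a < d" "b < d" by (auto simp: Y_def)
    have "(mat_star ?U * (amp Y * ?U)) $$ (a, b) =
        (\<Sum>p<d. \<Sum>q<d. haar G (star (u k p) * u l q) *\<^sub>C (star (u p a) * u q b))"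
      using ab by (simp add: Y_def mult_mat_entry mult_scaleC_left mult_scaleC_right sum_distrib_left
          del: index_mult_mat(1))
    also have "\<dots> = haar G (star (u k a) * u l b) *\<^sub>C 1"
      using haar_left[OF comult_product[OF ab assms(3,4)]]
      by (simp add: clinear_sum[OF clinear_tensor_slice'(2)[OF haar_linear]]
          tensor_slice_tensor'[OF haar_linear])
    finally show "(mat_star ?U * (amp Y * ?U)) $$ (a, b) = amp Y $$ (a, b)"
      using ab by (simp add: Y_def)
  qed (auto simp: Y_def)
  then have "?U * amp Y = ?U * (mat_star ?U * (amp Y * ?U))" by simp
  also have "\<dots> = (?U * mat_star ?U) * (amp Y * ?U)"
    by (rule assoc_mult_mat[symmetric, OF c(1,2) mult_carrier_mat[OF c(3,1)]])
  also have "\<dots> = amp Y * ?U"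
    using irr_unitary[of x] c by (simp add: unitary_mat_def)
  finally have "Y \<in> Mor ?U ?U" using c by (simp add: Mor_iff)
  then obtain c where c: "Y = c \<cdot>\<^sub>m 1\<^sub>m d"
    using irr_irreducible[of x] by (auto simp: irreducible_rep_def)
  have Y: "haar G (star (u k p) * u l q) = (if p = q then c else 0)" if "p < d" "q < d" for p q
    using arg_cong[OF c, of "\<lambda>M. M $$ (p, q)"] that by (simp add: Y_def)
  show ?thesis
    using Y[OF assms(1,2)] Y[OF hdim_pos hdim_pos] by (simp add: haar_form_def)
qed

text \<open>Column 0 of u is a unit vector and h(1) = 1. This normalization fixes the scalar in
  \<open>haar_form_X\<close>.\<close>

lemma haar_form_trace: "(\<Sum>k<d. haar_form x k k) = 1"
  unfolding haar_form_def
  by (simp add: clinear_sum[OF haar_linear, symmetric] haar_one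
      unitary_mat_columns[OF irr_unitary irr_carrier hdim_pos hdim_pos])

end


subsection \<open>Contragredients\<close>

lemma tensor_rep_single: "tensor_rep G [x] = irr G x"
  and tensor_rep_pair: "tensor_rep G [x, y] = kron (irr G x) (irr G y)"
  unfolding tensor_rep_def by simp_all

lemma MorI_pair_triv:
  assumes "S \<in> MorI G [y, x] [triv G]"
  shows "S \<in> carrier_mat (hdim G y * hdim G x) 1"
    and "kron_maps (irr G y) (irr G x) (vec_coords (hdim G x) S) (vec_coords (hdim G x) S)"
proof -
  have S: "S \<in> carrier_mat (hdim G y * hdim G x) 1"
    and eq: "kron (irr G y) (irr G x) * amp S = amp S * irr G (triv G)"
    using assms by (simp_all add: MorI_def Mor_def tensor_rep_single tensor_rep_pair)
  have "kron (irr G y) (irr G x) * amp S = amp S"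
    using S unfolding eq irr_triv by simp
  then show "kron_maps (irr G y) (irr G x) (vec_coords (hdim G x) S) (vec_coords (hdim G x) S)"
    using kron_mapsI[of "irr G y" "irr G x" S S] S by simp
  show "S \<in> carrier_mat (hdim G y * hdim G x) 1" by fact
qed

lemma Mor_irr_scalar:
  assumes "Y \<in> Mor (irr G x) (irr G x)"
  obtains c where "\<And>i j. i < hdim G x \<Longrightarrow> j < hdim G x \<Longrightarrow> Y $$ (i, j) = (if i = j then c else 0)"
proof -
  obtain c where "Y = c \<cdot>\<^sub>m 1\<^sub>m (hdim G x)"
    using assms irr_irreducible[of x] by (auto simp: irreducible_rep_def)
  then show ?thesis using that[of c] by simp
qed

lemma MorI_contract:
  assumes "S \<in> MorI G [y, x] [triv G]" "t \<in> MorI G [x, z] [triv G]"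
  shows "mat (hdim G y) (hdim G z) (\<lambda>(a, r). \<Sum>k<hdim G x.
      vec_coords (hdim G x) S a k * cnj (vec_coords (hdim G z) t k r)) \<in> Mor (irr G y) (irr G z)"
  by (rule Mor_contract[OF MorI_pair_triv(2)[OF assms(1)] MorI_pair_triv(2)[OF assms(2)]
        irr_unitary irr_carrier irr_unitary irr_carrier irr_unitary irr_carrier])

context
  fixes x :: 'x
begin

private abbreviation (input) "n \<equiv> hdim G x"
private abbreviation (input) "m \<equiv> hdim G (contra G x)"
private abbreviation (input) "N \<equiv> vec_coords m (tvec G x)"
private abbreviation (input) "S \<equiv> vec_coords n (svec G x)"

lemma tvec_Mor: "tvec G x \<in> MorI G [x, contra G x] [triv G]"
  and svec_Mor: "svec G x \<in> MorI G [contra G x, x] [triv G]"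
  and conjugate_mat: "kron (mat_star (tvec G x)) (1\<^sub>m n) * kron (1\<^sub>m n) (svec G x) = 1\<^sub>m n"
  using data by (simp_all add: quantum_group_data_def contragredient_choice_def Let_def)

text \<open>Entry (k, j) of the matrix form, with the index of the threefold tensor product split
  into (a, p, b). The two Kronecker products bracket this index differently, which the distributive
  law reconciles.\<close>

lemma conjugate_equation:
  assumes "j < n" "k < n"
  shows "(\<Sum>p<m. cnj (N j p) * S p k) = (if j = k then 1 else 0)"
proof -
  let ?t = "tvec G x" and ?s = "svec G x"
  have t: "?t \<in> carrier_mat (n * m) 1" and s: "?s \<in> carrier_mat (m * n) 1"
    using MorI_pair_triv(1)[OF tvec_Mor] MorI_pair_triv(1)[OF svec_Mor] by auto
  have l: "kron (mat_star ?t) (1\<^sub>m n) $$ (k, (a * m + p) * n + b) = cnj (N a p) * (if k = b then 1 else 0)"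
    if "a < n" "p < m" "b < n" for a p b
    using kron_entry[of 0 "mat_star ?t" k "1\<^sub>m n" "a * m + p" b] that assms t
    by (simp add: vec_coords_def index_pair_less)
  have r: "kron (1\<^sub>m n) ?s $$ ((a * m + p) * n + b, j) = (if a = j then 1 else 0) * S p b"
    if "a < n" "p < m" "b < n" for a p b
  proof -
    have "p * n + b < m * n" by (rule index_pair_less[OF that(2,3)])
    then have "kron (1\<^sub>m n) ?s $$ (a * (m * n) + (p * n + b), j) = (if a = j then 1 else 0) * S p b"
      using kron_entry[of a "1\<^sub>m n" "p * n + b" ?s j 0] that assms s
      by (simp add: vec_coords_def)
    then show ?thesis by (simp add: distrib_right mult.assoc add.assoc)
  qed
  have "(kron (mat_star ?t) (1\<^sub>m n) * kron (1\<^sub>m n) ?s) $$ (k, j) =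
      (\<Sum>q<n * m * n. kron (mat_star ?t) (1\<^sub>m n) $$ (k, q) * kron (1\<^sub>m n) ?s $$ (q, j))"
    using assms t s by (subst mult_mat_entry) (auto simp: mult.assoc)
  also have "\<dots> = (\<Sum>a<n. \<Sum>p<m. \<Sum>b<n. (cnj (N a p) * (if k = b then 1 else 0)) * ((if a = j then 1 else 0) * S p b))"
    by (simp add: sum_lessThan_mult l r)
  also have "\<dots> = (\<Sum>a<n. \<Sum>p<m. \<Sum>b<n. if k = b then if a = j then cnj (N a p) * S p b else 0 else 0)"
    by (intro sum.cong refl) simp
  also have "\<dots> = (\<Sum>a<n. if a = j then \<Sum>p<m. \<Sum>b<n. if k = b then cnj (N a p) * S p b else 0 else 0)"
    by (rule sum.cong[OF refl]) (simp cong: if_cong)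
  also have "\<dots> = (\<Sum>p<m. cnj (N j p) * S p k)"
    using assms by simp
  finally show ?thesis using assms by (auto simp: conjugate_mat)
qed

text \<open>By Schur's lemma the contraction of s with t is a scalar c times the identity. Inserting
  the first conjugate equation into its own entry (0, 0) and regrouping evaluates 1 to c.\<close>

lemma conjugate_equation':
  assumes "p < m" "q < m"
  shows "(\<Sum>k<n. S p k * cnj (N k q)) = (if p = q then 1 else 0)"
proof -
  obtain c where "\<And>p q. p < m \<Longrightarrow> q < m \<Longrightarrow>
      mat m m (\<lambda>(a, r). \<Sum>k<n. S a k * cnj (N k r)) $$ (p, q) = (if p = q then c else 0)"
    using Mor_irr_scalar[OF MorI_contract[OF svec_Mor tvec_Mor]] by blast
  then have c: "(\<Sum>k<n. S p k * cnj (N k q)) = (if p = q then c else 0)" if "p < m" "q < m" for p q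
    using that by simp
  have "1 = (\<Sum>p<m. cnj (N 0 p) * S p 0)"
    using conjugate_equation[OF hdim_pos hdim_pos] by simp
  also have "\<dots> = (\<Sum>p<m. \<Sum>k<n. cnj (N 0 p) * (S p k * (\<Sum>q<m. cnj (N k q) * S q 0)))"
  proof (intro sum.cong refl)
    fix p
    have "(\<Sum>k<n. cnj (N 0 p) * (S p k * (\<Sum>q<m. cnj (N k q) * S q 0))) =
        (\<Sum>k<n. if k = 0 then cnj (N 0 p) * S p k else 0)"
      by (intro sum.cong refl) (simp add: conjugate_equation hdim_pos)
    then show "cnj (N 0 p) * S p 0 = (\<Sum>k<n. cnj (N 0 p) * (S p k * (\<Sum>q<m. cnj (N k q) * S q 0)))"
      using hdim_pos by simp
  qed
  also have "\<dots> = (\<Sum>p<m. \<Sum>q<m. cnj (N 0 p) * ((\<Sum>k<n. S p k * cnj (N k q)) * S q 0))"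
    by (rule sum.cong[OF refl], simp add: sum_distrib_left sum_distrib_right mult.assoc, rule sum.swap)
  also have "\<dots> = (\<Sum>p<m. \<Sum>q<m. if p = q then cnj (N 0 p) * (c * S q 0) else 0)"
    by (intro sum.cong refl) (simp add: c)
  also have "\<dots> = c * (\<Sum>p<m. cnj (N 0 p) * S p 0)"
    by (simp add: sum_distrib_left algebra_simps)
  also have "\<dots> = c"
    using conjugate_equation[OF hdim_pos hdim_pos] by simp
  finally show ?thesis using c[OF assms] by simp
qed

lemma Qmat_entry:
  assumes "a < n" "b < n"
  shows "Qmat G x $$ (a, b) = (\<Sum>p<m. cnj (N b p) * N a p)"
proof -
  have t: "tvec G x \<in> carrier_mat (n * m) 1"
    using MorI_pair_triv(1)[OF tvec_Mor] .
  have j: "jmap G x (unit_col n b) \<in> carrier_mat m 1"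
    if "b < n" for b
    using t by (intro carrier_matI) (simp_all add: jmap_def unit_col_def)
  have e: "jmap G x (unit_col n b) $$ (p, 0) = N b p" if "b < n" "p < m" for b p
  proof -
    have k: "kron (mat_star (unit_col n b)) (1\<^sub>m m) $$ (p, c * m + q) * z =
        (if c = b then if p = q then z else 0 else 0)"
      if "c < n" "q < m" for c q z
      using kron_entry[of 0 "mat_star (unit_col n b)" p "1\<^sub>m m" c q] that \<open>p < m\<close>
      by (simp add: unit_col_def)
    have d: "dim_row (unit_col n b) = n" "dim_col (unit_col n b) = 1"
      by (simp_all add: unit_col_def)
    have "jmap G x (unit_col n b) $$ (p, 0) = (\<Sum>c<n. \<Sum>q<m. if c = b then if p = q then N c q else 0 else 0)"
      unfolding jmap_def using t that
      by (subst mult_mat_entry) (simp_all add: sum_lessThan_mult k d vec_coords_def cong: if_cong)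
    also have "\<dots> = (\<Sum>c<n. if c = b then \<Sum>q<m. if p = q then N c q else 0 else 0)"
      by (intro sum.cong refl) simp
    also have "\<dots> = N b p" using that by simp
    finally show ?thesis .
  qed
  show ?thesis
    using assms j[OF assms(1)] j[OF assms(2)] unfolding Qmat_def Let_def col_inner_def
    by (simp add: mult_mat_entry e del: index_mult_mat(1))
qed

lemma Qmat_carrier: "Qmat G x \<in> carrier_mat n n"
  by (simp add: Qmat_def Let_def)

lemma qdim_tvec: "qdim G x = (\<Sum>a<n. \<Sum>p<m. cnj (N a p) * N a p)"
  using Qmat_carrier by (simp add: qdim_def mat_trace_def Qmat_entry)

text \<open>The conjugate equations identify the inverse of Q with a matrix formed from s as Q is
  from t. Its trace is the squared norm of s, and the normalization Tr Q = Tr Q^{-1} makes this the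
  quantum dimension.\<close>

lemma qdim_svec: "qdim G x = (\<Sum>p<m. \<Sum>a<n. cnj (S p a) * S p a)"
proof -
  obtain R where R: "R \<in> carrier_mat n n" "inverts_mat R (Qmat G x)" "qdim G x = mat_trace R"
    using data by (auto simp: quantum_group_data_def contragredient_choice_def Let_def qdim_def)
  define R' where "R' = mat n n (\<lambda>(a, b). \<Sum>p<m. S p a * cnj (S p b))"
  have R': "R' \<in> carrier_mat n n" by (simp add: R'_def)
  have "Qmat G x * R' = 1\<^sub>m n"
  proof (rule eq_matI)
    fix a c assume "a < dim_row (1\<^sub>m n)" "c < dim_col (1\<^sub>m n)"
    then have ac: "a < n" "c < n" by auto
    have "(Qmat G x * R') $$ (a, c) =
        (\<Sum>b<n. (\<Sum>p<m. cnj (N b p) * N a p) * (\<Sum>r<m. S r b * cnj (S r c)))"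
      using ac Qmat_carrier by (subst mult_mat_entry) (auto simp: R'_def Qmat_entry intro!: sum.cong)
    also have "\<dots> = (\<Sum>b<n. \<Sum>p<m. \<Sum>r<m. N a p * (S r b * cnj (N b p)) * cnj (S r c))"
      by (simp only: sum_product) (simp add: mult_ac)
    also have "\<dots> = (\<Sum>p<m. \<Sum>r<m. \<Sum>b<n. N a p * (S r b * cnj (N b p)) * cnj (S r c))"
      by (subst sum.swap, rule sum.cong[OF refl], rule sum.swap)
    also have "\<dots> = (\<Sum>p<m. \<Sum>r<m. if r = p then N a p * cnj (S r c) else 0)"
      by (intro sum.cong refl)
        (simp add: sum_distrib_left[symmetric] sum_distrib_right[symmetric] conjugate_equation')
    also have "\<dots> = cnj (\<Sum>p<m. cnj (N a p) * S p c)" by simp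
    also have "\<dots> = (1\<^sub>m n) $$ (a, c)" using ac by (simp add: conjugate_equation)
    finally show "(Qmat G x * R') $$ (a, c) = (1\<^sub>m n) $$ (a, c)" .
  qed (use Qmat_carrier R' in auto)
  \<comment> \<open>R is a left inverse of Q and R' a right inverse, so they coincide.\<close>
  then have "R = R * (Qmat G x * R')" using R by simp
  also have "\<dots> = (R * Qmat G x) * R'" by (rule assoc_mult_mat[symmetric, OF R(1) Qmat_carrier R'])
  also have "\<dots> = R'" using R R' by (simp add: inverts_mat_def)
  finally have "qdim G x = (\<Sum>a<n. \<Sum>p<m. cnj (S p a) * S p a)"
    by (simp add: R(3) mat_trace_def R'_def mult.commute)
  then show ?thesis by (simp only: sum.swap[of _ "{..<m}"])
qed

lemma qdim_nonneg: "qdim G x = complex_of_real (Re (qdim G x))" "0 < Re (qdim G x)"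
proof -
  define r where "r = (\<Sum>a<n. \<Sum>p<m. (cmod (N a p))\<^sup>2)"
  have q: "qdim G x = complex_of_real r"
    unfolding qdim_tvec r_def of_real_sum
    by (intro sum.cong refl) (metis complex_norm_square mult.commute)
  then show "qdim G x = complex_of_real (Re (qdim G x))" by simp
  have "\<not> (\<forall>p<m. N 0 p = 0)"
  proof
    assume "\<forall>p<m. N 0 p = 0"
    then have "(\<Sum>p<m. cnj (N 0 p) * S p 0) = 0" by simp
    then show False using conjugate_equation[OF hdim_pos hdim_pos] by simp
  qed
  then obtain p where p: "p < m" "N 0 p \<noteq> 0" by auto
  then have "0 < (\<Sum>p<m. (cmod (N 0 p))\<^sup>2)"
    by (intro sum_pos2[of _ p]) auto
  then have "0 < r" unfolding r_def
    by - (rule sum_pos2[of "{..<n}" 0], simp_all only: finite_lessThan lessThan_iff hdim_pos sum_nonneg zero_le_power2)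
  then show "0 < Re (qdim G x)" by (simp add: q)
qed

text \<open>Contracting T with t gives an intertwiner between y and the contragredient of x.
  Contracting this with s returns the nonzero entry of T, so the intertwiner is nonzero and Schur's
  lemma applies.\<close>

lemma contra_unique:
  assumes T: "T \<in> MorI G [y, x] [triv G]" and nz: "i < hdim G y" "j < n" "vec_coords n T i j \<noteq> 0"
  shows "y = contra G x"
proof -
  let ?y = "\<lambda>a r. \<Sum>k<n. vec_coords n T a k * cnj (N k r)"
  let ?Y = "mat (hdim G y) m (\<lambda>(a, r). ?y a r)"
  have Y: "?Y \<in> Mor (irr G y) (irr G (contra G x))"
    by (rule MorI_contract[OF T tvec_Mor])
  have "(\<Sum>r<m. ?y i r * S r j) = (\<Sum>k<n. vec_coords n T i k * (\<Sum>r<m. cnj (N k r) * S r j))"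
    by (simp add: sum_distrib_left sum_distrib_right mult.assoc) (rule sum.swap)
  also have "\<dots> = (\<Sum>k<n. if k = j then vec_coords n T i k else 0)"
    using nz by (intro sum.cong refl) (simp add: conjugate_equation)
  also have "\<dots> \<noteq> 0" using nz by simp
  finally have *: "(\<Sum>r<m. ?y i r * S r j) \<noteq> 0" .
  have "\<not> (\<forall>r<m. ?y i r = 0)"
  proof
    assume "\<forall>r<m. ?y i r = 0"
    then have "(\<Sum>r<m. ?y i r * S r j) = 0" by (intro sum.neutral) simp
    with * show False ..
  qed
  then obtain r where r: "r < m" "?y i r \<noteq> 0" by blast
  have "equivalent_reps (irr G y) (irr G (contra G x))"
    using r nz by (intro Mor_irreducible_nonzero[OF irr_irreducible irr_irreducible Y, of i r]) auto
  then show ?thesis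
    using data by (simp add: quantum_group_data_def irreducible_representatives_def)
qed

text \<open>The contraction of T with t is a scalar by Schur's lemma, and the conjugate equation
  recovers T as this multiple of s.\<close>

lemma svec_span:
  assumes T: "T \<in> MorI G [contra G x, x] [triv G]"
  obtains c where "\<And>p k. p < m \<Longrightarrow> k < n \<Longrightarrow> vec_coords n T p k = c * S p k"
proof -
  let ?y = "\<lambda>a r. \<Sum>k<n. vec_coords n T a k * cnj (N k r)"
  obtain c where "\<And>p q. p < m \<Longrightarrow> q < m \<Longrightarrow> mat m m (\<lambda>(a, r). ?y a r) $$ (p, q) = (if p = q then c else 0)"
    using Mor_irr_scalar[OF MorI_contract[OF T tvec_Mor]] by blast
  then have c: "?y p q = (if p = q then c else 0)" if "p < m" "q < m" for p q
    using that by simp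
  have "vec_coords n T p j = c * S p j" if "p < m" "j < n" for p j
  proof -
    have "vec_coords n T p j = (\<Sum>k<n. if k = j then vec_coords n T p k else 0)" using that by simp
    also have "\<dots> = (\<Sum>k<n. vec_coords n T p k * (\<Sum>r<m. cnj (N k r) * S r j))"
      using that by (intro sum.cong refl) (simp add: conjugate_equation)
    also have "\<dots> = (\<Sum>r<m. ?y p r * S r j)"
      by (simp add: sum_distrib_left sum_distrib_right mult.assoc) (rule sum.swap)
    also have "\<dots> = (\<Sum>r<m. if r = p then c * S r j else 0)"
      using that by (intro sum.cong refl) (simp add: c)
    also have "\<dots> = c * S p j" using that by simp
    finally show ?thesis .
  qed
  then show ?thesis using that by blast
qed

text \<open>As for s, except that T enters conjugated, so the scalar is conjugated at the
  end.\<close>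

lemma tvec_span:
  assumes T: "T \<in> MorI G [x, contra G x] [triv G]"
  obtains c where "\<And>k p. k < n \<Longrightarrow> p < m \<Longrightarrow> vec_coords m T k p = c * N k p"
proof -
  let ?y = "\<lambda>a r. \<Sum>k<n. S a k * cnj (vec_coords m T k r)"
  obtain c where "\<And>p q. p < m \<Longrightarrow> q < m \<Longrightarrow> mat m m (\<lambda>(a, r). ?y a r) $$ (p, q) = (if p = q then c else 0)"
    using Mor_irr_scalar[OF MorI_contract[OF svec_Mor T]] by blast
  then have c: "?y p q = (if p = q then c else 0)" if "p < m" "q < m" for p q
    using that by simp
  have "cnj (vec_coords m T j p) = c * cnj (N j p)" if "p < m" "j < n" for p j
  proof -
    have "cnj (vec_coords m T j p) = (\<Sum>k<n. if j = k then cnj (vec_coords m T k p) else 0)"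
      using that by simp
    also have "\<dots> = (\<Sum>k<n. (\<Sum>r<m. cnj (N j r) * S r k) * cnj (vec_coords m T k p))"
      using that by (intro sum.cong refl) (simp add: conjugate_equation)
    also have "\<dots> = (\<Sum>r<m. cnj (N j r) * ?y r p)"
      by (simp add: sum_distrib_left sum_distrib_right mult.assoc) (rule sum.swap)
    also have "\<dots> = (\<Sum>r<m. if r = p then cnj (N j r) * c else 0)"
      using that by (intro sum.cong refl) (simp add: c)
    also have "\<dots> = c * cnj (N j p)" using that by simp
    finally show ?thesis .
  qed
  note * = this
  have "vec_coords m T j p = cnj c * N j p" if "j < n" "p < m" for j p
    using arg_cong[OF *[OF that(2,1)], of cnj] by simp
  then show ?thesis using that by blast
qed

end

end


section \<open>Actions and spectral subspaces\<close>

lemma inner_l_eq: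
  assumes "v \<in> carrier_mat 1 n" "w \<in> carrier_mat 1 n"
  shows "inner_l v w = (\<Sum>k<n. v $$ (0, k) * star (w $$ (0, k)))"
  using assms unfolding inner_l_def by (subst mult_mat_entry) auto

lemma row_mat_eqI:
  assumes "v \<in> carrier_mat 1 n" "w \<in> carrier_mat 1 n" "\<And>j. j < n \<Longrightarrow> v $$ (0, j) = w $$ (0, j)"
  shows "v = w"
  using assms by (intro eq_matI) auto

lemma spec_inner_eqI:
  "inner_l w v = c *\<^sub>C 1 \<Longrightarrow> spec_inner v w = c"
  unfolding spec_inner_def by (rule the_equality) (auto simp del: cvec.scale_right_imp_eq)

lemma spectral_subspace_iff:
  "v \<in> spectral_subspace G A \<iota> \<alpha> x \<longleftrightarrow> v \<in> carrier_mat 1 (hdim G x) \<and>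
    (\<forall>j<hdim G x. v $$ (0, j) \<in> A) \<and> map_mat \<alpha> v = legs \<iota> v (irr G x)"
  unfolding spectral_subspace_def mat_coeffs_def by (auto; blast)

definition row_lincomb :: "nat \<Rightarrow> 'a::complex_vector mat set \<Rightarrow> ('a mat \<Rightarrow> complex) \<Rightarrow> 'a mat" where
  "row_lincomb n B c = mat 1 n (\<lambda>(i, j). \<Sum>e\<in>B. c e *\<^sub>C e $$ (0, j))"

lemma row_lincomb_carrier [simp]: "row_lincomb n B c \<in> carrier_mat 1 n"
  by (simp add: row_lincomb_def)

lemma row_lincomb_entry [simp]:
  "j < n \<Longrightarrow> row_lincomb n B c $$ (0, j) = (\<Sum>e\<in>B. c e *\<^sub>C e $$ (0, j))"
  by (simp add: row_lincomb_def)

lemma Rmap_carrier: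
  assumes "\<tau> x \<in> carrier_mat (hdim G (contra G x) * hdim G x) 1" "v \<in> carrier_mat 1 (hdim G x)"
  shows "Rmap G \<tau> x v \<in> carrier_mat 1 (hdim G (contra G x))"
  using assms by (intro carrier_matI) (auto simp: Rmap_def)

lemma Rmap_entry:
  assumes t: "\<tau> x \<in> carrier_mat (hdim G (contra G x) * hdim G x) 1"
    and v: "v \<in> carrier_mat 1 (hdim G x)" and i: "i < hdim G (contra G x)"
  shows "Rmap G \<tau> x v $$ (0, i) =
    (\<Sum>k<hdim G x. cnj (vec_coords (hdim G x) (\<tau> x) i k) *\<^sub>C star (v $$ (0, k)))"
proof -
  let ?n = "hdim G x" and ?m = "hdim G (contra G x)"
  have k: "kron (1\<^sub>m ?m) (mat_star v) $$ (a * ?n + k, i) = (if a = i then star (v $$ (0, k)) else 0)"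
    if "a < ?m" "k < ?n" for a k
    using kron_entry[of a "1\<^sub>m ?m" k "mat_star v" i 0] that v i by simp
  have "Rmap G \<tau> x v $$ (0, i) =
      (\<Sum>a<?m. \<Sum>k<?n. if a = i then cnj (vec_coords ?n (\<tau> x) a k) *\<^sub>C star (v $$ (0, k)) else 0)"
    unfolding Rmap_def using t v i
    by (subst mult_mat_entry)
      (auto simp: sum_lessThan_mult k index_pair_less vec_coords_def mult_scaleC_left intro!: sum.cong)
  also have "\<dots> = (\<Sum>a<?m. if a = i then \<Sum>k<?n. cnj (vec_coords ?n (\<tau> x) a k) *\<^sub>C star (v $$ (0, k)) else 0)"
    by (rule sum.cong[OF refl]) simp
  finally show ?thesis using i by simp
qed

text \<open>Covers both the C*-algebraic action and the action on D \<otimes> B, with \<iota> the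
  minimal and the algebraic tensor product respectively. Injectivity of the lifted \<iota> allows
  \<open>cond_exp\<close> to be computed from any algebraic preimage.\<close>

locale qaction = qgroup G
  for G :: "('g::cstar_algebra, 'gg::cstar_algebra, 'ggg::cstar_algebra, 'x) cqg" +
  fixes \<iota> :: "'d::star_algebra \<Rightarrow> 'g \<Rightarrow> 'e::star_algebra" and \<alpha> :: "'d \<Rightarrow> 'e"
  assumes iota_bilinear: "cbilinear \<iota>"
    and iota_one: "\<iota> 1 1 = 1"
    and iota_mult: "\<iota> a c * \<iota> a' c' = \<iota> (a * a') (c * c')"
    and iota_star: "star (\<iota> a c) = \<iota> (star a) (star c)"
    and iota_inj: "inj (tensor_lift \<iota>)"
    and hom: "unital_star_hom \<alpha>"
begin

abbreviation spectral :: "'x \<Rightarrow> 'd mat set" where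
  "spectral x \<equiv> spectral_subspace G UNIV \<iota> \<alpha> x"

lemmas iota_add = cbilinear_add[OF iota_bilinear]
lemmas iota_scale = cbilinear_scale[OF iota_bilinear]
lemmas iota_sum = cbilinear_sum[OF iota_bilinear]
lemmas act = unital_star_homD[OF hom]
lemmas act_add = clinear_add[OF act(1)]
lemmas act_scale = clinear_scale[OF act(1)]
lemmas act_sum = clinear_sum[OF act(1)]

lemma clinear_lift_iota: "clinear (tensor_lift \<iota>)"
  by (rule clinear_tensor_lift[OF iota_bilinear])

lemma lift_iota_tensor [simp]: "tensor_lift \<iota> (a \<otimes>\<^sub>a c) = \<iota> a c"
  by (rule tensor_lift_alg_tensor[OF iota_bilinear])

lemma unital_star_hom_lift_iota: "unital_star_hom (tensor_lift \<iota>)"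
  by (rule unital_star_hom_tensorI[OF clinear_lift_iota]) (simp_all add: iota_one iota_mult iota_star)

lemma spectralD:
  assumes "v \<in> spectral x"
  shows "v \<in> carrier_mat 1 (hdim G x)"
    and "j < hdim G x \<Longrightarrow> \<alpha> (v $$ (0, j)) = (\<Sum>k<hdim G x. \<iota> (v $$ (0, k)) (irr G x $$ (k, j)))"
proof -
  show c: "v \<in> carrier_mat 1 (hdim G x)" using assms by (simp add: spectral_subspace_iff)
  assume "j < hdim G x"
  moreover have "map_mat \<alpha> v $$ (0, j) = legs \<iota> v (irr G x) $$ (0, j)"
    using assms by (simp add: spectral_subspace_iff)
  ultimately show "\<alpha> (v $$ (0, j)) = (\<Sum>k<hdim G x. \<iota> (v $$ (0, k)) (irr G x $$ (k, j)))"
    using c by simp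
qed

lemma spectralI:
  assumes "v \<in> carrier_mat 1 (hdim G x)"
    and "\<And>j. j < hdim G x \<Longrightarrow> v $$ (0, j) \<in> A"
    and "\<And>j. j < hdim G x \<Longrightarrow> \<alpha> (v $$ (0, j)) = (\<Sum>k<hdim G x. \<iota> (v $$ (0, k)) (irr G x $$ (k, j)))"
  shows "v \<in> spectral_subspace G A \<iota> \<alpha> x"
  unfolding spectral_subspace_iff using assms by (auto intro!: eq_matI)

lemma cond_exp_eq:
  assumes "\<alpha> a = tensor_lift \<iota> t"
  shows "cond_exp G \<iota> \<alpha> a = tensor_lift (\<lambda>a c. haar G c *\<^sub>C a) t"
  unfolding cond_exp_def assms by (simp add: inv_into_f_f[OF iota_inj])

text \<open>By the orthogonality relations, E of the entry (i, j) of v^* w vanishes for i \<noteq> j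
  and is independent of i on the diagonal, so the description in \<open>inner_r\<close> has a
  solution. It is unique because the representation space is nonzero.\<close>

lemma inner_r_eq:
  assumes v: "v \<in> spectral x" and w: "w \<in> spectral x"
  shows "inner_r (cond_exp G \<iota> \<alpha>) v w =
    (\<Sum>p<hdim G x. \<Sum>q<hdim G x. haar_form x p q *\<^sub>C (star (v $$ (0, p)) * w $$ (0, q)))"
    (is "_ = ?d")
proof -
  let ?n = "hdim G x"
  note c = spectralD(1)[OF v] spectralD(1)[OF w]
  have E: "cond_exp G \<iota> \<alpha> (star (v $$ (0, i)) * w $$ (0, j)) = (if i = j then ?d else 0)"
    if "i < ?n" "j < ?n" for i j
  proof -
    have "\<alpha> (star (v $$ (0, i)) * w $$ (0, j)) = tensor_lift \<iota> (\<Sum>p<?n. \<Sum>q<?n.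
        (star (v $$ (0, p)) * w $$ (0, q)) \<otimes>\<^sub>a (star (irr G x $$ (p, i)) * irr G x $$ (q, j)))"
      using that
      by (simp add: act spectralD(2)[OF v] spectralD(2)[OF w] star_sum sum_product iota_star iota_mult
          clinear_sum[OF clinear_lift_iota])
    then have "cond_exp G \<iota> \<alpha> (star (v $$ (0, i)) * w $$ (0, j)) = (\<Sum>p<?n. \<Sum>q<?n.
        haar G (star (irr G x $$ (p, i)) * irr G x $$ (q, j)) *\<^sub>C (star (v $$ (0, p)) * w $$ (0, q)))"
      by (simp add: cond_exp_eq clinear_sum[OF clinear_tensor_slice(2)[OF haar_linear]]
          tensor_slice_tensor[OF haar_linear])
    also have "\<dots> = (\<Sum>p<?n. \<Sum>q<?n.
        (if i = j then haar_form x p q else 0) *\<^sub>C (star (v $$ (0, p)) * w $$ (0, q)))"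
      using that by (intro sum.cong refl) (simp add: haar_orthogonality)
    finally show ?thesis by simp
  qed
  have m: "map_mat (cond_exp G \<iota> \<alpha>) (mat_star v * w) = ?d \<cdot>\<^sub>m 1\<^sub>m (dim_col v)"
  proof (rule eq_matI)
    fix i j assume "i < dim_row (?d \<cdot>\<^sub>m 1\<^sub>m (dim_col v))" "j < dim_col (?d \<cdot>\<^sub>m 1\<^sub>m (dim_col v))"
    then have ij: "i < ?n" "j < ?n" using c by auto
    have "(mat_star v * w) $$ (i, j) = star (v $$ (0, i)) * w $$ (0, j)"
      using ij c by (subst mult_mat_entry) auto
    then show "map_mat (cond_exp G \<iota> \<alpha>) (mat_star v * w) $$ (i, j) = (?d \<cdot>\<^sub>m 1\<^sub>m (dim_col v)) $$ (i, j)"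
      using ij c E[OF ij] by (simp del: index_mult_mat(1))
  qed (use c in auto)
  show ?thesis
    unfolding inner_r_def m
  proof (rule the_equality)
    show "?d \<cdot>\<^sub>m 1\<^sub>m (dim_col v) = ?d \<cdot>\<^sub>m 1\<^sub>m (dim_col v)" by (rule refl)
    fix d assume "?d \<cdot>\<^sub>m 1\<^sub>m (dim_col v) = d \<cdot>\<^sub>m 1\<^sub>m (dim_col v)"
    then have "(?d \<cdot>\<^sub>m 1\<^sub>m (dim_col v)) $$ (0, 0) = (d \<cdot>\<^sub>m 1\<^sub>m (dim_col v)) $$ (0, 0)" by simp
    then show "d = ?d" using c hdim_pos[of x] by simp
  qed
qed

text \<open>The two coefficient matrices meet in u u^* = 1.\<close>

lemma inner_l_fixed:
  assumes v: "v \<in> spectral x" and w: "w \<in> spectral x"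
  shows "\<alpha> (inner_l v w) = \<iota> (inner_l v w) 1"
proof -
  let ?n = "hdim G x" and ?u = "\<lambda>i j. irr G x $$ (i, j)"
  note c = spectralD(1)[OF v] spectralD(1)[OF w]
  have "\<alpha> (inner_l v w) = (\<Sum>k<?n. \<Sum>p<?n. \<Sum>q<?n. \<iota> (v $$ (0, p) * star (w $$ (0, q))) (?u p k * star (?u q k)))"
    by (simp add: inner_l_eq[OF c] act_sum act(3,4) spectralD(2)[OF v] spectralD(2)[OF w] star_sum
        sum_product iota_star iota_mult)
  also have "\<dots> = (\<Sum>p<?n. \<Sum>q<?n. \<Sum>k<?n. \<iota> (v $$ (0, p) * star (w $$ (0, q))) (?u p k * star (?u q k)))"
    by (subst sum.swap, rule sum.cong[OF refl], rule sum.swap)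
  also have "\<dots> = (\<Sum>p<?n. \<Sum>q<?n. if p = q then \<iota> (v $$ (0, p) * star (w $$ (0, q))) 1 else 0)"
    by (intro sum.cong refl)
      (simp add: iota_sum(2)[symmetric] unitary_mat_rows[OF irr_unitary irr_carrier]
        cbilinear_zero[OF iota_bilinear])
  also have "\<dots> = \<iota> (inner_l v w) 1"
    by (simp add: inner_l_eq[OF c] iota_sum)
  finally show ?thesis .
qed

lemma spectral_lincomb:
  assumes "B \<subseteq> spectral x"
  shows "row_lincomb (hdim G x) B c \<in> spectral x"
proof (rule spectralI)
  fix j assume j: "j < hdim G x"
  have "\<alpha> (row_lincomb (hdim G x) B c $$ (0, j)) =
      (\<Sum>e\<in>B. c e *\<^sub>C (\<Sum>k<hdim G x. \<iota> (e $$ (0, k)) (irr G x $$ (k, j))))"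
    using j assms by (auto simp: act_sum act_scale spectralD(2) intro!: sum.cong)
  also have "\<dots> = (\<Sum>k<hdim G x. \<iota> (row_lincomb (hdim G x) B c $$ (0, k)) (irr G x $$ (k, j)))"
    by (simp add: iota_sum iota_scale cvec.scale_sum_right) (rule sum.swap)
  finally show "\<alpha> (row_lincomb (hdim G x) B c $$ (0, j)) =
      (\<Sum>k<hdim G x. \<iota> (row_lincomb (hdim G x) B c $$ (0, k)) (irr G x $$ (k, j)))" .
qed (rule row_lincomb_carrier, rule UNIV_I)

text \<open>Invariance of the vector \<open>\<tau> x\<close>, in the form of
  \<open>kron_maps_cross_star\<close>, turns adjoints of coefficients of x into coefficients of the
  contragredient.\<close>

lemma Rmap_spectral:
  assumes \<tau>: "\<tau> x \<in> MorI G [contra G x, x] [triv G]" and v: "v \<in> spectral x"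
  shows "Rmap G \<tau> x v \<in> spectral (contra G x)"
proof (rule spectralI)
  let ?n = "hdim G x" and ?m = "hdim G (contra G x)" and ?M = "vec_coords (hdim G x) (\<tau> x)"
  let ?u = "\<lambda>i j. irr G x $$ (i, j)" and ?u' = "\<lambda>i j. irr G (contra G x) $$ (i, j)"
  note t = MorI_pair_triv[OF \<tau>] and c = spectralD(1)[OF v]
  note R = Rmap_entry[where \<tau> = \<tau> and x = x, OF t(1) c]
  show "Rmap G \<tau> x v \<in> carrier_mat 1 ?m" by (rule Rmap_carrier[where \<tau> = \<tau> and x = x, OF t(1) c])
  fix i assume i: "i < ?m"
  have "\<alpha> (Rmap G \<tau> x v $$ (0, i)) =
      (\<Sum>k<?n. \<Sum>l<?n. cnj (?M i k) *\<^sub>C \<iota> (star (v $$ (0, l))) (star (?u l k)))"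
    using i by (simp add: R act_sum act_scale act(4) spectralD(2)[OF v] star_sum iota_star cvec.scale_sum_right)
  also have "\<dots> = (\<Sum>l<?n. \<iota> (star (v $$ (0, l))) (\<Sum>k<?n. cnj (?M i k) *\<^sub>C star (?u l k)))"
    by (subst sum.swap) (simp add: iota_sum iota_scale)
  also have "\<dots> = (\<Sum>l<?n. \<iota> (star (v $$ (0, l))) (\<Sum>a<?m. cnj (?M a l) *\<^sub>C ?u' a i))"
    using i by (intro sum.cong refl)
      (simp add: kron_maps_cross_star[OF t(2) irr_unitary irr_carrier irr_carrier])
  also have "\<dots> = (\<Sum>a<?m. \<iota> (Rmap G \<tau> x v $$ (0, a)) (?u' a i))"
    by (simp add: R iota_sum iota_scale) (rule sum.swap)
  finally show "\<alpha> (Rmap G \<tau> x v $$ (0, i)) = (\<Sum>a<?m. \<iota> (Rmap G \<tau> x v $$ (0, a)) (?u' a i))" .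
qed simp

lemma one_in_spectral_subalgebra: "1 \<in> spectral_subalgebra G \<iota> \<alpha>"
proof -
  have v: "1\<^sub>m 1 \<in> spectral (triv G)"
    by (rule spectralI) (simp_all add: irr_triv act(2) iota_one)
  have "1 = (1\<^sub>m 1 * amp (1\<^sub>m 1)) $$ (0, 0 :: nat)" by simp
  then show ?thesis
    unfolding spectral_subalgebra_def using v
    by (intro cvec.span_base CollectI exI[of _ "1\<^sub>m 1"] exI[of _ "triv G"]) simp
qed

lemma spectral_entry_in_subalgebra:
  assumes v: "v \<in> spectral x" and j: "j < hdim G x"
  shows "v $$ (0, j) \<in> spectral_subalgebra G \<iota> \<alpha>"
proof -
  let ?e = "unit_col (hdim G x) j"
  have e: "?e \<in> carrier_mat (hdim G x) 1" by (simp add: unit_col_def)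
  have "(v * amp ?e) $$ (0, 0) = (\<Sum>k<hdim G x. v $$ (0, k) * (?e $$ (k, 0) *\<^sub>C 1))"
    using spectralD(1)[OF v] e by (subst mult_mat_entry) auto
  also have "\<dots> = (\<Sum>k<hdim G x. if k = j then v $$ (0, k) else 0)"
    by (intro sum.cong refl) (simp add: unit_col_def scaleC_one)
  finally have "v $$ (0, j) = (v * amp ?e) $$ (0, 0)" using j by simp
  then show ?thesis
    unfolding spectral_subalgebra_def using v e by (intro cvec.span_base) blast
qed

section \<open>Ergodic actions: scalar products and adjoints\<close>

context
  assumes erg: "ergodic UNIV \<iota> \<alpha>"
begin

lemma inner_l_scalar:
  assumes "v \<in> spectral x" "w \<in> spectral x"
  shows "inner_l w v = spec_inner v w *\<^sub>C 1"
proof -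
  have "inner_l w v \<in> fixed_points UNIV \<iota> \<alpha>"
    using inner_l_fixed[OF assms(2,1)] by (simp add: fixed_points_def)
  then obtain c where "inner_l w v = c *\<^sub>C 1" using erg by (auto simp: ergodic_def)
  then show ?thesis using spec_inner_eqI by metis
qed

lemma spec_inner_commute:
  assumes "v \<in> spectral x" "w \<in> spectral x"
  shows "cnj (spec_inner v w) = spec_inner w v"
proof -
  have "star (inner_l w v) = inner_l v w"
    using spectralD(1)[OF assms(1)] spectralD(1)[OF assms(2)]
    by (simp add: inner_l_eq star_sum star_mult star_star)
  then have "inner_l v w = cnj (spec_inner v w) *\<^sub>C 1"
    using inner_l_scalar[OF assms] by (simp add: star_scaleC)
  then show ?thesis using spec_inner_eqI by metis
qed

lemma spec_inner_sum:
  assumes "v \<in> spectral x" "w \<in> spectral x"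
    and w: "\<And>i. i < hdim G x \<Longrightarrow> w $$ (0, i) = (\<Sum>e\<in>B. c e *\<^sub>C f e $$ (0, i))"
    and f: "\<And>e. e \<in> B \<Longrightarrow> f e \<in> spectral x"
  shows "spec_inner v w = (\<Sum>e\<in>B. c e * spec_inner v (f e))"
proof (rule spec_inner_eqI)
  note c = spectralD(1)
  have "inner_l w v = (\<Sum>i<hdim G x. \<Sum>e\<in>B. c e *\<^sub>C (f e $$ (0, i) * star (v $$ (0, i))))"
    by (simp add: inner_l_eq[OF c[OF assms(2)] c[OF assms(1)]] w sum_distrib_right mult_scaleC_left)
  also have "\<dots> = (\<Sum>e\<in>B. c e *\<^sub>C inner_l (f e) v)"
    by (subst sum.swap) (simp add: inner_l_eq[OF c[OF f] c[OF assms(1)]] cvec.scale_sum_right)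
  also have "\<dots> = (\<Sum>e\<in>B. (c e * spec_inner v (f e)) *\<^sub>C 1)"
    by (intro sum.cong refl) (simp add: inner_l_scalar[OF assms(1) f])
  finally show "inner_l w v = (\<Sum>e\<in>B. c e * spec_inner v (f e)) *\<^sub>C 1"
    by (simp add: cvec.scale_sum_left)
qed

text \<open>The functional \<open>w \<mapsto> \<langle>u, R w\<rangle>\<close> is conjugate-linear, so an orthonormal basis yields its
  representing vector.\<close>

lemma antilinear_adjoint_unique:
  assumes \<tau>: "\<tau> x \<in> MorI G [contra G x, x] [triv G]" and B: "spec_onb (spectral x) B"
    and u: "u \<in> spectral (contra G x)"
  shows "\<exists>!v. v \<in> spectral x \<and> (\<forall>w\<in>spectral x. spec_inner w v = spec_inner u (Rmap G \<tau> x w))"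
proof (rule ex_ex1I)
  let ?R = "Rmap G \<tau> x" and ?n = "hdim G x"
  note t = MorI_pair_triv[OF \<tau>]
  have BK: "B \<subseteq> spectral x" using B by (simp add: spec_onb_def)
  have exp: "v $$ (0, i) = (\<Sum>e\<in>B. spec_inner e v *\<^sub>C e $$ (0, i))"
    if "v \<in> spectral x" "i < ?n" for v i
    using B that carrier_matD(2)[OF spectralD(1)[OF that(1)]] by (simp add: spec_onb_def)
  have RK: "?R w \<in> spectral (contra G x)" if "w \<in> spectral x" for w
    by (rule Rmap_spectral[where \<tau> = \<tau> and x = x, OF \<tau> that])
  \<comment> \<open>An adjoint vector v must satisfy <e, v> = <u, R e>, and these are its
    coefficients in the basis B.\<close>
  let ?v = "row_lincomb ?n B (\<lambda>e. spec_inner u (?R e))"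
  have v: "?v \<in> spectral x" by (rule spectral_lincomb[OF BK])
  have "spec_inner w ?v = spec_inner u (?R w)" if w: "w \<in> spectral x" for w
  proof -
    have "?R w $$ (0, i) = (\<Sum>e\<in>B. cnj (spec_inner e w) *\<^sub>C ?R e $$ (0, i))"
      if i: "i < hdim G (contra G x)" for i
    proof -
      have "?R w $$ (0, i) = (\<Sum>k<?n. \<Sum>e\<in>B. (cnj (vec_coords ?n (\<tau> x) i k) * cnj (spec_inner e w)) *\<^sub>C star (e $$ (0, k)))"
        by (simp add: Rmap_entry[where \<tau> = \<tau> and x = x, OF t(1) spectralD(1)[OF w] i] exp[OF w] star_sum star_scaleC cvec.scale_sum_right)
      also have "\<dots> = (\<Sum>e\<in>B. cnj (spec_inner e w) *\<^sub>C ?R e $$ (0, i))"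
        using BK by (subst sum.swap)
          (auto simp: Rmap_entry[where \<tau> = \<tau> and x = x, OF t(1) spectralD(1) i] cvec.scale_sum_right mult.commute intro!: sum.cong)
      finally show ?thesis .
    qed
    then have "spec_inner u (?R w) = (\<Sum>e\<in>B. cnj (spec_inner e w) * spec_inner u (?R e))"
      using BK by (intro spec_inner_sum[OF u RK[OF w]] RK) auto
    also have "\<dots> = (\<Sum>e\<in>B. spec_inner u (?R e) * spec_inner w e)"
      using BK w by (auto simp: spec_inner_commute mult.commute intro!: sum.cong)
    also have "\<dots> = spec_inner w ?v"
      using BK by (intro spec_inner_sum[OF w v, symmetric]) auto
    finally show ?thesis ..
  qed
  then show "\<exists>v. v \<in> spectral x \<and> (\<forall>w\<in>spectral x. spec_inner w v = spec_inner u (?R w))"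
    using v by blast
  fix a b
  assume a: "a \<in> spectral x \<and> (\<forall>w\<in>spectral x. spec_inner w a = spec_inner u (?R w))"
    and b: "b \<in> spectral x \<and> (\<forall>w\<in>spectral x. spec_inner w b = spec_inner u (?R w))"
  show "a = b"
  proof (rule row_mat_eqI)
    fix i assume i: "i < ?n"
    show "a $$ (0, i) = b $$ (0, i)"
      using a b BK i by (auto simp: exp[of a] exp[of b] intro!: sum.cong)
  qed (use a b spectralD(1) in blast)+
qed

end

end


section \<open>The action obtained from the link algebra\<close>

lemma tensor_lift_alg_tensor_id: "tensor_lift (\<otimes>\<^sub>a) = id"
  by (rule tensor_lift_unique)
    (simp_all add: clinear_tensor_lift tensor_lift_alg_tensor cbilinear_alg_tensor)

text \<open>The inverse of T is its adjoint: write the second argument as T of its preimage.\<close>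

lemma hilbert_module_unitaryI:
  assumes T: "bij_betw T K K'"
    and ip: "\<And>v w. v \<in> K \<Longrightarrow> w \<in> K \<Longrightarrow> ip' (T v) (T w) = \<theta> (ip v w)"
  shows "hilbert_module_unitary \<theta> K ip K' ip' T"
  unfolding hilbert_module_unitary_def
proof (intro conjI exI[of _ "inv_into K T"] ballI)
  note T' = bij_betw_imp_surj_on[OF T] bij_betw_inv_into_right[OF T] bij_betw_inv_into_left[OF T]
  show "T ` K \<subseteq> K'" "inv_into K T ` K' \<subseteq> K"
    using T'(1) bij_betw_imp_surj_on[OF bij_betw_inv_into[OF T]] by auto
  show "inv_into K T (T v) = v" if "v \<in> K" for v using T'(3) that .
  show "T (inv_into K T w) = w" if "w \<in> K'" for w using T'(2) that .
  show "ip' (T v) w = \<theta> (ip v (inv_into K T w))" if "v \<in> K" "w \<in> K'" for v w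
    using ip[OF that(1), of "inv_into K T w"] T'(2)[OF that(2)] T'(1) that(2)
    by (simp add: inv_into_into)
qed

locale box_product =
  fixes G1 :: "('g1::cstar_algebra, 'gg1::cstar_algebra, 'ggg1::cstar_algebra, 'x1) cqg"
    and G2 :: "('g2::cstar_algebra, 'gg2::cstar_algebra, 'ggg2::cstar_algebra, 'x2) cqg"
    and \<phi> :: "'x2 \<Rightarrow> 'x1"
    and \<Phi> :: "'x2 list \<Rightarrow> 'x2 list \<Rightarrow> complex mat \<Rightarrow> complex mat"
    and L :: "('x2, 'g1, 'g2, 'b::star_algebra) link"
    and \<iota> :: "'d::cstar_algebra \<Rightarrow> 'g1 \<Rightarrow> 'dg::cstar_algebra"
    and \<alpha> :: "'d \<Rightarrow> 'dg"
  assumes G1: "quantum_group_data G1" and G2: "quantum_group_data G2"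
    and equivalence: "monoidal_equivalence G2 G1 \<phi> \<Phi>"
    and link: "link_algebra G2 G1 \<phi> \<Phi> L" and link_actions: "link_actions G2 G1 \<phi> L"
    and tensor: "cstar_tensor \<iota>" and hom: "unital_star_hom \<alpha>"
begin

abbreviation "\<delta>1 \<equiv> link_act1 L"
abbreviation "\<delta>2 \<equiv> link_act2 L"
abbreviation "\<omega> \<equiv> link_state L"
abbreviation "n1 x \<equiv> hdim G1 (\<phi> x)"
abbreviation "n2 \<equiv> hdim G2"
abbreviation "X x i j \<equiv> link_X L x $$ (i, j)"
abbreviation "U x i j \<equiv> irr G1 (\<phi> x) $$ (i, j)"
abbreviation "u x i j \<equiv> irr G2 x $$ (i, j)"
abbreviation "\<beta> \<equiv> box_action \<delta>2 :: ('d, 'b) tensor \<Rightarrow> (('d, 'b) tensor, 'g2) tensor"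

lemma delta_hom: "unital_star_hom \<delta>1" "unital_star_hom \<delta>2"
  using link_actions by (simp_all add: link_actions_def hopf_left_action_def hopf_right_action_def)

lemmas delta1 = unital_star_homD[OF delta_hom(1)]
lemmas delta2 = unital_star_homD[OF delta_hom(2)]

lemma box_action_hom: "unital_star_hom \<beta>"
  using unital_star_hom_compose[OF unital_star_hom_assoc_left
      unital_star_hom_tensor_map[OF unital_star_hom_id delta_hom(2)]]
  by (simp add: box_action_def[abs_def])

sublocale D1: qaction G1 \<iota> \<alpha>
  by unfold_locales (use G1 hom cstar_tensorD[OF tensor] in auto)

text \<open>Here \<beta> is considered on all of D \<otimes> B. The subalgebra \<open>A2\<close>
  enters through the entries of the vectors in \<open>K2\<close>, which are in particular spectral
  vectors in this larger sense.\<close>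

sublocale D2: qaction G2 "(\<otimes>\<^sub>a) :: ('d, 'b) tensor \<Rightarrow> 'g2 \<Rightarrow> _" \<beta>
  by unfold_locales
    (use G2 box_action_hom in \<open>auto simp: cbilinear_alg_tensor one_tensor_def tensor_lift_alg_tensor_id\<close>)

lemma X_carrier: "link_X L x \<in> carrier_mat (n1 x) (n2 x)" and X_unitary: "unitary_mat (link_X L x)"
  using link by (simp_all add: link_algebra_def)

lemma X_dim [simp]: "dim_row (link_X L x) = n1 x" "dim_col (link_X L x) = n2 x"
  using X_carrier[of x] by auto

lemmas X_columns = unitary_mat_columns[OF X_unitary X_carrier]
lemmas X_rows = unitary_mat_rows[OF X_unitary X_carrier]

lemma delta1_X:
  assumes "i < n1 x" "j < n2 x"
  shows "\<delta>1 (X x i j) = (\<Sum>k<n1 x. U x i k \<otimes>\<^sub>a X x k j)"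
proof -
  have "map_mat \<delta>1 (link_X L x) = legs (\<otimes>\<^sub>a) (irr G1 (\<phi> x)) (link_X L x)"
    using link_actions by (simp add: link_actions_def)
  from arg_cong[OF this, of "\<lambda>M. M $$ (i, j)"] show ?thesis using assms by simp
qed

lemma delta2_X:
  assumes "i < n1 x" "j < n2 x"
  shows "\<delta>2 (X x i j) = (\<Sum>k<n2 x. X x i k \<otimes>\<^sub>a u x k j)"
proof -
  have "map_mat \<delta>2 (link_X L x) = legs (\<otimes>\<^sub>a) (link_X L x) (irr G2 x)"
    using link_actions by (simp add: link_actions_def)
  from arg_cong[OF this, of "\<lambda>M. M $$ (i, j)"] show ?thesis using assms by simp
qed

lemma omega: "clinear \<omega>" "\<omega> 1 = 1"
  using link by (simp_all add: link_algebra_def state_def)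

lemma omega_invariant: "tensor_lift (\<lambda>c b. \<omega> b *\<^sub>C c) (\<delta>1 b) = \<omega> b *\<^sub>C 1"
  using link_actions by (simp add: link_actions_def)

lemma delta2_ergodic:
  assumes "\<delta>2 b = b \<otimes>\<^sub>a 1" shows "b = \<omega> b *\<^sub>C 1"
proof -
  have "{b. \<delta>2 b = b \<otimes>\<^sub>a 1} = range (\<lambda>c. c *\<^sub>C 1)"
    using link_actions by (simp add: link_actions_def)
  then obtain c where c: "b = c *\<^sub>C 1" using assms by blast
  then show ?thesis using omega by (simp add: clinear_scale[OF omega(1)])
qed

lemma box_action_tensor: "\<beta> (a \<otimes>\<^sub>a b) = assoc_left (a \<otimes>\<^sub>a \<delta>2 b)"
  using delta2(1) by (simp add: box_action_def)

lemma box_action_X: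
  assumes "i < n1 x" "j < n2 x"
  shows "\<beta> (a \<otimes>\<^sub>a X x i j) = (\<Sum>k<n2 x. (a \<otimes>\<^sub>a X x i k) \<otimes>\<^sub>a u x k j)"
  using assms by (simp add: box_action_tensor delta2_X tensor_sum clinear_sum[OF clinear_assoc_left])

text \<open>Slicing the first leg by f turns \<beta> into \<delta>2, so ergodicity makes the slice
  of t a scalar, and \<omega> identifies it with the slice of s t \<otimes> 1. Hence all slices of
  the difference vanish.\<close>

lemma box_action_fixed:
  assumes t: "\<beta> t = t \<otimes>\<^sub>a 1"
  shows "t = tensor_lift (\<lambda>a b. \<omega> b *\<^sub>C a) t \<otimes>\<^sub>a 1"
proof -
  define s where "s = tensor_lift (\<lambda>(a::'d) b. \<omega> b *\<^sub>C a)"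
  have s: "clinear s" "\<And>a b. s (a \<otimes>\<^sub>a b) = \<omega> b *\<^sub>C a"
    unfolding s_def using clinear_tensor_slice[OF omega(1)] by auto
  have "t - s t \<otimes>\<^sub>a 1 = 0"
  proof (rule tensor_eq_zero_if_slices_zero)
    fix f :: "'d \<Rightarrow> complex" assume f: "clinear f"
    define r where "r = tensor_lift (\<lambda>a (b::'b). f a *\<^sub>C b)"
    have r: "clinear r" "\<And>a b. r (a \<otimes>\<^sub>a b) = f a *\<^sub>C b"
      unfolding r_def using clinear_tensor_slice'[OF f] by auto
    have r': "tensor_map r (\<lambda>y. y) (assoc_left (a \<otimes>\<^sub>a y)) = f a *\<^sub>C y" for a and y :: "('b, 'g2) tensor"
      by (induction y rule: tensor_induct)
        (simp_all add: clinear_zero[OF clinear_assoc_left] clinear_add[OF clinear_assoc_left] tensor_add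
          clinear_zero[OF clinear_tensor_map] clinear_add[OF clinear_tensor_map] r tensor_scale
          scaleC_add_right)
    have "\<delta>2 (r t) = tensor_map r id (\<beta> t)" for t
      by (induction t rule: tensor_induct)
        (simp_all add: clinear_zero[OF r(1)] clinear_zero[OF delta2(1)] clinear_zero[OF D2.act(1)]
          clinear_zero[OF clinear_tensor_map] r clinear_add[OF r(1)] clinear_add[OF delta2(1)]
          D2.act_add clinear_add[OF clinear_tensor_map] clinear_scale[OF delta2(1)] box_action_tensor r')
    then have "\<delta>2 (r t) = r t \<otimes>\<^sub>a 1" using t by (simp add: r(1))
    then have "r t = \<omega> (r t) *\<^sub>C 1" by (rule delta2_ergodic)
    moreover have "\<omega> (r t) = f (s t)" for t
      by (induction t rule: tensor_induct)
        (simp_all add: clinear_zero[OF r(1)] clinear_zero[OF omega(1)] clinear_zero[OF s(1)]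
          clinear_zero[OF f] clinear_add[OF r(1)] clinear_add[OF omega(1)] clinear_add[OF s(1)]
          clinear_add[OF f] r s clinear_scale[OF f] clinear_scale[OF omega(1)])
    ultimately have "r t = r (s t \<otimes>\<^sub>a 1)" by (simp add: r)
    then show "r (t - s t \<otimes>\<^sub>a 1) = 0"
      using cvec_pair.linear_diff[OF r(1)] by simp
  qed
  then show ?thesis by (simp add: s_def)
qed

section \<open>The two sides of the condition defining the box algebra, and the fixed points\<close>

definition M1 :: "('d, 'b) tensor \<Rightarrow> ('dg, 'b) tensor" where
  "M1 = tensor_map \<alpha> id"

definition M2 :: "('d, 'b) tensor \<Rightarrow> ('dg, 'b) tensor" where
  "M2 t = tensor_map (tensor_lift \<iota>) id (assoc_left (tensor_map id \<delta>1 t))"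

lemma M1_hom: "unital_star_hom M1"
  unfolding M1_def by (rule unital_star_hom_tensor_map[OF hom unital_star_hom_id])

lemma M2_hom: "unital_star_hom M2"
  unfolding M2_def[abs_def]
  by (intro unital_star_hom_compose[OF unital_star_hom_tensor_map[OF D1.unital_star_hom_lift_iota unital_star_hom_id]]
      unital_star_hom_compose[OF unital_star_hom_assoc_left]
      unital_star_hom_tensor_map[OF unital_star_hom_id delta_hom(1)])

lemmas M1 = unital_star_homD[OF M1_hom]
lemmas M2 = unital_star_homD[OF M2_hom]

lemma M1_tensor: "M1 (a \<otimes>\<^sub>a b) = \<alpha> a \<otimes>\<^sub>a b"
  by (simp add: M1_def D1.act(1))

lemma M2_X:
  assumes "i < n1 x" "j < n2 x"
  shows "M2 (a \<otimes>\<^sub>a X x i j) = (\<Sum>k<n1 x. \<iota> a (U x i k) \<otimes>\<^sub>a X x k j)"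
  using assms
  by (simp add: M2_def delta1(1) delta1_X tensor_sum clinear_sum[OF clinear_assoc_left]
      clinear_sum[OF clinear_tensor_map] D1.clinear_lift_iota)

lemma M2_one: "M2 (a \<otimes>\<^sub>a 1) = \<iota> a 1 \<otimes>\<^sub>a 1"
  by (simp add: M2_def delta1(1,2) one_tensor_def D1.clinear_lift_iota)

abbreviation "A1 \<equiv> spectral_subalgebra G1 \<iota> \<alpha>"
abbreviation "A2 \<equiv> box_algebra \<iota> \<alpha> A1 \<delta>1"

lemma subspace_A1: "cvec.subspace A1"
  by (simp add: spectral_subalgebra_def)

lemma box_algebra_iff: "t \<in> A2 \<longleftrightarrow> t \<in> tensor_subspace A1 UNIV \<and> M1 t = M2 t"
  by (simp add: box_algebra_def M1_def M2_def)

text \<open>On a \<otimes> 1 the condition defining \<open>A2\<close> reads \<alpha> a = \<iota> a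
  1, since \<delta>1 is unital. Fixed tensors have this form by \<open>box_action_fixed\<close>, and
  slicing with \<omega> keeps a in \<open>A1\<close>.\<close>

lemma fixed_points_box:
  "fixed_points A2 (\<otimes>\<^sub>a) \<beta> = (\<lambda>a. a \<otimes>\<^sub>a 1) ` fixed_points A1 \<iota> \<alpha>"
proof (intro equalityI subsetI)
  fix t assume "t \<in> fixed_points A2 (\<otimes>\<^sub>a) \<beta>"
  then have t: "t \<in> tensor_subspace A1 UNIV" "M1 t = M2 t" "\<beta> t = t \<otimes>\<^sub>a 1"
    by (auto simp: fixed_points_def box_algebra_iff)
  define a where "a = tensor_lift (\<lambda>a b. \<omega> b *\<^sub>C a) t"
  have ta: "t = a \<otimes>\<^sub>a 1" unfolding a_def by (rule box_action_fixed[OF t(3)])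
  have "a \<in> A1" unfolding a_def by (rule tensor_subspace_slice[OF omega(1) t(1) subspace_A1])
  moreover have "\<alpha> a = \<iota> a 1" using t(2) by (simp add: ta M1_tensor M2_one)
  ultimately show "t \<in> (\<lambda>a. a \<otimes>\<^sub>a 1) ` fixed_points A1 \<iota> \<alpha>"
    by (auto simp: ta fixed_points_def)
next
  fix t assume "t \<in> (\<lambda>a. a \<otimes>\<^sub>a (1::'b)) ` fixed_points A1 \<iota> \<alpha>"
  then obtain a where a: "t = a \<otimes>\<^sub>a 1" "a \<in> A1" "\<alpha> a = \<iota> a 1" by (auto simp: fixed_points_def)
  have "t \<in> tensor_subspace A1 UNIV"
    using a unfolding tensor_subspace_def by (intro cvec.span_base) blast
  moreover have "\<beta> t = t \<otimes>\<^sub>a 1"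
    by (simp add: a(1) box_action_tensor delta2(2) one_tensor_def)
  ultimately show "t \<in> fixed_points A2 (\<otimes>\<^sub>a) \<beta>"
    using a by (simp add: fixed_points_def box_algebra_iff M1_tensor M2_one)
qed

lemma fixed_points_isomorphism:
  "star_isomorphism_on (fixed_points A1 \<iota> \<alpha>) (fixed_points A2 (\<otimes>\<^sub>a) \<beta>) (\<lambda>a. a \<otimes>\<^sub>a (1::'b))"
  unfolding star_isomorphism_on_def fixed_points_box
  by (simp add: bij_betw_def inj_on_def one_tensor_def tensor_add tensor_scale)


subsection \<open>The spectral subspaces\<close>

abbreviation "K1 x \<equiv> D1.spectral (\<phi> x)"
abbreviation "K2 \<equiv> spectral_subspace G2 A2 (\<otimes>\<^sub>a) \<beta>"

definition T :: "'x2 \<Rightarrow> 'd mat \<Rightarrow> ('d, 'b) tensor mat" where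
  "T x v = legs (\<otimes>\<^sub>a) v (link_X L x)"

lemma K2_spectral: "w \<in> K2 x \<Longrightarrow> w \<in> D2.spectral x"
  by (simp add: spectral_subspace_iff)

lemma T_carrier: "v \<in> carrier_mat 1 m \<Longrightarrow> T x v \<in> carrier_mat 1 (n2 x)"
  unfolding T_def by (intro carrier_matI) auto

lemma T_entry:
  "v \<in> carrier_mat 1 (n1 x) \<Longrightarrow> j < n2 x \<Longrightarrow> T x v $$ (0, j) = (\<Sum>k<n1 x. v $$ (0, k) \<otimes>\<^sub>a X x k j)"
  by (simp add: T_def)

text \<open>Multiplying on the right by the adjoint of X removes X, whose rows are orthonormal. This
  gives injectivity of \<open>T x\<close> and pulls identities back to the first leg.\<close>

lemma X_cancel:
  fixes a b :: "nat \<Rightarrow> 'c::star_algebra"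
  assumes "\<And>j. j < n2 x \<Longrightarrow> (\<Sum>i<n1 x. a i \<otimes>\<^sub>a X x i j) = (\<Sum>i<n1 x. b i \<otimes>\<^sub>a X x i j)" and k: "k < n1 x"
  shows "a k = b k"
proof -
  have *: "(\<Sum>j<n2 x. (\<Sum>i<n1 x. c i \<otimes>\<^sub>a X x i j) * (1 \<otimes>\<^sub>a star (X x k j))) = c k \<otimes>\<^sub>a 1" for c :: "nat \<Rightarrow> 'c"
  proof -
    have "(\<Sum>j<n2 x. (\<Sum>i<n1 x. c i \<otimes>\<^sub>a X x i j) * (1 \<otimes>\<^sub>a star (X x k j)))
        = (\<Sum>i<n1 x. c i \<otimes>\<^sub>a (\<Sum>j<n2 x. X x i j * star (X x k j)))"
      by (simp add: sum_distrib_right tensor_sum) (rule sum.swap)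
    also have "\<dots> = (\<Sum>i<n1 x. if i = k then c i \<otimes>\<^sub>a 1 else 0)"
      using k by (intro sum.cong refl) (simp add: X_rows)
    finally show ?thesis using k by simp
  qed
  have "a k \<otimes>\<^sub>a (1::'b) = b k \<otimes>\<^sub>a 1"
    using assms unfolding *[symmetric] by (intro sum.cong refl) simp
  then show ?thesis by simp
qed

text \<open>Acting by \<alpha> on v and by \<delta>1 on X inserts the same factor U between v and X,
  which is why the entries lie in \<open>A2\<close>.\<close>

lemma T_spectral:
  assumes v: "v \<in> K1 x"
  shows "T x v \<in> K2 x"
proof (rule D2.spectralI)
  note c = D1.spectralD(1)[OF v] and e = T_entry[OF D1.spectralD(1)[OF v]]
  show "T x v \<in> carrier_mat 1 (n2 x)" by (rule T_carrier[OF c])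
  fix j assume j: "j < n2 x"
  have "T x v $$ (0, j) \<in> tensor_subspace A1 UNIV"
    unfolding e[OF j] tensor_subspace_def
    by (intro cvec.span_sum cvec.span_base) (use D1.spectral_entry_in_subalgebra[OF v] in auto)
  moreover have "M1 (T x v $$ (0, j)) = (\<Sum>k<n1 x. \<Sum>l<n1 x. \<iota> (v $$ (0, l)) (U x l k) \<otimes>\<^sub>a X x k j)"
    by (simp add: e[OF j] clinear_sum[OF M1(1)] M1_tensor D1.spectralD(2)[OF v] tensor_sum)
  moreover have "M2 (T x v $$ (0, j)) = (\<Sum>l<n1 x. \<Sum>k<n1 x. \<iota> (v $$ (0, l)) (U x l k) \<otimes>\<^sub>a X x k j)"
    using j by (simp add: e clinear_sum[OF M2(1)] M2_X)
  ultimately show "T x v $$ (0, j) \<in> A2"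
    by (simp add: box_algebra_iff) (rule sum.swap)
  show "\<beta> (T x v $$ (0, j)) = (\<Sum>k<n2 x. T x v $$ (0, k) \<otimes>\<^sub>a u x k j)"
    using j by (simp add: e D2.act_sum box_action_X tensor_sum) (rule sum.swap)
qed

lemma T_inject:
  assumes v: "v \<in> K1 x" and w: "w \<in> K1 x" and eq: "T x v = T x w"
  shows "v = w"
proof (rule row_mat_eqI)
  note c = D1.spectralD(1)[OF v] D1.spectralD(1)[OF w]
  show "v \<in> carrier_mat 1 (n1 x)" "w \<in> carrier_mat 1 (n1 x)" by (rule c)+
  fix k assume "k < n1 x"
  then show "v $$ (0, k) = w $$ (0, k)"
    by (rule X_cancel[rotated]) (use eq c in \<open>simp add: T_entry[symmetric]\<close>)
qed

lemma T_surjective: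
  assumes w: "w \<in> K2 x"
  obtains v where "v \<in> K1 x" "T x v = w"
proof -
  note w' = K2_spectral[OF w]
  have wA: "w $$ (0, j) \<in> tensor_subspace A1 UNIV" "M1 (w $$ (0, j)) = M2 (w $$ (0, j))" if "j < n2 x" for j
    using w that by (auto simp: spectral_subspace_iff box_algebra_iff)
  define t where "t i = (\<Sum>j<n2 x. w $$ (0, j) * (1 \<otimes>\<^sub>a star (X x i j)))" for i
  have t_fixed: "\<beta> (t i) = t i \<otimes>\<^sub>a 1" if i: "i < n1 x" for i
  proof -
    have s: "\<beta> (1 \<otimes>\<^sub>a star (X x i j)) = (\<Sum>l<n2 x. (1 \<otimes>\<^sub>a star (X x i l)) \<otimes>\<^sub>a star (u x l j))"
      if "j < n2 x" for j
      using D2.act(4)[of "1 \<otimes>\<^sub>a X x i j"] i that by (simp add: box_action_X star_sum)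
    have "\<beta> (t i) = (\<Sum>j<n2 x. \<Sum>k<n2 x. \<Sum>l<n2 x.
        (w $$ (0, k) * (1 \<otimes>\<^sub>a star (X x i l))) \<otimes>\<^sub>a (u x k j * star (u x l j)))"
      by (simp add: t_def D2.act_sum D2.act(3) D2.spectralD(2)[OF w'] s sum_product)
    also have "\<dots> = (\<Sum>k<n2 x. \<Sum>l<n2 x.
        (w $$ (0, k) * (1 \<otimes>\<^sub>a star (X x i l))) \<otimes>\<^sub>a (\<Sum>j<n2 x. u x k j * star (u x l j)))"
      by (subst sum.swap, rule sum.cong[OF refl], subst sum.swap) (simp add: tensor_sum)
    also have "\<dots> = (\<Sum>k<n2 x. \<Sum>l<n2 x.
        if k = l then (w $$ (0, k) * (1 \<otimes>\<^sub>a star (X x i l))) \<otimes>\<^sub>a 1 else 0)"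
      by (intro sum.cong refl) (simp add: unitary_mat_rows[OF D2.irr_unitary D2.irr_carrier])
    also have "\<dots> = t i \<otimes>\<^sub>a 1" by (simp add: t_def tensor_sum)
    finally show ?thesis .
  qed
  define s where "s = tensor_lift (\<lambda>(a::'d) b. \<omega> b *\<^sub>C a)"
  define v where "v = mat 1 (n1 x) (\<lambda>(_, i). s (t i))"
  have v: "v \<in> carrier_mat 1 (n1 x)" by (simp add: v_def)
  have vt: "v $$ (0, i) \<otimes>\<^sub>a 1 = t i" if "i < n1 x" for i
    using box_action_fixed[OF t_fixed[OF that]] that by (simp add: v_def s_def)
  have Tv: "T x v $$ (0, j) = w $$ (0, j)" if j: "j < n2 x" for j
  proof -
    have "T x v $$ (0, j) = (\<Sum>i<n1 x. (v $$ (0, i) \<otimes>\<^sub>a 1) * (1 \<otimes>\<^sub>a X x i j))"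
      using j by (simp add: T_entry[OF v])
    also have "\<dots> = (\<Sum>i<n1 x. \<Sum>l<n2 x. w $$ (0, l) * (1 \<otimes>\<^sub>a (star (X x i l) * X x i j)))"
      by (simp add: vt t_def sum_distrib_right mult.assoc)
    also have "\<dots> = (\<Sum>l<n2 x. w $$ (0, l) * (1 \<otimes>\<^sub>a (\<Sum>i<n1 x. star (X x i l) * X x i j)))"
      by (subst sum.swap) (simp add: sum_distrib_left tensor_sum)
    also have "\<dots> = (\<Sum>l<n2 x. if l = j then w $$ (0, l) else 0)"
      using j by (intro sum.cong refl) (simp add: X_columns flip: one_tensor_def)
    finally show ?thesis using j by simp
  qed
  \<comment> \<open>Membership of the entries of w in \<open>A2\<close> says that \<alpha>(v) and v
    U agree after multiplication by X, and X can be cancelled.\<close>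
  have "v \<in> K1 x"
  proof (rule D1.spectralI[OF v])
    fix i assume "i < n1 x"
    then show "\<alpha> (v $$ (0, i)) = (\<Sum>k<n1 x. \<iota> (v $$ (0, k)) (U x k i))"
    proof (rule X_cancel[rotated])
      fix j assume j: "j < n2 x"
      have "(\<Sum>i<n1 x. \<alpha> (v $$ (0, i)) \<otimes>\<^sub>a X x i j) = M1 (w $$ (0, j))"
        using j by (simp add: Tv[symmetric] T_entry[OF v] clinear_sum[OF M1(1)] M1_tensor)
      also have "\<dots> = (\<Sum>k<n1 x. \<Sum>i<n1 x. \<iota> (v $$ (0, k)) (U x k i) \<otimes>\<^sub>a X x i j)"
        using j unfolding wA(2)[OF j] by (simp add: Tv[symmetric] T_entry[OF v] clinear_sum[OF M2(1)] M2_X)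
      also have "\<dots> = (\<Sum>i<n1 x. (\<Sum>k<n1 x. \<iota> (v $$ (0, k)) (U x k i)) \<otimes>\<^sub>a X x i j)"
        by (subst sum.swap) (simp add: tensor_sum)
      finally show "(\<Sum>i<n1 x. \<alpha> (v $$ (0, i)) \<otimes>\<^sub>a X x i j) =
          (\<Sum>i<n1 x. (\<Sum>k<n1 x. \<iota> (v $$ (0, k)) (U x k i)) \<otimes>\<^sub>a X x i j)" .
    qed
  qed simp
  moreover have "T x v = w"
    by (rule row_mat_eqI[OF T_carrier[OF v] D2.spectralD(1)[OF w'] Tv])
  ultimately show ?thesis using that by blast
qed

lemma T_bij: "bij_betw (T x) (K1 x) (K2 x)"
  unfolding bij_betw_def
proof
  show "inj_on (T x) (K1 x)" using T_inject by (blast intro: inj_onI)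
  show "T x ` K1 x = K2 x" using T_spectral T_surjective by blast
qed

lemma T_bimodule:
  "bimodule_isomorphism (fixed_points A1 \<iota> \<alpha>) (\<lambda>a. a \<otimes>\<^sub>a (1::'b)) (K1 x) (K2 x) (T x)"
  unfolding bimodule_isomorphism_def
proof (intro conjI ballI allI T_bij)
  fix v w assume "v \<in> K1 x" "w \<in> K1 x"
  note c = D1.spectralD(1)[OF this(1)] D1.spectralD(1)[OF this(2)]
  show "T x (v + w) = T x v + T x w"
  proof (rule row_mat_eqI)
    have cs: "v + w \<in> carrier_mat 1 (n1 x)" by (rule add_carrier_mat[OF c(2)])
    show "T x (v + w) \<in> carrier_mat 1 (n2 x)" "T x v + T x w \<in> carrier_mat 1 (n2 x)"
      by (rule T_carrier[OF cs] add_carrier_mat[OF T_carrier[OF c(2)]])+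
    fix j assume "j < n2 x"
    then show "T x (v + w) $$ (0, j) = (T x v + T x w) $$ (0, j)"
      using c T_carrier[OF c(2), of x] by (simp add: T_entry[OF cs] T_entry tensor_add sum.distrib)
  qed
next
  fix v assume "v \<in> K1 x"
  note c = D1.spectralD(1)[OF this]
  note cm = map_carrier_mat[THEN iffD2, OF c]
  note Tc = T_carrier[OF c] T_carrier[OF cm]
  have d: "dim_row (T x v) = 1" "dim_col (T x v) = n2 x" using c by (simp_all add: T_def)
  show "T x (map_mat ((*\<^sub>C) k) v) = map_mat ((*\<^sub>C) k) (T x v)" for k
    by (rule row_mat_eqI[OF Tc(2)]) (use c d in \<open>auto simp: T_entry tensor_scale cvec.scale_sum_right\<close>)
  fix a
  show "T x (map_mat (\<lambda>u. a * u) v) = map_mat (\<lambda>u. (a \<otimes>\<^sub>a 1) * u) (T x v)"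
    by (rule row_mat_eqI[OF Tc(2)]) (use c d in \<open>auto simp: T_entry sum_distrib_left\<close>)
  show "T x (map_mat (\<lambda>u. u * a) v) = map_mat (\<lambda>u. u * (a \<otimes>\<^sub>a 1)) (T x v)"
    by (rule row_mat_eqI[OF Tc(2)]) (use c d in \<open>auto simp: T_entry sum_distrib_right\<close>)
qed

lemma inner_l_T:
  assumes v: "v \<in> K1 x" and w: "w \<in> K1 x"
  shows "inner_l (T x v) (T x w) = inner_l v w \<otimes>\<^sub>a 1"
proof -
  note c = D1.spectralD(1)[OF v] D1.spectralD(1)[OF w]
  have "inner_l (T x v) (T x w) = (\<Sum>j<n2 x. \<Sum>k<n1 x. \<Sum>l<n1 x.
      (v $$ (0, k) * star (w $$ (0, l))) \<otimes>\<^sub>a (X x k j * star (X x l j)))"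
    by (simp add: inner_l_eq[OF T_carrier[OF c(1)] T_carrier[OF c(2)]] T_entry[OF c(1)] T_entry[OF c(2)]
        star_sum sum_product)
  also have "\<dots> = (\<Sum>k<n1 x. \<Sum>l<n1 x.
      (v $$ (0, k) * star (w $$ (0, l))) \<otimes>\<^sub>a (\<Sum>j<n2 x. X x k j * star (X x l j)))"
    by (subst sum.swap, rule sum.cong[OF refl], subst sum.swap) (simp add: tensor_sum)
  also have "\<dots> = (\<Sum>k<n1 x. \<Sum>l<n1 x. if k = l then (v $$ (0, k) * star (w $$ (0, l))) \<otimes>\<^sub>a 1 else 0)"
    by (intro sum.cong refl) (simp add: X_rows)
  also have "\<dots> = inner_l v w \<otimes>\<^sub>a 1" by (simp add: inner_l_eq[OF c] tensor_sum)
  finally show ?thesis .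
qed

section \<open>The right inner product\<close>

text \<open>Apply the invariance of \<omega> under \<delta>1 and then the Haar state of G1. Its
  orthogonality relations produce the form of G1, and the orthonormal columns of X produce the
  condition p = q.\<close>

lemma omega_X:
  assumes kl: "k < n1 x" "l < n1 x" and pq: "p < n2 x" "q < n2 x"
  shows "\<omega> (star (X x k p) * X x l q) = (if p = q then D1.haar_form (\<phi> x) k l else 0)"
proof -
  let ?b = "star (X x k p) * X x l q"
  have "\<omega> ?b *\<^sub>C 1 = (\<Sum>a<n1 x. \<Sum>c<n1 x. \<omega> (star (X x a p) * X x c q) *\<^sub>C (star (U x k a) * U x l c))"
    unfolding omega_invariant[symmetric] using kl pq
    by (simp add: delta1(3,4) delta1_X star_sum sum_product clinear_sum[OF clinear_tensor_slice(2)[OF omega(1)]]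
        tensor_slice_tensor[OF omega(1)])
  from arg_cong[OF this, of "haar G1"]
  have "\<omega> ?b = (\<Sum>a<n1 x. \<Sum>c<n1 x. \<omega> (star (X x a p) * X x c q) * haar G1 (star (U x k a) * U x l c))"
    by (simp add: clinear_scale[OF D1.haar_linear] D1.haar_one clinear_sum[OF D1.haar_linear])
  also have "\<dots> = (\<Sum>a<n1 x. \<Sum>c<n1 x. if a = c then \<omega> (star (X x a p) * X x c q) * D1.haar_form (\<phi> x) k l else 0)"
    using kl by (intro sum.cong refl) (simp add: D1.haar_orthogonality)
  also have "\<dots> = \<omega> (\<Sum>a<n1 x. star (X x a p) * X x a q) * D1.haar_form (\<phi> x) k l"
    by (simp add: clinear_sum[OF omega(1)] sum_distrib_right)
  finally show ?thesis using pq by (simp add: X_columns omega clinear_zero[OF omega(1)])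
qed

lemma haar_form_X:
  assumes kl: "k < n1 x" "l < n1 x"
  shows "(\<Sum>p<n2 x. \<Sum>q<n2 x. D2.haar_form x p q *\<^sub>C (star (X x k p) * X x l q)) =
    D1.haar_form (\<phi> x) k l *\<^sub>C 1" (is "?b = _")
proof -
  let ?F = "D2.haar_form x"
  have "\<delta>2 ?b = (\<Sum>p<n2 x. \<Sum>q<n2 x. \<Sum>a<n2 x. \<Sum>c<n2 x.
      (star (X x k a) * X x l c) \<otimes>\<^sub>a (?F p q *\<^sub>C (star (u x a p) * u x c q)))"
    using kl by (simp add: clinear_sum[OF delta2(1)] clinear_scale[OF delta2(1)] delta2(3,4) delta2_X star_sum
        sum_product cvec.scale_sum_right tensor_scale)
  also have "\<dots> = (\<Sum>p<n2 x. \<Sum>a<n2 x. \<Sum>c<n2 x. \<Sum>q<n2 x.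
      (star (X x k a) * X x l c) \<otimes>\<^sub>a (?F p q *\<^sub>C (star (u x a p) * u x c q)))"
    by (rule sum.cong[OF refl], subst sum.swap, rule sum.cong[OF refl], rule sum.swap)
  also have "\<dots> = (\<Sum>a<n2 x. \<Sum>c<n2 x. \<Sum>p<n2 x. \<Sum>q<n2 x.
      (star (X x k a) * X x l c) \<otimes>\<^sub>a (?F p q *\<^sub>C (star (u x a p) * u x c q)))"
    by (subst sum.swap, rule sum.cong[OF refl], rule sum.swap)
  \<comment> \<open>Invariance of the form of G2 collapses the second leg to a scalar.\<close>
  also have "\<dots> = (\<Sum>a<n2 x. \<Sum>c<n2 x. (star (X x k a) * X x l c) \<otimes>\<^sub>a (?F a c *\<^sub>C 1))"
    by (intro sum.cong refl) (simp add: tensor_sum(2)[symmetric] D2.haar_form_invariant)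
  also have "\<dots> = ?b \<otimes>\<^sub>a 1" by (simp add: tensor_sum tensor_scale)
  finally have "?b = \<omega> ?b *\<^sub>C 1" by (rule delta2_ergodic)
  \<comment> \<open>Only p = q contributes, and the form of G2 has trace 1, so the form of G1
    remains.\<close>
  also have "\<omega> ?b = (\<Sum>p<n2 x. \<Sum>q<n2 x. if p = q then ?F p q * D1.haar_form (\<phi> x) k l else 0)"
    unfolding clinear_sum[OF omega(1)] clinear_scale[OF omega(1)]
    using kl by (intro sum.cong refl) (simp add: omega_X)
  also have "\<dots> = D1.haar_form (\<phi> x) k l"
    using D2.haar_form_trace[of x] by (simp add: sum_distrib_right[symmetric])
  finally show ?thesis .
qed

text \<open>The factors from D are moved to the outer sums; the inner sum over p and q is then the
  one in \<open>haar_form_X\<close>, which converts the weights of G2 into those of G1.\<close>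

lemma inner_r_T:
  assumes v: "v \<in> K1 x" and w: "w \<in> K1 x"
  shows "inner_r (cond_exp G2 (\<otimes>\<^sub>a) \<beta>) (T x v) (T x w) = inner_r (cond_exp G1 \<iota> \<alpha>) v w \<otimes>\<^sub>a 1"
proof -
  note c = D1.spectralD(1)[OF v] D1.spectralD(1)[OF w]
  let ?F = "D2.haar_form x"
  have "inner_r (cond_exp G2 (\<otimes>\<^sub>a) \<beta>) (T x v) (T x w) =
      (\<Sum>p<n2 x. \<Sum>q<n2 x. \<Sum>k<n1 x. \<Sum>l<n1 x.
        (star (v $$ (0, k)) * w $$ (0, l)) \<otimes>\<^sub>a (?F p q *\<^sub>C (star (X x k p) * X x l q)))"
    by (simp add: D2.inner_r_eq[OF K2_spectral[OF T_spectral[OF v]] K2_spectral[OF T_spectral[OF w]]]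
        T_entry[OF c(1)] T_entry[OF c(2)] star_sum sum_product cvec.scale_sum_right tensor_scale)
  also have "\<dots> = (\<Sum>p<n2 x. \<Sum>k<n1 x. \<Sum>l<n1 x. \<Sum>q<n2 x.
        (star (v $$ (0, k)) * w $$ (0, l)) \<otimes>\<^sub>a (?F p q *\<^sub>C (star (X x k p) * X x l q)))"
    by (rule sum.cong[OF refl], subst sum.swap, rule sum.cong[OF refl], rule sum.swap)
  also have "\<dots> = (\<Sum>k<n1 x. \<Sum>l<n1 x. \<Sum>p<n2 x. \<Sum>q<n2 x.
        (star (v $$ (0, k)) * w $$ (0, l)) \<otimes>\<^sub>a (?F p q *\<^sub>C (star (X x k p) * X x l q)))"
    by (subst sum.swap, rule sum.cong[OF refl], rule sum.swap)
  also have "\<dots> = (\<Sum>k<n1 x. \<Sum>l<n1 x. (star (v $$ (0, k)) * w $$ (0, l)) \<otimes>\<^sub>a (D1.haar_form (\<phi> x) k l *\<^sub>C 1))"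
    by (intro sum.cong refl) (simp add: tensor_sum(2)[symmetric] haar_form_X)
  also have "\<dots> = inner_r (cond_exp G1 \<iota> \<alpha>) v w \<otimes>\<^sub>a 1"
    by (simp add: D1.inner_r_eq[OF v w] tensor_sum tensor_scale)
  finally show ?thesis .
qed


subsection \<open>Compatibility with the monoidal structure\<close>

lemma link_relation:
  "S \<in> MorI G2 [y, z] [x] \<Longrightarrow>
    kron (link_X L y) (link_X L z) * amp S = amp (\<Phi> [y, z] [x] S) * link_X L x"
  using link by (simp add: link_algebra_def)

lemma Phi_MorI:
  assumes "S \<in> MorI G2 [y, z] [x]"
  shows "\<Phi> [y, z] [x] S \<in> MorI G1 [\<phi> y, \<phi> z] [\<phi> x]"
proof -
  have "bij_betw (\<Phi> [y, z] [x]) (MorI G2 [y, z] [x]) (MorI G1 (map \<phi> [y, z]) (map \<phi> [x]))"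
    using equivalence[unfolded monoidal_equivalence_def, THEN conjunct2, THEN conjunct2, THEN conjunct1,
        THEN spec[of _ "[y, z]"], THEN spec[of _ "[x]"]]
    by simp
  from bij_betwE[OF this] show ?thesis using assms by simp
qed

lemma phi_triv: "\<phi> (triv G2) = triv G1"
  using equivalence by (simp add: monoidal_equivalence_def)

text \<open>Entries from D and from B occupy different legs and commute, so the product regroups as
  v_13 w_23 times X^x_13 X^y_23, to which the link relation applies.\<close>

lemma T_tensor:
  assumes V: "V \<in> MorI G2 [x, y] [z]" and v: "v \<in> K1 x" and w: "w \<in> K1 y"
  shows "kron (T x v) (T y w) * amp V = T z (kron v w * amp (\<Phi> [x, y] [z] V))"
proof -
  note c = D1.spectralD(1)[OF v] D1.spectralD(1)[OF w]
  let ?V' = "\<Phi> [x, y] [z] V"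
  have V: "V \<in> carrier_mat (n2 x * n2 y) (n2 z)" and V': "?V' \<in> carrier_mat (n1 x * n1 y) (n1 z)"
    using V Phi_MorI[OF V]
    by (simp_all add: MorI_def Mor_def D1.tensor_rep_pair D1.tensor_rep_single D2.tensor_rep_pair D2.tensor_rep_single)
  have rel: "(\<Sum>i<n2 x. \<Sum>j<n2 y. V $$ (i * n2 y + j, m) *\<^sub>C (X x k i * X y l j)) =
      (\<Sum>r<n1 z. ?V' $$ (k * n1 y + l, r) *\<^sub>C X z r m)"
    if "k < n1 x" "l < n1 y" "m < n2 z" for k l m
  proof -
    have "(kron (link_X L x) (link_X L y) * amp V) $$ (k * n1 y + l, m) = (amp ?V' * link_X L z) $$ (k * n1 y + l, m)"
      by (simp add: link_relation[OF assms(1)])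
    moreover have "(amp ?V' * link_X L z) $$ (k * n1 y + l, m) = (\<Sum>r<n1 z. ?V' $$ (k * n1 y + l, r) *\<^sub>C X z r m)"
      using that V' by (subst mult_mat_entry) (auto simp: index_pair_less mult_scaleC_left intro!: sum.cong)
    ultimately show ?thesis
      using kron_mult_amp_entry[of k "link_X L x" l "link_X L y" V m] V that by simp
  qed
  have cv: "kron v w * amp ?V' \<in> carrier_mat 1 (n1 z)" using c V' by (intro carrier_matI) auto
  show ?thesis
  proof (rule row_mat_eqI)
    show "kron (T x v) (T y w) * amp V \<in> carrier_mat 1 (n2 z)"
      using c V by (intro carrier_matI) (auto simp: T_def)
    show "T z (kron v w * amp ?V') \<in> carrier_mat 1 (n2 z)" by (rule T_carrier[OF cv])
    fix m assume m: "m < n2 z"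
    have "(kron (T x v) (T y w) * amp V) $$ (0, m) =
        (\<Sum>i<n2 x. \<Sum>j<n2 y. V $$ (i * n2 y + j, m) *\<^sub>C (T x v $$ (0, i) * T y w $$ (0, j)))"
      using kron_mult_amp_entry[of 0 "T x v" 0 "T y w" V m] m c V T_carrier[OF c(1), of x] T_carrier[OF c(2), of y]
      by simp
    also have "\<dots> = (\<Sum>i<n2 x. \<Sum>j<n2 y. \<Sum>k<n1 x. \<Sum>l<n1 y.
        (v $$ (0, k) * w $$ (0, l)) \<otimes>\<^sub>a (V $$ (i * n2 y + j, m) *\<^sub>C (X x k i * X y l j)))"
      by (simp add: T_entry[OF c(1)] T_entry[OF c(2)] sum_product cvec.scale_sum_right tensor_scale)
    also have "\<dots> = (\<Sum>i<n2 x. \<Sum>k<n1 x. \<Sum>l<n1 y. \<Sum>j<n2 y.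
        (v $$ (0, k) * w $$ (0, l)) \<otimes>\<^sub>a (V $$ (i * n2 y + j, m) *\<^sub>C (X x k i * X y l j)))"
      by (rule sum.cong[OF refl], subst sum.swap, rule sum.cong[OF refl], rule sum.swap)
    also have "\<dots> = (\<Sum>k<n1 x. \<Sum>l<n1 y. \<Sum>i<n2 x. \<Sum>j<n2 y.
        (v $$ (0, k) * w $$ (0, l)) \<otimes>\<^sub>a (V $$ (i * n2 y + j, m) *\<^sub>C (X x k i * X y l j)))"
      by (subst sum.swap, rule sum.cong[OF refl], rule sum.swap)
    also have "\<dots> = (\<Sum>k<n1 x. \<Sum>l<n1 y. (v $$ (0, k) * w $$ (0, l)) \<otimes>\<^sub>a
        (\<Sum>r<n1 z. ?V' $$ (k * n1 y + l, r) *\<^sub>C X z r m))"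
      using m by (intro sum.cong refl) (simp add: tensor_sum(2)[symmetric] rel)
    also have "\<dots> = (\<Sum>k<n1 x. \<Sum>r<n1 z. \<Sum>l<n1 y.
        (?V' $$ (k * n1 y + l, r) *\<^sub>C (v $$ (0, k) * w $$ (0, l))) \<otimes>\<^sub>a X z r m)"
      by (rule sum.cong[OF refl], subst sum.swap) (simp add: tensor_sum tensor_scale)
    also have "\<dots> = (\<Sum>r<n1 z. (\<Sum>k<n1 x. \<Sum>l<n1 y.
        ?V' $$ (k * n1 y + l, r) *\<^sub>C (v $$ (0, k) * w $$ (0, l))) \<otimes>\<^sub>a X z r m)"
      by (subst sum.swap) (simp add: tensor_sum)
    also have "\<dots> = (\<Sum>r<n1 z. (kron v w * amp ?V') $$ (0, r) \<otimes>\<^sub>a X z r m)"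
    proof (intro sum.cong refl)
      fix r assume "r \<in> {..<n1 z}"
      then show "(\<Sum>k<n1 x. \<Sum>l<n1 y. ?V' $$ (k * n1 y + l, r) *\<^sub>C (v $$ (0, k) * w $$ (0, l))) \<otimes>\<^sub>a X z r m =
          (kron v w * amp ?V') $$ (0, r) \<otimes>\<^sub>a X z r m"
        using kron_mult_amp_entry[of 0 v 0 w ?V' r] c V' by simp
    qed
    also have "\<dots> = T z (kron v w * amp ?V') $$ (0, m)"
      by (rule T_entry[OF cv m, symmetric])
    finally show "(kron (T x v) (T y w) * amp V) $$ (0, m) = T z (kron v w * amp ?V') $$ (0, m)" .
  qed
qed


subsection \<open>Contragredients and quantum dimensions under the equivalence\<close>

text \<open>The scalar 1 is an intertwiner from \<epsilon> to \<epsilon> \<otimes> \<epsilon> and is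
  preserved by \<Phi>, so the link relation makes the single entry of X idempotent; a unitary
  idempotent is 1.\<close>

lemma X_triv: "link_X L (triv G2) = 1\<^sub>m 1"
proof -
  let ?e = "triv G2" and ?X = "link_X L (triv G2)"
  have one: "1\<^sub>m 1 \<in> MorI G2 [?e, ?e] [?e]"
    by (simp add: MorI_def Mor_def D2.tensor_rep_pair D2.tensor_rep_single D2.irr_triv)
  have \<Phi>: "\<Phi> [?e, ?e] [?e] (1\<^sub>m 1) = 1\<^sub>m 1"
    using equivalence unfolding monoidal_equivalence_def by (metis D1.hdim_triv D2.hdim_triv)
  have X: "?X \<in> carrier_mat 1 1" using X_carrier[of ?e] by (simp add: phi_triv)
  have "kron ?X ?X = ?X" using link_relation[OF one] left_mult_one_mat[OF X] unfolding \<Phi> by simp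
  from arg_cong[OF this, of "\<lambda>M. M $$ (0, 0)"] X
  have idem: "?X $$ (0, 0) * ?X $$ (0, 0) = ?X $$ (0, 0)"
    using kron_entry[of 0 ?X 0 ?X 0 0] by (simp add: phi_triv)
  have star: "star (?X $$ (0, 0)) * ?X $$ (0, 0) = 1"
    using X_columns[of 0 ?e 0] by (simp add: phi_triv)
  have "?X $$ (0, 0) = (star (?X $$ (0, 0)) * ?X $$ (0, 0)) * ?X $$ (0, 0)" by (simp add: star)
  also have "\<dots> = 1" unfolding mult.assoc idem by (rule star)
  finally show ?thesis using X by (intro eq_matI) auto
qed

text \<open>By \<open>X_triv\<close> the right-hand side of the link relation loses its X and
  becomes a scalar vector, as \<open>kron_maps\<close> demands.\<close>

lemma Phi_pair_triv:
  assumes "S \<in> MorI G2 [y, x] [triv G2]"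
  shows "\<Phi> [y, x] [triv G2] S \<in> MorI G1 [\<phi> y, \<phi> x] [triv G1]"
    and "kron_maps (link_X L y) (link_X L x) (vec_coords (n2 x) S) (vec_coords (n1 x) (\<Phi> [y, x] [triv G2] S))"
proof -
  show M: "\<Phi> [y, x] [triv G2] S \<in> MorI G1 [\<phi> y, \<phi> x] [triv G1]"
    using Phi_MorI[OF assms] by (simp add: phi_triv)
  have S: "S \<in> carrier_mat (n2 y * n2 x) 1" "\<Phi> [y, x] [triv G2] S \<in> carrier_mat (n1 y * n1 x) 1"
    using D2.MorI_pair_triv(1)[OF assms] D1.MorI_pair_triv(1)[OF M] .
  have "kron (link_X L y) (link_X L x) * amp S = amp (\<Phi> [y, x] [triv G2] S)"
    using link_relation[OF assms] S(2) unfolding X_triv by simp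
  then show "kron_maps (link_X L y) (link_X L x) (vec_coords (n2 x) S) (vec_coords (n1 x) (\<Phi> [y, x] [triv G2] S))"
    using kron_mapsI[of "link_X L y" "link_X L x" S] S by simp
qed

text \<open>The transported s is nonzero because the transported pair solves the conjugate equation,
  so uniqueness of the contragredient applies. The quantum dimensions follow by measuring the
  transported pair against the chosen one.\<close>

lemma phi_contra: "\<phi> (contra G2 x) = contra G1 (\<phi> x)"
  and qdim_phi: "qdim G1 (\<phi> x) = qdim G2 x"
proof -
  let ?y = "contra G2 x"
  let ?t = "\<Phi> [x, ?y] [triv G2] (tvec G2 x)" and ?s = "\<Phi> [?y, x] [triv G2] (svec G2 x)"
  let ?N = "vec_coords (n1 ?y) ?t" and ?S = "vec_coords (n1 x) ?s"
  let ?N2 = "vec_coords (n2 ?y) (tvec G2 x)" and ?S2 = "vec_coords (n2 x) (svec G2 x)"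
  let ?N1 = "vec_coords (n1 ?y) (tvec G1 (\<phi> x))" and ?S1 = "vec_coords (n1 x) (svec G1 (\<phi> x))"
  note t = Phi_pair_triv[OF D2.tvec_Mor[of x]] and s = Phi_pair_triv[OF D2.svec_Mor[of x]]
  have conj: "(\<Sum>a<n1 ?y. cnj (?N 0 a) * ?S a 0) = 1"
    using kron_maps_conjugate[OF t(2) s(2) X_unitary X_carrier X_unitary X_carrier D2.conjugate_equation
        D1.hdim_pos D1.hdim_pos]
    by simp
  have "\<not> (\<forall>a<n1 ?y. ?S a 0 = 0)"
  proof
    assume "\<forall>a<n1 ?y. ?S a 0 = 0"
    then have "(\<Sum>a<n1 ?y. cnj (?N 0 a) * ?S a 0) = 0" by simp
    with conj show False by simp
  qed
  then obtain a where a: "a < n1 ?y" "?S a 0 \<noteq> 0" by blast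
  show y: "\<phi> ?y = contra G1 (\<phi> x)"
    by (rule D1.contra_unique[OF s(1) a(1) D1.hdim_pos a(2)])
  obtain c where c: "\<And>k p. k < n1 x \<Longrightarrow> p < n1 ?y \<Longrightarrow> ?N k p = c * ?N1 k p"
    using D1.tvec_span[of ?t "\<phi> x"] t(1) unfolding y by blast
  obtain d where d: "\<And>p k. p < n1 ?y \<Longrightarrow> k < n1 x \<Longrightarrow> ?S p k = d * ?S1 p k"
    using D1.svec_span[of ?s "\<phi> x"] s(1) unfolding y by blast
  \<comment> \<open>The transported and the chosen pair both solve the conjugate equation, which
    ties the two scalars together.\<close>
  have "1 = (\<Sum>a<n1 ?y. (cnj c * d) * (cnj (?N1 0 a) * ?S1 a 0))"
    unfolding conj[symmetric] using D1.hdim_pos by (intro sum.cong refl) (simp add: c d)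
  also have "\<dots> = cnj c * d"
    using D1.conjugate_equation[OF D1.hdim_pos D1.hdim_pos, of "\<phi> x"]
    by (simp add: sum_distrib_left[symmetric] y)
  finally have cd: "cmod c * cmod d = 1" by (metis complex_mod_cnj norm_mult norm_one)
  define r1 r2 where "r1 = Re (qdim G1 (\<phi> x))" "r2 = Re (qdim G2 x)"
  have r: "qdim G1 (\<phi> x) = of_real r1" "0 < r1" "qdim G2 x = of_real r2" "0 < r2"
    using D1.qdim_nonneg[of "\<phi> x"] D2.qdim_nonneg[of x] by (simp_all add: r1_r2_def)
  have "(\<Sum>k<n1 x. \<Sum>p<n1 ?y. cnj (?N k p) * ?N k p) = qdim G2 x"
    unfolding D2.qdim_tvec by (rule kron_maps_norm[OF t(2) X_unitary X_carrier X_unitary X_carrier])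
  also have "(\<Sum>k<n1 x. \<Sum>p<n1 ?y. cnj (?N k p) * ?N k p)
      = (\<Sum>k<n1 x. \<Sum>p<n1 ?y. (c * cnj c) * (cnj (?N1 k p) * ?N1 k p))"
    by (intro sum.cong refl) (simp add: c)
  also have "\<dots> = (c * cnj c) * qdim G1 (\<phi> x)"
    unfolding D1.qdim_tvec y by (simp add: sum_distrib_left)
  finally have "complex_of_real ((cmod c)\<^sup>2 * r1) = of_real r2"
    by (simp only: of_real_mult complex_norm_square r)
  then have c2: "(cmod c)\<^sup>2 * r1 = r2" by (simp only: of_real_eq_iff)
  have "(\<Sum>p<n1 ?y. \<Sum>k<n1 x. cnj (?S p k) * ?S p k) = qdim G2 x"
    unfolding D2.qdim_svec by (rule kron_maps_norm[OF s(2) X_unitary X_carrier X_unitary X_carrier])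
  also have "(\<Sum>p<n1 ?y. \<Sum>k<n1 x. cnj (?S p k) * ?S p k)
      = (\<Sum>p<n1 ?y. \<Sum>k<n1 x. (d * cnj d) * (cnj (?S1 p k) * ?S1 p k))"
    by (intro sum.cong refl) (simp add: d)
  also have "\<dots> = (d * cnj d) * qdim G1 (\<phi> x)"
    unfolding D1.qdim_svec y by (simp add: sum_distrib_left)
  finally have "complex_of_real ((cmod d)\<^sup>2 * r1) = of_real r2"
    by (simp only: of_real_mult complex_norm_square r)
  then have d2: "(cmod d)\<^sup>2 * r1 = r2" by (simp only: of_real_eq_iff)
  \<comment> \<open>The product of the two norm identities is free of c and d, since their moduli
    are inverse to each other.\<close>
  have "r2\<^sup>2 = ((cmod c)\<^sup>2 * r1) * ((cmod d)\<^sup>2 * r1)"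
    unfolding c2 d2 by (rule power2_eq_square)
  also have "\<dots> = (cmod c * cmod d)\<^sup>2 * r1\<^sup>2"
    by (simp add: power2_eq_square mult_ac)
  finally have "r1 = r2"
    using r cd power2_eq_imp_eq[of r1 r2] by simp
  then show "qdim G1 (\<phi> x) = qdim G2 x" using r by simp
qed

end


subsection \<open>Quantum multiplicities\<close>

lemma (in qgroup) normalized_norm:
  assumes "normalized_intertwiners G \<tau>"
  shows "\<tau> x \<in> MorI G [contra G x, x] [triv G]"
    and "(\<Sum>p<hdim G (contra G x). \<Sum>k<hdim G x.
      cnj (vec_coords (hdim G x) (\<tau> x) p k) * vec_coords (hdim G x) (\<tau> x) p k) = qdim G x"
proof -
  show M: "\<tau> x \<in> MorI G [contra G x, x] [triv G]"
    using assms by (simp add: normalized_intertwiners_def)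
  have "(mat_star (\<tau> x) * \<tau> x) $$ (0, 0) = qdim G x"
    using assms by (simp add: normalized_intertwiners_def)
  moreover have "(mat_star (\<tau> x) * \<tau> x) $$ (0, 0) =
      (\<Sum>r<hdim G (contra G x) * hdim G x. cnj (\<tau> x $$ (r, 0)) * \<tau> x $$ (r, 0))"
    using MorI_pair_triv(1)[OF M] by (subst mult_mat_entry) auto
  ultimately show "(\<Sum>p<hdim G (contra G x). \<Sum>k<hdim G x.
      cnj (vec_coords (hdim G x) (\<tau> x) p k) * vec_coords (hdim G x) (\<tau> x) p k) = qdim G x"
    by (simp add: sum_lessThan_mult vec_coords_def)
qed

context box_product
begin

lemma spec_inner_T:
  assumes "v \<in> K1 x" "w \<in> K1 x"
  shows "spec_inner (T x v) (T x w) = spec_inner v w"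
proof -
  have "(c *\<^sub>C 1 :: ('d, 'b) tensor) = (c *\<^sub>C 1) \<otimes>\<^sub>a 1" for c
    by (simp add: one_tensor_def tensor_scale)
  then show ?thesis
    unfolding spec_inner_def inner_l_T[OF assms(2,1)] by (simp only: tensor_one_right_inject)
qed

text \<open>Linearity of T and cancellation of X translate the expansion of v in B into that of T v
  in the image of B. Both directions enter \<open>spec_trace_T\<close>.\<close>

lemma spec_onb_T:
  assumes B: "B \<subseteq> K1 x"
  shows "spec_onb (K2 x) (T x ` B) \<longleftrightarrow> spec_onb (K1 x) B"
proof -
  have inj: "inj_on (T x) B" using B T_inject by (blast intro: inj_onI)
  have dim: "dim_col v = n1 x" "dim_col (T x v) = n2 x" if "v \<in> K1 x" for v
    using D1.spectralD(1)[OF that] by (auto simp: T_def)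
  have exp: "(\<forall>i<n2 x. T x v $$ (0, i) = (\<Sum>e\<in>T x ` B. spec_inner e (T x v) *\<^sub>C e $$ (0, i))) \<longleftrightarrow>
      (\<forall>i<n1 x. v $$ (0, i) = (\<Sum>e\<in>B. spec_inner e v *\<^sub>C e $$ (0, i)))"
    if v: "v \<in> K1 x" for v
  proof -
    let ?w = "\<lambda>k. \<Sum>e\<in>B. spec_inner e v *\<^sub>C e $$ (0, k)"
    have eq: "(\<Sum>e\<in>T x ` B. spec_inner e (T x v) *\<^sub>C e $$ (0, j)) = (\<Sum>k<n1 x. ?w k \<otimes>\<^sub>a X x k j)"
      if j: "j < n2 x" for j
    proof -
      have "(\<Sum>e\<in>T x ` B. spec_inner e (T x v) *\<^sub>C e $$ (0, j)) =
          (\<Sum>e\<in>B. \<Sum>k<n1 x. spec_inner e v *\<^sub>C (e $$ (0, k) \<otimes>\<^sub>a X x k j))"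
        unfolding sum.reindex[OF inj] o_def
      proof (intro sum.cong refl)
        fix e assume "e \<in> B"
        then have e: "e \<in> K1 x" using B by blast
        show "spec_inner (T x e) (T x v) *\<^sub>C T x e $$ (0, j) =
            (\<Sum>k<n1 x. spec_inner e v *\<^sub>C (e $$ (0, k) \<otimes>\<^sub>a X x k j))"
          by (simp add: spec_inner_T[OF e v] T_entry[OF D1.spectralD(1)[OF e] j] cvec.scale_sum_right)
      qed
      also have "\<dots> = (\<Sum>k<n1 x. ?w k \<otimes>\<^sub>a X x k j)"
        by (subst sum.swap) (simp add: tensor_sum tensor_scale)
      finally show ?thesis .
    qed
    show ?thesis
    proof
      assume *: "\<forall>i<n2 x. T x v $$ (0, i) = (\<Sum>e\<in>T x ` B. spec_inner e (T x v) *\<^sub>C e $$ (0, i))"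
      show "\<forall>i<n1 x. v $$ (0, i) = ?w i"
      proof (intro allI impI)
        fix i assume "i < n1 x"
        then show "v $$ (0, i) = ?w i"
        proof (rule X_cancel[rotated])
          fix j assume j: "j < n2 x"
          have "T x v $$ (0, j) = (\<Sum>k<n1 x. ?w k \<otimes>\<^sub>a X x k j)" using * j eq by simp
          then show "(\<Sum>i<n1 x. v $$ (0, i) \<otimes>\<^sub>a X x i j) = (\<Sum>i<n1 x. ?w i \<otimes>\<^sub>a X x i j)"
            by (simp only: T_entry[OF D1.spectralD(1)[OF v] j])
        qed
      qed
    next
      assume *: "\<forall>i<n1 x. v $$ (0, i) = ?w i"
      show "\<forall>i<n2 x. T x v $$ (0, i) = (\<Sum>e\<in>T x ` B. spec_inner e (T x v) *\<^sub>C e $$ (0, i))"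
      proof (intro allI impI)
        fix j assume j: "j < n2 x"
        show "T x v $$ (0, j) = (\<Sum>e\<in>T x ` B. spec_inner e (T x v) *\<^sub>C e $$ (0, j))"
          unfolding eq[OF j] T_entry[OF D1.spectralD(1)[OF v] j]
          by (rule sum.cong[OF refl], rule arg_cong[of _ _ "\<lambda>a. a \<otimes>\<^sub>a _"]) (use * in auto)
      qed
    qed
  qed
  have K2: "K2 x = T x ` K1 x" using T_bij[of x] by (simp add: bij_betw_def)
  have "(\<forall>e\<in>T x ` B. \<forall>f\<in>T x ` B. spec_inner e f = (if e = f then 1 else 0)) \<longleftrightarrow>
      (\<forall>e\<in>B. \<forall>f\<in>B. spec_inner e f = (if e = f then 1 else 0))"
    using B by (auto simp: spec_inner_T subset_iff inj_on_eq_iff[OF inj])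
  moreover have "(\<forall>v\<in>K2 x. \<forall>i<dim_col v. v $$ (0, i) = (\<Sum>e\<in>T x ` B. spec_inner e v *\<^sub>C e $$ (0, i))) \<longleftrightarrow>
      (\<forall>v\<in>K1 x. \<forall>i<dim_col v. v $$ (0, i) = (\<Sum>e\<in>B. spec_inner e v *\<^sub>C e $$ (0, i)))"
    unfolding K2 using exp by (simp add: dim)
  moreover have "T x ` B \<subseteq> K2 x" using B K2 by blast
  ultimately show ?thesis
    using B finite_image_iff[OF inj] by (simp only: spec_onb_def) 
qed

text \<open>The defining predicates of the two traces are shown equal, so the definite descriptions
  agree even where there is no basis. The hypothesis on M is restricted to spaces with a basis,
  where \<open>Lmap_T\<close> can supply it.\<close>

lemma spec_trace_T:
  assumes M: "\<And>B e. spec_onb (K1 x) B \<Longrightarrow> e \<in> K1 x \<Longrightarrow> M e \<in> K1 x \<and> M' (T x e) = T x (M e)"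
  shows "spec_trace (K2 x) M' = spec_trace (K1 x) M"
proof -
  have K2: "K2 x = T x ` K1 x" using T_bij[of x] by (simp add: bij_betw_def)
  have tr: "(\<Sum>e\<in>T x ` B. spec_inner e (M' e)) = (\<Sum>e\<in>B. spec_inner e (M e))"
    if B: "B \<subseteq> K1 x" "spec_onb (K1 x) B" for B
  proof -
    have "inj_on (T x) B" using B T_inject by (blast intro: inj_onI)
    then have "(\<Sum>e\<in>T x ` B. spec_inner e (M' e)) = (\<Sum>e\<in>B. spec_inner (T x e) (M' (T x e)))"
      by (simp add: sum.reindex)
    also have "\<dots> = (\<Sum>e\<in>B. spec_inner e (M e))"
      using B M[OF B(2)] by (intro sum.cong refl) (auto simp: spec_inner_T)
    finally show ?thesis .
  qed
  have "(\<exists>B. spec_onb (K2 x) B \<and> \<tau> = (\<Sum>e\<in>B. spec_inner e (M' e))) \<longleftrightarrow>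
      (\<exists>B. spec_onb (K1 x) B \<and> \<tau> = (\<Sum>e\<in>B. spec_inner e (M e)))" for \<tau>
  proof
    assume "\<exists>B. spec_onb (K2 x) B \<and> \<tau> = (\<Sum>e\<in>B. spec_inner e (M' e))"
    then obtain B' where B': "spec_onb (K2 x) B'" "\<tau> = (\<Sum>e\<in>B'. spec_inner e (M' e))" by blast
    then have "B' \<subseteq> T x ` K1 x" by (simp add: spec_onb_def K2)
    then obtain B where B: "B \<subseteq> K1 x" "B' = T x ` B"
      unfolding subset_image_iff by blast
    with B' spec_onb_T[OF B(1)] tr[OF B(1)]
    show "\<exists>B. spec_onb (K1 x) B \<and> \<tau> = (\<Sum>e\<in>B. spec_inner e (M e))" by auto
  next
    assume "\<exists>B. spec_onb (K1 x) B \<and> \<tau> = (\<Sum>e\<in>B. spec_inner e (M e))"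
    then obtain B where B: "spec_onb (K1 x) B" "\<tau> = (\<Sum>e\<in>B. spec_inner e (M e))" by blast
    then have "B \<subseteq> K1 x" by (simp add: spec_onb_def)
    with B spec_onb_T[of B x] tr[of B]
    show "\<exists>B. spec_onb (K2 x) B \<and> \<tau> = (\<Sum>e\<in>B. spec_inner e (M' e))" by auto
  qed
  then show ?thesis by (simp add: spec_trace_def)
qed

context
  fixes \<tau>1 :: "'x1 \<Rightarrow> complex mat" and \<tau>2 :: "'x2 \<Rightarrow> complex mat"
  assumes \<tau>1: "normalized_intertwiners G1 \<tau>1" and \<tau>2: "normalized_intertwiners G2 \<tau>2"
begin

text \<open>Both intertwiners are multiples of s, by a and b, and have squared norm
  dim_q(\<phi>(x)): one by isometry and \<open>qdim_phi\<close>, the other by normalization. Hence a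
  and b have modulus 1, and the phase is c = a * cnj b.\<close>

lemma Phi_normalized:
  obtains c where "c * cnj c = 1"
    and "\<And>p k. p < n1 (contra G2 x) \<Longrightarrow> k < n1 x \<Longrightarrow>
      vec_coords (n1 x) (\<Phi> [contra G2 x, x] [triv G2] (\<tau>2 x)) p k = c * vec_coords (n1 x) (\<tau>1 (\<phi> x)) p k"
proof -
  let ?y = "contra G2 x"
  let ?s = "\<Phi> [?y, x] [triv G2] (\<tau>2 x)"
  let ?S1 = "vec_coords (n1 x) (svec G1 (\<phi> x))" and ?S = "vec_coords (n1 x) ?s"
  let ?M = "vec_coords (n1 x) (\<tau>1 (\<phi> x))"
  note t1 = D1.normalized_norm[OF \<tau>1, of "\<phi> x", folded phi_contra]
  note t2 = D2.normalized_norm[OF \<tau>2, of x] and s = Phi_pair_triv[OF D2.normalized_norm(1)[OF \<tau>2]]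
  obtain a where a: "\<And>p k. p < n1 ?y \<Longrightarrow> k < n1 x \<Longrightarrow> ?S p k = a * ?S1 p k"
    using D1.svec_span[of ?s "\<phi> x"] s(1)[of x] unfolding phi_contra by blast
  obtain b where b: "\<And>p k. p < n1 ?y \<Longrightarrow> k < n1 x \<Longrightarrow> ?M p k = b * ?S1 p k"
    using D1.svec_span[of "\<tau>1 (\<phi> x)" "\<phi> x"] t1(1) unfolding phi_contra by blast
  have q: "qdim G1 (\<phi> x) \<noteq> 0" using D1.qdim_nonneg(2)[of "\<phi> x"] by auto
  have "qdim G1 (\<phi> x) = (\<Sum>p<n1 ?y. \<Sum>k<n1 x. (a * cnj a) * (cnj (?S1 p k) * ?S1 p k))"
    unfolding qdim_phi t2(2)[symmetric]
      kron_maps_norm[OF s(2) X_unitary X_carrier X_unitary X_carrier, symmetric]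
    by (intro sum.cong refl) (simp add: a)
  also have "\<dots> = (a * cnj a) * qdim G1 (\<phi> x)"
    unfolding D1.qdim_svec phi_contra by (simp add: sum_distrib_left)
  finally have a1: "a * cnj a = 1" using q by simp
  have "qdim G1 (\<phi> x) = (\<Sum>p<n1 ?y. \<Sum>k<n1 x. (b * cnj b) * (cnj (?S1 p k) * ?S1 p k))"
    unfolding t1(2)[symmetric] by (intro sum.cong refl) (simp add: b)
  also have "\<dots> = (b * cnj b) * qdim G1 (\<phi> x)"
    unfolding D1.qdim_svec phi_contra by (simp add: sum_distrib_left)
  finally have b1: "b * cnj b = 1" using q by simp
  have "(a * cnj b) * cnj (a * cnj b) = (a * cnj a) * (b * cnj b)" by simp
  then have "(a * cnj b) * cnj (a * cnj b) = 1" by (simp only: a1 b1 mult_1)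
  moreover have "?S p k = (a * cnj b) * ?M p k" if "p < n1 ?y" "k < n1 x" for p k
  proof -
    have "(a * cnj b) * ?M p k = a * (b * cnj b) * ?S1 p k" using b[OF that] by simp
    then show ?thesis using a[OF that] by (simp only: b1 mult_1_right)
  qed
  ultimately show ?thesis using that by blast
qed

text \<open>The cross relation turns adjoint entries of X for x into entries of X for the
  contragredient. The phase of \<open>Phi_normalized\<close> appears conjugated because R is formed
  with the adjoint of t.\<close>

lemma Rmap_T:
  obtains c where "c * cnj c = 1"
    and "\<And>v i. v \<in> K1 x \<Longrightarrow> i < n2 (contra G2 x) \<Longrightarrow>
      Rmap G2 \<tau>2 x (T x v) $$ (0, i) = cnj c *\<^sub>C T (contra G2 x) (Rmap G1 \<tau>1 (\<phi> x) v) $$ (0, i)"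
proof -
  let ?y = "contra G2 x"
  let ?s = "\<Phi> [?y, x] [triv G2] (\<tau>2 x)"
  let ?M2 = "vec_coords (n2 x) (\<tau>2 x)" and ?M1 = "vec_coords (n1 x) (\<tau>1 (\<phi> x))"
  let ?M = "vec_coords (n1 x) ?s"
  note t1 = D1.normalized_norm(1)[OF \<tau>1, of "\<phi> x", folded phi_contra]
  note t2 = D2.normalized_norm(1)[OF \<tau>2, of x]
  note s = Phi_pair_triv[OF t2]
  note tc = D1.MorI_pair_triv(1)[OF t1] D2.MorI_pair_triv(1)[OF t2]
  obtain c where c: "c * cnj c = 1"
    and cM: "\<And>p k. p < n1 ?y \<Longrightarrow> k < n1 x \<Longrightarrow> ?M p k = c * ?M1 p k"
    using Phi_normalized[of x] by blast
  have "Rmap G2 \<tau>2 x (T x v) $$ (0, i) = cnj c *\<^sub>C T ?y (Rmap G1 \<tau>1 (\<phi> x) v) $$ (0, i)"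
    if v: "v \<in> K1 x" and i: "i < n2 ?y" for v i
  proof -
    note cv = D1.spectralD(1)[OF v]
    have R: "Rmap G1 \<tau>1 (\<phi> x) v \<in> carrier_mat 1 (n1 ?y)"
      using Rmap_carrier[of \<tau>1 "\<phi> x" G1 v] tc(1) cv by (simp add: phi_contra)
    have R1: "Rmap G1 \<tau>1 (\<phi> x) v $$ (0, a) = (\<Sum>k<n1 x. cnj (?M1 a k) *\<^sub>C star (v $$ (0, k)))"
      if "a < n1 ?y" for a
      using Rmap_entry[of \<tau>1 "\<phi> x" G1 v a] tc(1) cv that by (simp add: phi_contra)
    have "Rmap G2 \<tau>2 x (T x v) $$ (0, i) =
        (\<Sum>j<n2 x. \<Sum>k<n1 x. star (v $$ (0, k)) \<otimes>\<^sub>a (cnj (?M2 i j) *\<^sub>C star (X x k j)))"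
      by (simp add: Rmap_entry[where \<tau> = \<tau>2 and x = x, OF tc(2) T_carrier[OF cv] i] T_entry[OF cv] star_sum
          cvec.scale_sum_right tensor_scale)
    also have "\<dots> = (\<Sum>k<n1 x. star (v $$ (0, k)) \<otimes>\<^sub>a (\<Sum>j<n2 x. cnj (?M2 i j) *\<^sub>C star (X x k j)))"
      by (subst sum.swap) (simp add: tensor_sum)
    also have "\<dots> = (\<Sum>k<n1 x. star (v $$ (0, k)) \<otimes>\<^sub>a (\<Sum>a<n1 ?y. cnj (?M a k) *\<^sub>C X ?y a i))"
      using i by (intro sum.cong refl) (simp add: kron_maps_cross_star[OF s(2) X_unitary X_carrier X_carrier])
    also have "\<dots> = (\<Sum>k<n1 x. star (v $$ (0, k)) \<otimes>\<^sub>a (\<Sum>a<n1 ?y. (cnj c * cnj (?M1 a k)) *\<^sub>C X ?y a i))"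
      by (intro sum.cong refl arg_cong[of _ _ "\<lambda>b. _ \<otimes>\<^sub>a b"]) (simp add: cM)
    also have "\<dots> = (\<Sum>a<n1 ?y. cnj c *\<^sub>C (\<Sum>k<n1 x. cnj (?M1 a k) *\<^sub>C star (v $$ (0, k))) \<otimes>\<^sub>a X ?y a i)"
      by (simp add: tensor_sum tensor_scale cvec.scale_sum_right) (rule sum.swap)
    also have "\<dots> = (\<Sum>a<n1 ?y. cnj c *\<^sub>C (Rmap G1 \<tau>1 (\<phi> x) v $$ (0, a) \<otimes>\<^sub>a X ?y a i))"
      by (intro sum.cong refl) (simp add: R1 tensor_scale)
    also have "\<dots> = cnj c *\<^sub>C T ?y (Rmap G1 \<tau>1 (\<phi> x) v) $$ (0, i)"
      by (simp add: T_entry[OF R i] cvec.scale_sum_right)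
    finally show ?thesis .
  qed
  then show ?thesis using c that by blast
qed

text \<open>The phase occurs once plainly and once conjugated, and cancels.\<close>

lemma Rmap_T_inner:
  assumes v: "v \<in> K1 x" and w: "w \<in> K1 x"
  shows "spec_inner (Rmap G2 \<tau>2 x (T x v)) (Rmap G2 \<tau>2 x (T x w)) =
    spec_inner (Rmap G1 \<tau>1 (\<phi> x) v) (Rmap G1 \<tau>1 (\<phi> x) w)"
proof -
  let ?y = "contra G2 x" and ?R1 = "Rmap G1 \<tau>1 (\<phi> x)" and ?R2 = "Rmap G2 \<tau>2 x"
  note t1 = D1.normalized_norm(1)[OF \<tau>1, of "\<phi> x"] and t2 = D2.normalized_norm(1)[OF \<tau>2, of x]
  obtain c where c: "c * cnj c = 1"
    and R: "\<And>v i. v \<in> K1 x \<Longrightarrow> i < n2 ?y \<Longrightarrow> ?R2 (T x v) $$ (0, i) = cnj c *\<^sub>C T ?y (?R1 v) $$ (0, i)"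
    using Rmap_T[of x] by blast
  have R1: "?R1 v \<in> K1 ?y" if "v \<in> K1 x" for v
    using D1.Rmap_spectral[of \<tau>1 "\<phi> x" v] t1 that by (simp add: phi_contra)
  have c2: "?R2 (T x v) \<in> carrier_mat 1 (n2 ?y)" if "v \<in> K1 x" for v
    by (rule Rmap_carrier[where \<tau> = \<tau>2 and x = x, OF D2.MorI_pair_triv(1)[OF t2] T_carrier[OF D1.spectralD(1)[OF that]]])
  have cT: "T ?y (?R1 v) \<in> carrier_mat 1 (n2 ?y)" if "v \<in> K1 x" for v
    by (rule T_carrier[OF D1.spectralD(1)[OF R1[OF that]]])
  have "inner_l (?R2 (T x w)) (?R2 (T x v)) = (\<Sum>i<n2 ?y. (c * cnj c) *\<^sub>C
      (T ?y (?R1 w) $$ (0, i) * star (T ?y (?R1 v) $$ (0, i))))"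
    unfolding inner_l_eq[OF c2[OF w] c2[OF v]]
    by (intro sum.cong refl) (simp add: R[OF w] R[OF v] star_scaleC mult_scaleC_left mult_scaleC_right)
  also have "\<dots> = inner_l (T ?y (?R1 w)) (T ?y (?R1 v))"
    unfolding c inner_l_eq[OF cT[OF w] cT[OF v]] by (simp add: scaleC_one)
  finally have "spec_inner (?R2 (T x v)) (?R2 (T x w)) = spec_inner (T ?y (?R1 v)) (T ?y (?R1 w))"
    by (simp add: spec_inner_def)
  then show ?thesis by (simp add: spec_inner_T[OF R1[OF v] R1[OF w]])
qed

text \<open>The basis guarantees that the adjoint for G1 exists. Since T preserves scalar products
  and maps \<open>K1 x\<close> onto \<open>K2 x\<close>, it transports the characterization of the
  adjoint together with its uniqueness.\<close>

lemma Lmap_T: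
  assumes erg: "ergodic UNIV \<iota> \<alpha>" and B: "spec_onb (K1 x) B" and e: "e \<in> K1 x"
  shows "Lmap G1 \<tau>1 UNIV \<iota> \<alpha> (\<phi> x) e \<in> K1 x \<and>
    Lmap G2 \<tau>2 A2 (\<otimes>\<^sub>a) \<beta> x (T x e) = T x (Lmap G1 \<tau>1 UNIV \<iota> \<alpha> (\<phi> x) e)"
proof -
  let ?R1 = "Rmap G1 \<tau>1 (\<phi> x)" and ?R2 = "Rmap G2 \<tau>2 x"
  let ?P = "\<lambda>v. v \<in> K1 x \<and> (\<forall>w\<in>K1 x. spec_inner w v = spec_inner (?R1 e) (?R1 w))"
  let ?v = "Lmap G1 \<tau>1 UNIV \<iota> \<alpha> (\<phi> x) e"
  note t1 = D1.normalized_norm(1)[OF \<tau>1, of "\<phi> x"]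
  have ex: "\<exists>!v. ?P v"
    by (rule D1.antilinear_adjoint_unique[where \<tau> = \<tau>1 and x = "\<phi> x", OF erg t1 B
          D1.Rmap_spectral[where \<tau> = \<tau>1 and x = "\<phi> x", OF t1 e]])
  have v: "?P ?v"
    unfolding Lmap_def antilinear_adjoint_def by (rule theI'[OF ex])
  have K2: "K2 x = T x ` K1 x" using T_bij[of x] by (simp add: bij_betw_def)
  have "Lmap G2 \<tau>2 A2 (\<otimes>\<^sub>a) \<beta> x (T x e) = T x ?v"
    unfolding Lmap_def[of G2] antilinear_adjoint_def
  proof (rule the_equality)
    show "T x ?v \<in> K2 x \<and> (\<forall>w\<in>K2 x. spec_inner w (T x ?v) = spec_inner (?R2 (T x e)) (?R2 w))"
      using v e unfolding K2 by (auto simp: spec_inner_T Rmap_T_inner)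
    fix v' assume v': "v' \<in> K2 x \<and> (\<forall>w\<in>K2 x. spec_inner w v' = spec_inner (?R2 (T x e)) (?R2 w))"
    then obtain a where a: "a \<in> K1 x" "v' = T x a" unfolding K2 by blast
    have "?P a" using v' a e unfolding K2 by (auto simp: spec_inner_T Rmap_T_inner)
    then show "v' = T x ?v" using ex v a by blast
  qed
  with v show ?thesis by blast
qed

text \<open>The second factor of the multiplicity belongs to the contragredient, which
  \<open>phi_contra\<close> matches.\<close>

lemma mult_q_T:
  assumes erg: "ergodic UNIV \<iota> \<alpha>"
  shows "mult_q G2 \<tau>2 A2 (\<otimes>\<^sub>a) \<beta> x = mult_q G1 \<tau>1 UNIV \<iota> \<alpha> (\<phi> x)"
proof -
  have "spec_trace (K2 x) (Lmap G2 \<tau>2 A2 (\<otimes>\<^sub>a) \<beta> x) = spec_trace (K1 x) (Lmap G1 \<tau>1 UNIV \<iota> \<alpha> (\<phi> x))" for x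
    by (rule spec_trace_T) (rule Lmap_T[OF erg])
  from this[of x] this[of "contra G2 x"] show ?thesis
    by (simp add: mult_q_def phi_contra)
qed

end

text \<open>Ergodicity is assumed on all of D, whereas item 1 speaks of fixed points in
  \<open>A1\<close>; the scalars lie in \<open>A1\<close>, so the two sets agree.\<close>

lemma ergodic_box:
  assumes "ergodic UNIV \<iota> \<alpha>"
  shows "ergodic A2 (\<otimes>\<^sub>a) \<beta>"
proof -
  have "fixed_points A1 \<iota> \<alpha> = A1 \<inter> range (\<lambda>c. c *\<^sub>C 1)"
    using assms by (auto simp: ergodic_def fixed_points_def)
  moreover have "range (\<lambda>c. c *\<^sub>C 1) \<subseteq> A1"
    using cvec.subspace_scale[OF subspace_A1 D1.one_in_spectral_subalgebra] by blast
  ultimately have "fixed_points A1 \<iota> \<alpha> = range (\<lambda>c. c *\<^sub>C 1)" by blast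
  then show ?thesis
    by (simp add: ergodic_def fixed_points_box image_image tensor_scale one_tensor_def)
qed

end

theorem theorem7p3:
  fixes G1 :: "('g1::cstar_algebra, 'gg1::cstar_algebra, 'ggg1::cstar_algebra, 'x1) cqg"
    and G2 :: "('g2::cstar_algebra, 'gg2::cstar_algebra, 'ggg2::cstar_algebra, 'x2) cqg"
    and \<phi> :: "'x2 \<Rightarrow> 'x1"
    and \<Phi> :: "'x2 list \<Rightarrow> 'x2 list \<Rightarrow> complex mat \<Rightarrow> complex mat"
    and L :: "('x2, 'g1, 'g2, 'b::star_algebra) link"
    and \<iota> :: "'d::cstar_algebra \<Rightarrow> 'g1 \<Rightarrow> 'dg::cstar_algebra"
    and \<iota>l :: "'dg \<Rightarrow> 'g1 \<Rightarrow> 'dgg::cstar_algebra"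
    and \<iota>r :: "'d \<Rightarrow> 'gg1 \<Rightarrow> 'dgg"
    and \<alpha>1 :: "'d \<Rightarrow> 'dg"
    and \<tau>1 :: "'x1 \<Rightarrow> complex mat"
    and \<tau>2 :: "'x2 \<Rightarrow> complex mat"
  assumes "quantum_group_data G1" and "quantum_group_data G2"
    and "monoidal_equivalence G2 G1 \<phi> \<Phi>"
    and "link_algebra G2 G1 \<phi> \<Phi> L" and "link_actions G2 G1 \<phi> L"
    and "cstar_action G1 \<iota> \<iota>l \<iota>r \<alpha>1"
    and "normalized_intertwiners G1 \<tau>1" and "normalized_intertwiners G2 \<tau>2"
  defines "A1 \<equiv> spectral_subalgebra G1 \<iota> \<alpha>1"
  defines "A2 \<equiv> box_algebra \<iota> \<alpha>1 A1 (link_act1 L)"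
    and "\<alpha>2 \<equiv> box_action (link_act2 L) :: ('d, 'b) tensor \<Rightarrow> (('d, 'b) tensor, 'g2) tensor"
    and "K1 \<equiv> spectral_subspace G1 UNIV \<iota> \<alpha>1"
    and "E1 \<equiv> cond_exp G1 \<iota> \<alpha>1"
    and "\<theta> \<equiv> \<lambda>a. a \<otimes>\<^sub>a (1::'b)"
    and "T \<equiv> \<lambda>x v. legs (\<otimes>\<^sub>a) v (link_X L x)"
  defines "K2 \<equiv> spectral_subspace G2 A2 (\<otimes>\<^sub>a) \<alpha>2"
    and "E2 \<equiv> cond_exp G2 (\<otimes>\<^sub>a) \<alpha>2"
  shows "star_isomorphism_on (fixed_points A1 \<iota> \<alpha>1) (fixed_points A2 (\<otimes>\<^sub>a) \<alpha>2) \<theta> \<and>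
         (\<forall>x. bimodule_isomorphism (fixed_points A1 \<iota> \<alpha>1) \<theta> (K1 (\<phi> x)) (K2 x) (T x) \<and>
             hilbert_module_unitary \<theta> (K1 (\<phi> x)) inner_l (K2 x) inner_l (T x) \<and>
             hilbert_module_unitary \<theta> (K1 (\<phi> x)) (inner_r E1) (K2 x) (inner_r E2) (T x)) \<and>
         (\<forall>x y z. \<forall>V \<in> MorI G2 [x, y] [z]. \<forall>v \<in> K1 (\<phi> x). \<forall>w \<in> K1 (\<phi> y).
           kron (T x v) (T y w) * amp V = T z (kron v w * amp (\<Phi> [x, y] [z] V))) \<and>
         (ergodic UNIV \<iota> \<alpha>1 \<longrightarrow> ergodic A2 (\<otimes>\<^sub>a) \<alpha>2 \<and>
           (\<forall>x. mult_q G2 \<tau>2 A2 (\<otimes>\<^sub>a) \<alpha>2 x = mult_q G1 \<tau>1 UNIV \<iota> \<alpha>1 (\<phi> x)))"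
proof -
  interpret B: box_product G1 G2 \<phi> \<Phi> L \<iota> \<alpha>1
    by unfold_locales (use assms(1-6) in \<open>auto simp: cstar_action_def cstar_triple_tensor_def\<close>)
  have T: "T = B.T" by (intro ext) (simp add: T_def B.T_def)
  note defs = A2_def A1_def \<alpha>2_def K1_def E1_def \<theta>_def K2_def E2_def
  show ?thesis
    unfolding T unfolding defs
    by (intro conjI allI ballI impI B.fixed_points_isomorphism B.T_bimodule B.T_tensor B.ergodic_box
        B.mult_q_T[OF assms(7,8)] hilbert_module_unitaryI[OF B.T_bij] B.inner_l_T B.inner_r_T)
qed

end
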